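(* Let $\Bbbk$ be a field and let $\Delta$ be a simplicial complex with $\operatorname{depth}\Bbbk[\Delta]\ge\dim\Bbbk[\Delta]-1$. Then for any simplicial complex $\Gamma$ that is Cohen--Macaulay over $\Bbbk$, has the same dimension as $\Delta$, and contains $\Delta$, the relative complex $(\Gamma,\Delta)$ is relative Cohen--Macaulay over $\Bbbk$.
   Context: All simplicial complexes are finite: a simplicial complex is a collection of finite subsets of a finite ground set, closed under taking subsets; $\dim\sigma=|\sigma|-1$, and a $d$-dimensional complex ($d\ge-1$) contains the empty face. $\Bbbk[\Delta]=\Bbbk[x_1,\dots,x_n]/I_\Delta$ is the Stanley--Reisner ring, where $I_\Delta$ is the ideal generated by the squarefree monomials of non-faces of $\Delta$; for $\dim\Delta=d$ one has $\dim\Bbbk[\Delta]=d+1$. A complex $\Gamma$ is Cohen--Macaulay (over $\Bbbk$) if $\operatorname{depth}\Bbbk[\Gamma]=\dim\Bbbk[\Gamma]$; equivalently, $\tilde H_i(\operatorname{lk}_\Gamma(\sigma);\Bbbk)=0$ for all $\sigma\in\Gamma$ and all $i\ne\dim\Gamma-|\sigma|$, where $\operatorname{lk}_\Gamma(\sigma)=\{\tau\in\Gamma : \sigma\cup\tau\in\Gamma,\ \sigma\cap\tau=\varnothing\}$. For a subcomplex $\Delta\subseteq\Gamma$ with $\dim\Gamma=d$, the relative complex $(\Gamma,\Delta)$ (the faces of $\Gamma$ not in $\Delta$) is relative Cohen--Macaulay if $I_\Delta/I_\Gamma$ is a Cohen--Macaulay module over the polynomial ring $\Bbbk[\mathbf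 x]$ on the vertices of $\Gamma$ (the zero module being allowed). Equivalently, for every $\sigma\in\Gamma$ the relative homology $\tilde H_i(\operatorname{lk}_\Gamma(\sigma),\operatorname{lk}_\Delta(\sigma);\Bbbk)$ vanishes except possibly when $|\sigma|+i=d$, where $\operatorname{lk}_\Delta(\sigma)$ is the void complex if $\sigma\notin\Delta$, in which case the relative homology is $\tilde H_i(\operatorname{lk}_\Gamma(\sigma);\Bbbk)$. *)

theory Defs
  imports
    "HOL-Algebra.QuotRing"
    "HOL-Algebra.Module"
    "HOL-Library.Poly_Mapping"
    "HOL-Library.Extended_Real"
begin

section \<open>Commutative algebra\<close>

text \<open>
  Suprema are taken in \<^typ>\<open>ereal\<close>: the zero ring has no prime ideals, hence
  dimension \<open>- \<infinity>\<close>; no sequence is regular on the zero module, hence its depth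
  is \<open>- \<infinity>\<close> as well.
\<close>

definition krull_dim :: "('a, 'b) ring_scheme \<Rightarrow> ereal" where
  "krull_dim R = Sup {ereal (real n) | n P.
     (\<forall>i\<le>n. primeideal (P i) R) \<and> (\<forall>i<n. P i \<subset> P (Suc i))}"

definition ideal_module :: "('a, 'b) ring_scheme \<Rightarrow> 'a set \<Rightarrow> ('a, 'a) module" where
  "ideal_module R I =
    \<lparr>carrier = I, mult = mult R, one = \<one>\<^bsub>R\<^esub>, zero = \<zero>\<^bsub>R\<^esub>, add = add R, smult = mult R\<rparr>"

text \<open>
  The quotient of a module by a submodule. The fields \<open>mult\<close> and \<open>one\<close> play no role
  for modules; they are filled in as in \<^const>\<open>FactRing\<close>.
\<close>

definition quotient_module ::
    "('r, 'a, 'b) module_scheme \<Rightarrow> 'a set \<Rightarrow> ('r, 'a set) module" where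
  "quotient_module M N =
    \<lparr>carrier = a_rcosets\<^bsub>M\<^esub> N, mult = rcoset_mult M N, one = N +>\<^bsub>M\<^esub> \<one>\<^bsub>M\<^esub>,
     zero = N, add = set_add M, smult = (\<lambda>r X. \<Union>x\<in>X. N +>\<^bsub>M\<^esub> (r \<odot>\<^bsub>M\<^esub> x))\<rparr>"

text \<open>The submodule \<open>(f\<^sub>1, \<dots>, f\<^sub>k) M\<close> of \<open>M\<close>.\<close>

definition seq_smult ::
    "('r, 'c) ring_scheme \<Rightarrow> ('r, 'a, 'b) module_scheme \<Rightarrow> 'r list \<Rightarrow> 'a set" where
  "seq_smult R M fs =
     \<Inter>{N. submodule N R M \<and> (\<forall>f\<in>set fs. \<forall>x\<in>carrier M. f \<odot>\<^bsub>M\<^esub> x \<in> N)}"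

definition regular_element ::
    "('r, 'c) ring_scheme \<Rightarrow> ('r, 'a, 'b) module_scheme \<Rightarrow> 'r \<Rightarrow> bool" where
  "regular_element R M f \<longleftrightarrow>
     f \<in> carrier R \<and> (\<forall>x\<in>carrier M. f \<odot>\<^bsub>M\<^esub> x = \<zero>\<^bsub>M\<^esub> \<longrightarrow> x = \<zero>\<^bsub>M\<^esub>)"

definition regular_sequence ::
    "('r, 'c) ring_scheme \<Rightarrow> ('r, 'a, 'b) module_scheme \<Rightarrow> 'r list \<Rightarrow> bool" where
  "regular_sequence R M fs \<longleftrightarrow>
     (\<forall>i<length fs. regular_element R (quotient_module M (seq_smult R M (take i fs))) (fs ! i)) \<and>
     seq_smult R M fs \<noteq> carrier M"

definition depth ::
    "('r, 'c) ring_scheme \<Rightarrow> 'r set \<Rightarrow> ('r, 'a, 'b) module_scheme \<Rightarrow> ereal" where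
  "depth R \<mm> M =
     Sup {ereal (real (length fs)) | fs. set fs \<subseteq> \<mm> \<and> regular_sequence R M fs}"

definition annihilator ::
    "('r, 'c) ring_scheme \<Rightarrow> ('r, 'a, 'b) module_scheme \<Rightarrow> 'r set" where
  "annihilator R M = {r \<in> carrier R. \<forall>x\<in>carrier M. r \<odot>\<^bsub>M\<^esub> x = \<zero>\<^bsub>M\<^esub>}"

definition module_dim ::
    "('r, 'c) ring_scheme \<Rightarrow> ('r, 'a, 'b) module_scheme \<Rightarrow> ereal" where
  "module_dim R M = krull_dim (R Quot annihilator R M)"

text \<open>
  Used only for finitely generated graded modules over a standard graded polynomial ring
  with irrelevant maximal ideal \<open>\<mm>\<close>. The zero module counts as Cohen--Macaulay.
\<close>

definition cohen_macaulay_module ::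
    "('r, 'c) ring_scheme \<Rightarrow> 'r set \<Rightarrow> ('r, 'a, 'b) module_scheme \<Rightarrow> bool" where
  "cohen_macaulay_module R \<mm> M \<longleftrightarrow>
     carrier M = {\<zero>\<^bsub>M\<^esub>} \<or> depth R \<mm> M = module_dim R M"


section \<open>Polynomial rings\<close>

text \<open>
  Monomials are finitely supported exponent vectors \<^typ>\<open>'v \<Rightarrow>\<^sub>0 nat\<close>; a polynomial is a
  finitely supported map from monomials to coefficients, multiplied by convolution.
  \<open>poly_ring V\<close> consists of the polynomials in the variables \<open>x\<^sub>v\<close> with \<open>v \<in> V\<close>.
\<close>

type_synonym ('v, 'k) mpoly = "('v \<Rightarrow>\<^sub>0 nat) \<Rightarrow>\<^sub>0 'k"

definition poly_ring :: "'v set \<Rightarrow> ('v, 'k::field) mpoly ring" where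
  "poly_ring V =
    \<lparr>carrier = {p. \<forall>m\<in>Poly_Mapping.keys p. Poly_Mapping.keys m \<subseteq> V}, mult = (*), one = 1, zero = 0, add = (+)\<rparr>"

definition var :: "'v \<Rightarrow> ('v, 'k::field) mpoly" where
  "var v = Poly_Mapping.single (Poly_Mapping.single v 1) 1"

definition irrelevant_ideal :: "'v set \<Rightarrow> ('v, 'k::field) mpoly set" where
  "irrelevant_ideal V = Idl\<^bsub>poly_ring V\<^esub> (var ` V)"


section \<open>Simplicial complexes\<close>

text \<open>
  \<open>V\<close> is the ground set; not every element of \<open>V\<close> has to be a vertex. The void complex
  \<open>{}\<close>, of dimension \<open>- \<infinity>\<close>, is permitted.
\<close>

definition simplicial_complex :: "'v set \<Rightarrow> 'v set set \<Rightarrow> bool" where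
  "simplicial_complex V \<Delta> \<longleftrightarrow>
     finite V \<and> \<Delta> \<subseteq> Pow V \<and> (\<forall>\<sigma>\<in>\<Delta>. \<forall>\<tau>. \<tau> \<subseteq> \<sigma> \<longrightarrow> \<tau> \<in> \<Delta>)"

definition complex_dim :: "'v set set \<Rightarrow> ereal" where
  "complex_dim \<Delta> = (SUP \<sigma>\<in>\<Delta>. ereal (real (card \<sigma>) - 1))"

definition SR_ideal :: "'v set \<Rightarrow> 'v set set \<Rightarrow> ('v, 'k::field) mpoly set" where
  "SR_ideal V \<Delta> = Idl\<^bsub>poly_ring V\<^esub> {\<Prod>v\<in>\<sigma>. var v | \<sigma>. \<sigma> \<subseteq> V \<and> \<sigma> \<notin> \<Delta>}"

text \<open>The argument of type \<open>'k itself\<close> selects the coefficient field.\<close>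

definition SR_ring ::
    "'k::field itself \<Rightarrow> 'v set \<Rightarrow> 'v set set \<Rightarrow> ('v, 'k) mpoly set ring" where
  "SR_ring k V \<Delta> = poly_ring V Quot SR_ideal V \<Delta>"

definition SR_module ::
    "'k::field itself \<Rightarrow> 'v set \<Rightarrow> 'v set set \<Rightarrow> (('v, 'k) mpoly, ('v, 'k) mpoly set) module" where
  "SR_module k V \<Delta> =
     quotient_module (ideal_module (poly_ring V) (carrier (poly_ring V))) (SR_ideal V \<Delta>)"

definition SR_depth :: "'k::field itself \<Rightarrow> 'v set \<Rightarrow> 'v set set \<Rightarrow> ereal" where
  "SR_depth k V \<Delta> = depth (poly_ring V) (irrelevant_ideal V) (SR_module k V \<Delta>)"

definition cohen_macaulay_complex :: "'k::field itself \<Rightarrow> 'v set \<Rightarrow> 'v set set \<Rightarrow> bool" where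
  "cohen_macaulay_complex k V \<Gamma> \<longleftrightarrow> SR_depth k V \<Gamma> = krull_dim (SR_ring k V \<Gamma>)"

text \<open>The module \<open>I\<^sub>\<Delta> / I\<^sub>\<Gamma>\<close> over the polynomial ring on \<open>V\<close>.\<close>

definition relative_SR_module ::
    "'k::field itself \<Rightarrow> 'v set \<Rightarrow> 'v set set \<Rightarrow> 'v set set \<Rightarrow>
      (('v, 'k) mpoly, ('v, 'k) mpoly set) module" where
  "relative_SR_module k V \<Gamma> \<Delta> =
     quotient_module (ideal_module (poly_ring V) (SR_ideal V \<Delta>)) (SR_ideal V \<Gamma>)"

text \<open>\<open>\<Union>\<Gamma>\<close> is the vertex set of \<open>\<Gamma>\<close>.\<close>

definition relative_cohen_macaulay ::
    "'k::field itself \<Rightarrow> 'v set set \<Rightarrow> 'v set set \<Rightarrow> bool" where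
  "relative_cohen_macaulay k \<Gamma> \<Delta> \<longleftrightarrow>
     cohen_macaulay_module (poly_ring (\<Union>\<Gamma>)) (irrelevant_ideal (\<Union>\<Gamma>))
       (relative_SR_module k (\<Union>\<Gamma>) \<Gamma> \<Delta>)"


section \<open>Well-formedness of the constructions\<close>

lemma cring_poly_ring: "cring (poly_ring V :: ('v, 'k::field) mpoly ring)"
proof -
  let ?C = "{p :: ('v, 'k) mpoly. \<forall>m\<in>Poly_Mapping.keys p. Poly_Mapping.keys m \<subseteq> V}"
  have add: "p + q \<in> ?C" if "p \<in> ?C" "q \<in> ?C" for p q
    using that Poly_Mapping.keys_add[of p q] by blast
  have mult: "p * q \<in> ?C" if "p \<in> ?C" "q \<in> ?C" for p q
  proof -
    have "Poly_Mapping.keys m \<subseteq> V" if m: "m \<in> Poly_Mapping.keys (p * q)" for m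
    proof -
      obtain a b where "m = a + b" "a \<in> Poly_Mapping.keys p" "b \<in> Poly_Mapping.keys q"
        using m keys_mult[of p q] by auto
      then show ?thesis
        using \<open>p \<in> ?C\<close> \<open>q \<in> ?C\<close> Poly_Mapping.keys_add[of a b] by blast
    qed
    then show ?thesis by blast
  qed
  have neg: "- p \<in> ?C" if "p \<in> ?C" for p
    using that by simp
  have zero: "0 \<in> ?C" by simp
  have inv: "\<exists>q\<in>?C. q + p = 0" if "p \<in> ?C" for p
    by (rule bexI[of _ "- p"]) (use neg[OF that] in auto)
  have one: "1 \<in> ?C" by simp
  have ag: "abelian_group (poly_ring V :: ('v, 'k) mpoly ring)"
    by (rule abelian_groupI, unfold poly_ring_def ring.simps partial_object.simps)
      (rule add inv zero | simp add: add.assoc add.commute | assumption)+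
  have cm: "comm_monoid (poly_ring V :: ('v, 'k) mpoly ring)"
    by (rule comm_monoidI, unfold poly_ring_def monoid.simps partial_object.simps)
      (rule mult one | simp add: mult.assoc mult.commute | assumption)+
  show ?thesis
    by (rule cringI[OF ag cm]) (simp add: poly_ring_def distrib_right)
qed

lemma ideal_SR_ideal:
  shows "ideal (SR_ideal V \<Delta> :: ('v, 'k::field) mpoly set) (poly_ring V)"
proof -
  interpret R: cring "poly_ring V :: ('v, 'k) mpoly ring" by (rule cring_poly_ring)
  show ?thesis unfolding SR_ideal_def
  proof (rule R.genideal_ideal, safe)
    fix \<sigma> assume s: "\<sigma> \<subseteq> V"
    show "(\<Prod>v\<in>\<sigma>. var v :: ('v, 'k) mpoly) \<in> carrier (poly_ring V)"
      using s
    proof (induction \<sigma> rule: infinite_finite_induct)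
      case (insert x F)
      have v: "(var x:: ('v, 'k) mpoly)  \<in> carrier (poly_ring V)"
        using insert.prems by (auto simp: var_def poly_ring_def)
      with insert show ?case using R.m_closed[OF v] by (simp add: poly_ring_def)
    qed (use R.one_closed in \<open>auto simp: poly_ring_def\<close>)
  qed
qed

lemma module_ideal_module:
  assumes "cring R" "ideal I R" shows "Module.module R (ideal_module R I)"
proof -
  interpret cring R by fact
  interpret ideal I R by fact
  have inv: "\<exists>y\<in>I. y \<oplus>\<^bsub>R\<^esub> x = \<zero>\<^bsub>R\<^esub>" if "x \<in> I" for x
    by (rule bexI[of _ "\<ominus>\<^bsub>R\<^esub> x"]) (use that in \<open>auto intro: l_neg\<close>)
  have ag: "abelian_group (ideal_module R I)"
    by (rule abelian_groupI, unfold ideal_module_def ring.simps)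
      (use inv in \<open>simp_all add: a_assoc Icarr, simp add: a_comm Icarr\<close>)
  show ?thesis
    by (rule moduleI[OF cring_axioms ag])
      (simp_all add: ideal_module_def I_l_closed l_distr r_distr m_assoc Icarr)
qed

lemma module_quotient_module:
  assumes "Module.module R M" "submodule N R M" shows "Module.module R (quotient_module M N)"
proof -
  interpret Module.module R M by fact
  interpret N: submodule N R M by fact
  have ab: "abelian_subgroup N M" 
    by (intro abelian_subgroupI3 additive_subgroupI N.subgroup_axioms M.abelian_group_axioms)
  interpret N: abelian_subgroup N M by fact
  have rep: "\<exists>x\<in>carrier M. X = N +>\<^bsub>M\<^esub> x" if "X \<in> a_rcosets\<^bsub>M\<^esub> N" for X
    using that by (auto simp: A_RCOSETS_def')
  have add: "(N +>\<^bsub>M\<^esub> x) <+>\<^bsub>M\<^esub> (N +>\<^bsub>M\<^esub> y) = N +>\<^bsub>M\<^esub> (x \<oplus>\<^bsub>M\<^esub> y)"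
    if "x \<in> carrier M" "y \<in> carrier M" for x y using that by (rule N.a_rcos_sum)
  have sm: "(\<Union>x\<in>N +>\<^bsub>M\<^esub> y. N +>\<^bsub>M\<^esub> (r \<odot>\<^bsub>M\<^esub> x)) = N +>\<^bsub>M\<^esub> (r \<odot>\<^bsub>M\<^esub> y)"
    if ry: "r \<in> carrier R" "y \<in> carrier M" for r y
  proof -
    have "N +>\<^bsub>M\<^esub> (r \<odot>\<^bsub>M\<^esub> x) = N +>\<^bsub>M\<^esub> (r \<odot>\<^bsub>M\<^esub> y)" if xN: "x \<in> N +>\<^bsub>M\<^esub> y" for x
    proof -
      obtain h where h: "h \<in> N" "x = h \<oplus>\<^bsub>M\<^esub> y" using xN unfolding a_r_coset_def' by blast
      have hc: "h \<in> carrier M" using h(1) by (rule N.a_Hcarr)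
      have eq: "r \<odot>\<^bsub>M\<^esub> x = r \<odot>\<^bsub>M\<^esub> h \<oplus>\<^bsub>M\<^esub> r \<odot>\<^bsub>M\<^esub> y"
        using h(2) hc ry by (simp only: smult_r_distr)
      have "r \<odot>\<^bsub>M\<^esub> h \<in> N" using N.smult_closed[OF ry(1) h(1)] .
      then have "r \<odot>\<^bsub>M\<^esub> x \<in> N +>\<^bsub>M\<^esub> (r \<odot>\<^bsub>M\<^esub> y)"
        unfolding a_r_coset_def' eq by blast
      then show ?thesis by (rule N.a_repr_independence'[symmetric]) (rule smult_closed[OF ry])
    qed
    then have "(\<Union>x\<in>N +>\<^bsub>M\<^esub> y. N +>\<^bsub>M\<^esub> (r \<odot>\<^bsub>M\<^esub> x)) = (\<Union>x\<in>N +>\<^bsub>M\<^esub> y. N +>\<^bsub>M\<^esub> (r \<odot>\<^bsub>M\<^esub> y))"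
      by (rule SUP_cong[OF refl])
    moreover have "y \<in> N +>\<^bsub>M\<^esub> y" using ry(2) by (rule N.a_rcos_self) 
    then have "N +>\<^bsub>M\<^esub> y \<noteq> {}" by (metis empty_iff)
    ultimately show ?thesis by (simp only: UN_constant if_False)
  qed
  have zero: "N +>\<^bsub>M\<^esub> \<zero>\<^bsub>M\<^esub> = N" by (rule M.a_coset_add_zero[OF N.a_subset])
  have cr: "N +>\<^bsub>M\<^esub> x \<in> a_rcosets\<^bsub>M\<^esub> N" if "x \<in> carrier M" for x
    using that by (auto simp: A_RCOSETS_def')
  have Nc: "N \<in> a_rcosets\<^bsub>M\<^esub> N" using cr[of "\<zero>\<^bsub>M\<^esub>"] zero by simp
  have car: "carrier (quotient_module M N) = a_rcosets\<^bsub>M\<^esub> N"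
    and ze: "\<zero>\<^bsub>quotient_module M N\<^esub> = N"
    by (simp_all add: quotient_module_def)
  have ad: "(N +>\<^bsub>M\<^esub> x) \<oplus>\<^bsub>quotient_module M N\<^esub> (N +>\<^bsub>M\<^esub> y) = N +>\<^bsub>M\<^esub> (x \<oplus>\<^bsub>M\<^esub> y)"
    if "x \<in> carrier M" "y \<in> carrier M" for x y
    using add[OF that] by (simp add: quotient_module_def)
  have sq: "r \<odot>\<^bsub>quotient_module M N\<^esub> (N +>\<^bsub>M\<^esub> y) = N +>\<^bsub>M\<^esub> (r \<odot>\<^bsub>M\<^esub> y)"
    if "r \<in> carrier R" "y \<in> carrier M" for r y
    using sm[OF that] by (simp add: quotient_module_def)
  have repE: thesis
    if "X \<in> carrier (quotient_module M N)"
      and "\<And>x. x \<in> carrier M \<Longrightarrow> X = N +>\<^bsub>M\<^esub> x \<Longrightarrow> thesis" for X thesis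
    using rep[of X] that unfolding car by blast
  note crq = cr[folded car]
  have ag: "abelian_group (quotient_module M N)"
  proof (rule abelian_groupI)
    show "\<zero>\<^bsub>quotient_module M N\<^esub> \<in> carrier (quotient_module M N)"
      unfolding ze car by (rule Nc)
  next
    fix X assume "X \<in> carrier (quotient_module M N)"
    then obtain x where x: "x \<in> carrier M" "X = N +>\<^bsub>M\<^esub> x" by (rule repE)
    show "\<zero>\<^bsub>quotient_module M N\<^esub> \<oplus>\<^bsub>quotient_module M N\<^esub> X = X"
      using ad[of "\<zero>\<^bsub>M\<^esub>" x] x by (simp add: zero ze)
    show "\<exists>Y\<in>carrier (quotient_module M N). Y \<oplus>\<^bsub>quotient_module M N\<^esub> X = \<zero>\<^bsub>quotient_module M N\<^esub>"
      by (rule bexI[of _ "N +>\<^bsub>M\<^esub> (\<ominus>\<^bsub>M\<^esub> x)"]) (use x in \<open>simp_all add: ad crq M.l_neg zero ze\<close>)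
  qed (elim repE, simp add: ad crq M.a_assoc M.a_closed, elim repE, simp add: ad M.a_assoc, elim repE, simp add: ad M.a_comm)
  show ?thesis
    by (rule moduleI[OF R.cring_axioms ag]; elim repE;
        simp add: ad sq crq smult_l_distr smult_r_distr smult_assoc1)
qed

end

theory Submission
  imports Defs
begin

text \<open>
  Write \<open>A = k[\<Gamma>]\<close>, \<open>B = k[\<Delta>]\<close> and \<open>M = I\<^sub>\<Delta> / I\<^sub>\<Gamma>\<close>, so that there is an exact sequence
  \<open>0 \<longrightarrow> M \<longrightarrow> A \<longrightarrow> B \<longrightarrow> 0\<close>, and let \<open>D\<close> be the common value of \<open>dim \<Gamma> + 1\<close> and \<open>dim \<Delta> + 1\<close>.
  The depth of \<open>A\<close> is at least \<open>D\<close> and that of \<open>B\<close> at least \<open>D - 1\<close>, hence the depth of \<open>M\<close> is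
  at least \<open>D\<close>; its dimension is at most \<open>dim A = D\<close>.  A nonzero module has depth at most
  dimension, so \<open>M\<close> is Cohen--Macaulay.

  The depth estimate has to produce a regular sequence on \<open>M\<close> out of unrelated regular sequences
  on \<open>A\<close> and \<open>B\<close>.  All three are compared with one system of parameters, the elementary
  symmetric polynomials \<open>e\<^sub>1, \<dots>, e\<^sub>D\<close> in the vertices of \<open>\<Gamma>\<close>.  Since \<open>\<Prod>\<^sub>u (x\<^sub>v - x\<^sub>u) = 0\<close> and
  \<open>e\<^sub>i \<in> I\<^sub>\<Gamma>\<close> for \<open>i > D\<close>, every variable is nilpotent modulo \<open>(e\<^sub>1, \<dots>, e\<^sub>D) + I\<^sub>\<Gamma>\<close>
  (\<open>var_power_esym\<close>).  Consequently every element of the irrelevant ideal acts nilpotently on the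
  Koszul cohomology \<open>H\<^sup>i(e; N)\<close> of \<open>N = A, B, M\<close>.  If \<open>f\<close> is regular on \<open>N\<close> and
  \<open>H\<^sup>i\<^sup>-\<^sup>1(e; N/fN) = 0\<close>, then \<open>f\<close> is injective on \<open>H\<^sup>i(e; N)\<close>, which is therefore zero; so a regular
  sequence of length \<open>r\<close> forces \<open>H\<^sup>i(e; N) = 0\<close> for \<open>i < r\<close> (\<open>regular_imp_exact\<close>).  The long exact
  sequence passes the vanishing on to \<open>M\<close> (\<open>exact_kernel\<close>), and the graded Nakayama lemma turns it
  back into regularity of \<open>e\<^sub>1, \<dots>, e\<^sub>D\<close> on \<open>M\<close> (\<open>exact_imp_regular\<close>).

  All upper bounds, for Krull dimensions as well as for depths, come from a single counting argument
  (\<open>nested_face_ideal\<close>).  If every face of \<open>X\<close> has fewer than \<open>r\<close> elements, the monomials in \<open>r\<close>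
  given polynomials outnumber the monomials supported on faces of \<open>X\<close>, so the polynomials satisfy
  a relation modulo \<open>I\<^sub>X\<close>.  Factoring out, one polynomial after the other, the lowest power that
  occurs brings it into the form
  \<open>f\<^sub>1\<^sup>a (f\<^sub>2\<^sup>b (\<dots> (c + f\<^sub>r g\<^sub>r) \<dots> + f\<^sub>2 g\<^sub>2) + f\<^sub>1 g\<^sub>1)\<close> with a constant \<open>c \<noteq> 0\<close>, from which
  the factors can be peeled off again, both along a strict chain of primes and along a regular
  sequence, until the unit \<open>c\<close> is reached.  Applied to the subcomplex \<open>X\<close> of \<open>\<Gamma>\<close> generated by
  \<open>\<Gamma> - \<Delta>\<close>, whose ideal annihilates \<open>M\<close>, it also yields a face of size \<open>D\<close> in \<open>\<Gamma> - \<Delta>\<close>, and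
  thereby \<open>dim M \<ge> D\<close>.

  All modules are treated as subquotients \<open>I / J\<close> of the polynomial ring in all variables of the type
  \<open>'v\<close>.  There the ideal of a complex does not depend on the ground set, which makes the
  hypotheses on \<open>V\<close> and \<open>W\<close> comparable with the conclusion on the vertex set of \<open>\<Gamma>\<close>.
\<close>

section \<open>Koszul cohomology of subquotients\<close>

definition is_ideal :: "'a::comm_ring_1 set \<Rightarrow> bool" where
  "is_ideal I \<longleftrightarrow> 0 \<in> I \<and> (\<forall>a\<in>I. \<forall>b\<in>I. a + b \<in> I) \<and> (\<forall>r. \<forall>a\<in>I. r * a \<in> I)"

lemma is_ideal_0: "is_ideal I \<Longrightarrow> 0 \<in> I"
  and is_ideal_add: "is_ideal I \<Longrightarrow> a \<in> I \<Longrightarrow> b \<in> I \<Longrightarrow> a + b \<in> I"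
  and is_ideal_mult: "is_ideal I \<Longrightarrow> a \<in> I \<Longrightarrow> r * a \<in> I"
  by (auto simp: is_ideal_def)

lemma is_ideal_uminus: "is_ideal I \<Longrightarrow> a \<in> I \<Longrightarrow> - a \<in> I"
  using is_ideal_mult[of I a "-1"] by simp

lemma is_ideal_diff: "is_ideal I \<Longrightarrow> a \<in> I \<Longrightarrow> b \<in> I \<Longrightarrow> a - b \<in> I"
  using is_ideal_add[of I a "- b"] is_ideal_uminus[of I b] by simp

lemmas is_ideal_closed = is_ideal_0 is_ideal_add is_ideal_mult is_ideal_uminus is_ideal_diff

lemma is_ideal_UNIV: "is_ideal UNIV"
  by (simp add: is_ideal_def)

text \<open>
  The Koszul cochain complex of the sequence \<open>ys\<close>, built as the iterated mapping cone of the
  multiplications by its entries.  A cochain assigns a coefficient to every subset of the positions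
  of \<open>ys\<close>, encoded as a Boolean list of the same length; the head of the list selects one of the
  two summands of the cone.
\<close>

primrec koszul :: "'a::comm_ring_1 list \<Rightarrow> (bool list \<Rightarrow> 'a) \<Rightarrow> bool list \<Rightarrow> 'a" where
  "koszul [] c = (\<lambda>l. 0)"
| "koszul (y # ys) c = (\<lambda>l. if hd l then y * c (False # tl l) - koszul ys (\<lambda>l. c (True # l)) (tl l)
     else koszul ys (\<lambda>l. c (False # l)) (tl l))"

text \<open>
  The positions that carry the cochains of degree \<open>i\<close>.  Cochains are total functions, and only their
  values at such lists matter; the values elsewhere are arbitrary elements of the module, which
  avoids side conditions when cochains are put together.
\<close>

definition cells :: "nat \<Rightarrow> nat \<Rightarrow> bool list set" where
  "cells n i = {l. length l = n \<and> count_list l True = i}"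

lemma koszul_add: "koszul ys (\<lambda>l. a l + b l) l = koszul ys a l + koszul ys b l"
  by (induction ys arbitrary: a b l) (auto simp: algebra_simps)

lemma koszul_mult: "koszul ys (\<lambda>l. r * a l) l = r * koszul ys a l"
  by (induction ys arbitrary: a l) (auto simp: algebra_simps)

lemma koszul_uminus: "koszul ys (\<lambda>l. - a l) l = - koszul ys a l"
  using koszul_mult[of ys "-1" a l] by simp

lemma koszul_diff: "koszul ys (\<lambda>l. a l - b l) l = koszul ys a l - koszul ys b l"
  using koszul_add[of ys a "\<lambda>l. - b l" l] by (simp add: koszul_uminus)

lemma koszul_zero: "koszul ys (\<lambda>l. 0) l = 0"
  using koszul_mult[of ys 0 "\<lambda>l. 0" l] by simp

lemma koszul_koszul: "koszul ys (koszul ys c) l = 0"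
  by (induction ys arbitrary: c l) (auto simp: koszul_diff koszul_mult)

lemma koszul_mem:
  assumes "is_ideal J" "\<And>l. a l \<in> J" shows "koszul ys a l \<in> J"
  using assms(2) by (induction ys arbitrary: a l) (auto intro!: is_ideal_closed[OF assms(1)])

lemma cells_Cons:
  "b # l \<in> cells (Suc n) i \<longleftrightarrow> (if b then (\<exists>j. i = Suc j \<and> l \<in> cells n j) else l \<in> cells n i)"
  by (cases i) (auto simp: cells_def)

lemma cells_SucE:
  assumes "l \<in> cells (Suc n) i"
  obtains b l' where "l = b # l'" "l' \<in> cells n (if b then i - 1 else i)" "b \<Longrightarrow> i > 0"
proof (cases l)
  case Nil then show ?thesis using assms by (simp add: cells_def)
next
  case (Cons b l')
  then show ?thesis using assms that[of b l'] by (auto simp: cells_Cons split: if_splits)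
qed

lemma koszul_cells_mem:
  assumes "is_ideal J" "\<And>l. l \<in> cells (length ys) i \<Longrightarrow> a l \<in> J"
    and "l \<in> cells (length ys) (Suc i)"
  shows "koszul ys a l \<in> J"
  using assms(2,3)
proof (induction ys arbitrary: a l i)
  case Nil then show ?case by (simp add: is_ideal_0[OF assms(1)])
next
  case (Cons y ys)
  from Cons.prems(2) obtain b l' where l: "l = b # l'"
      "l' \<in> cells (length ys) (if b then i else Suc i)"
    by (cases l) (auto simp: cells_Cons split: if_splits, auto simp: cells_def)
  show ?case
  proof (cases b)
    case False
    have "koszul ys (\<lambda>l. a (False # l)) l' \<in> J"
      by (rule Cons.IH[of i]) (use l False Cons.prems(1) in \<open>auto simp: cells_Cons\<close>)
    then show ?thesis using l False by simp
  next
    case True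
    have 1: "koszul ys (\<lambda>l. a (True # l)) l' \<in> J"
    proof (cases i)
      case 0
      then have "l' \<in> cells (length ys) 0" using l True by simp
      then have "koszul ys c l' = 0" for c
        by (induction ys arbitrary: c l') (auto elim!: cells_SucE)
      then show ?thesis by (simp add: is_ideal_0[OF assms(1)])
    next
      case (Suc j)
      show ?thesis
        by (rule Cons.IH[of j]) (use l True Suc Cons.prems(1) in \<open>auto simp: cells_Cons\<close>)
    qed
    have "a (False # l') \<in> J" using l True Cons.prems(1) by (auto simp: cells_Cons)
    then show ?thesis using l True 1 by (auto intro!: is_ideal_closed[OF assms(1)])
  qed
qed

lemma koszul_cells_0: "l \<in> cells (length ys) 0 \<Longrightarrow> koszul ys c l = 0"
  by (induction ys arbitrary: c l) (auto elim!: cells_SucE)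

definition cocycle where
  "cocycle I J ys i c \<longleftrightarrow> (\<forall>l. c l \<in> I) \<and> (\<forall>l\<in>cells (length ys) (Suc i). koszul ys c l \<in> J)"

definition coboundary where
  "coboundary I J ys i c \<longleftrightarrow>
     (\<exists>b. (\<forall>l. b l \<in> I) \<and> (\<forall>l\<in>cells (length ys) i. c l - koszul ys b l \<in> J))"

definition exact_at where
  "exact_at I J ys i \<longleftrightarrow> (\<forall>c. cocycle I J ys i c \<longrightarrow> coboundary I J ys i c)"

lemma exact_atE:
  assumes "exact_at I J ys i" "cocycle I J ys i c"
  obtains b where "\<forall>l. b l \<in> I" "\<forall>l\<in>cells (length ys) i. c l - koszul ys b l \<in> J"
  using assms unfolding exact_at_def coboundary_def by auto

lemma coboundary_add:
  assumes "is_ideal I" "is_ideal J" "coboundary I J ys i a" "coboundary I J ys i b"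
  shows "coboundary I J ys i (\<lambda>l. a l + b l)"
proof -
  obtain a' b' where a: "\<forall>l. a' l \<in> I" "\<forall>l\<in>cells (length ys) i. a l - koszul ys a' l \<in> J"
    and b: "\<forall>l. b' l \<in> I" "\<forall>l\<in>cells (length ys) i. b l - koszul ys b' l \<in> J"
    using assms by (auto simp: coboundary_def)
  show ?thesis unfolding coboundary_def
  proof (intro exI[of _ "\<lambda>l. a' l + b' l"] conjI allI ballI)
    fix l assume "l \<in> cells (length ys) i"
    then have "(a l - koszul ys a' l) + (b l - koszul ys b' l) \<in> J"
      using a b is_ideal_add[OF assms(2)] by blast
    then show "a l + b l - koszul ys (\<lambda>l. a' l + b' l) l \<in> J" by (simp add: koszul_add algebra_simps)
  qed (use a b is_ideal_add[OF assms(1)] in auto)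
qed

lemma coboundary_mult:
  assumes "is_ideal I" "is_ideal J" "coboundary I J ys i a"
  shows "coboundary I J ys i (\<lambda>l. r * a l)"
proof -
  obtain a' where a: "\<forall>l. a' l \<in> I" "\<forall>l\<in>cells (length ys) i. a l - koszul ys a' l \<in> J"
    using assms by (auto simp: coboundary_def)
  show ?thesis unfolding coboundary_def
  proof (intro exI[of _ "\<lambda>l. r * a' l"] conjI allI ballI)
    fix l assume "l \<in> cells (length ys) i"
    then have "r * (a l - koszul ys a' l) \<in> J"
      using a is_ideal_mult[OF assms(2)] by blast
    then show "r * a l - koszul ys (\<lambda>l. r * a' l) l \<in> J" by (simp add: koszul_mult algebra_simps)
  qed (use a is_ideal_mult[OF assms(1)] in auto)
qed

lemma coboundary_mem:
  assumes "is_ideal I" "\<And>l. l \<in> cells (length ys) i \<Longrightarrow> c l \<in> J"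
  shows "coboundary I J ys i c"
  unfolding coboundary_def
  by (intro exI[of _ "\<lambda>l. 0"]) (auto simp: koszul_zero assms is_ideal_0)

lemma coboundary_cong:
  assumes "\<And>l. l \<in> cells (length ys) i \<Longrightarrow> c l = c' l"
  shows "coboundary I J ys i c \<longleftrightarrow> coboundary I J ys i c'"
  unfolding coboundary_def using assms by auto

definition kills :: "'a::comm_ring_1 set \<Rightarrow> 'a set \<Rightarrow> 'a list \<Rightarrow> 'a \<Rightarrow> bool" where
  "kills I J ys z \<longleftrightarrow> (\<forall>i c. cocycle I J ys i c \<longrightarrow> coboundary I J ys i (\<lambda>l. z * c l))"

lemma is_ideal_kills:
  assumes "is_ideal I" "is_ideal J" shows "is_ideal {z. kills I J ys z}"
  unfolding is_ideal_def
proof (intro conjI ballI allI)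
  show "0 \<in> {z. kills I J ys z}"
    by (auto simp: kills_def intro!: coboundary_mem assms is_ideal_0)
next
  fix a b assume "a \<in> {z. kills I J ys z}" "b \<in> {z. kills I J ys z}"
  then show "a + b \<in> {z. kills I J ys z}"
    using coboundary_add[OF assms] by (auto simp: kills_def distrib_right)
next
  fix r a assume "a \<in> {z. kills I J ys z}"
  then show "r * a \<in> {z. kills I J ys z}"
    using coboundary_mult[OF assms] by (auto simp: kills_def mult.assoc)
qed

lemma kills_ann:
  assumes "is_ideal I" "\<And>a. a \<in> I \<Longrightarrow> z * a \<in> J"
  shows "kills I J ys z"
  by (auto simp: kills_def cocycle_def intro!: coboundary_mem assms)

text \<open>
  Contraction with the position \<open>j\<close>, a chain homotopy between zero and multiplication by the
  entry \<open>ys ! j\<close>.  The sign at the head position compensates the sign in \<open>koszul\<close>.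
\<close>

primrec contraction :: "nat \<Rightarrow> (bool list \<Rightarrow> 'a::comm_ring_1) \<Rightarrow> bool list \<Rightarrow> 'a" where
  "contraction 0 c = (\<lambda>l. if hd l then 0 else c (True # tl l))"
| "contraction (Suc j) c = (\<lambda>l. if hd l then - contraction j (\<lambda>l. c (True # l)) (tl l)
      else contraction j (\<lambda>l. c (False # l)) (tl l))"

lemma contraction_add: "contraction j (\<lambda>l. a l + b l) l = contraction j a l + contraction j b l"
  by (induction j arbitrary: a b l) auto

lemma contraction_mult: "contraction j (\<lambda>l. r * a l) l = r * contraction j a l"
  by (induction j arbitrary: a l) auto

lemma contraction_uminus: "contraction j (\<lambda>l. - a l) l = - contraction j a l"
  using contraction_mult[of j "-1" a l] by simp

lemma contraction_diff: "contraction j (\<lambda>l. a l - b l) l = contraction j a l - contraction j b l"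
  using contraction_add[of j a "\<lambda>l. - b l" l] by (simp add: contraction_uminus)

lemma contraction_mem:
  assumes "is_ideal J" "\<And>l. a l \<in> J" shows "contraction j a l \<in> J"
  using assms(2) by (induction j arbitrary: a l) (auto intro!: is_ideal_closed[OF assms(1)])

lemma contraction_cells_mem:
  assumes "is_ideal J" "\<And>l. l \<in> cells n (Suc i) \<Longrightarrow> a l \<in> J"
    and "l \<in> cells n i" "j < n"
  shows "contraction j a l \<in> J"
  using assms(2-)
proof (induction j arbitrary: a l i n)
  case 0
  then obtain m where n: "n = Suc m" by (cases n) auto
  with 0 show ?case
    by (auto elim!: cells_SucE simp: cells_Cons is_ideal_0[OF assms(1)])
next
  case (Suc j)
  then obtain m where n: "n = Suc m" by (cases n) auto
  obtain b l' where l: "l = b # l'" "l' \<in> cells m (if b then i - 1 else i)" "b \<Longrightarrow> i > 0"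
    using Suc.prems n by (auto elim!: cells_SucE)
  have "contraction j (\<lambda>l. a (b # l)) l' \<in> J"
    by (rule Suc.IH[OF _ l(2)]) (use n Suc.prems l(3) in \<open>auto simp: cells_Cons split: if_splits\<close>)
  then show ?case using l is_ideal_uminus[OF assms(1)] by (cases b) auto
qed

lemma koszul_contraction_homotopy:
  "length l = length ys \<Longrightarrow> j < length ys \<Longrightarrow>
     koszul ys (contraction j c) l + contraction j (koszul ys c) l = ys ! j * c l"
proof (induction ys arbitrary: j c l)
  case Nil then show ?case by simp
next
  case (Cons y ys)
  obtain b l' where l: "l = b # l'" "length l' = length ys" using Cons.prems(1) by (cases l) auto
  show ?case
  proof (cases j)
    case 0
    then show ?thesis using l by (cases b) (auto simp: koszul_zero)
  next
    case (Suc k)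
    then have k: "k < length ys" using Cons.prems by simp
    have *: "koszul ys (contraction k c) l' + contraction k (koszul ys c) l' = ys ! k * c l'" for c
      by (rule Cons.IH[OF l(2) k])
    show ?thesis
      using *[of "\<lambda>l. c (b # l)"] l Suc
      by (cases b) (auto simp: koszul_uminus contraction_diff contraction_mult algebra_simps)
  qed
qed

text \<open>
  The entries of a sequence annihilate its Koszul cohomology, by the contraction homotopy.
\<close>

lemma kills_entry:
  assumes IJ: "is_ideal I" "is_ideal J" and y: "y \<in> set ys"
  shows "kills I J ys y"
  unfolding kills_def
proof (intro allI impI)
  fix i c assume c: "cocycle I J ys i c"
  obtain j where j: "j < length ys" "ys ! j = y" using y by (auto simp: in_set_conv_nth)
  show "coboundary I J ys i (\<lambda>l. y * c l)"
    unfolding coboundary_def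
  proof (intro exI[of _ "contraction j c"] conjI allI ballI)
    show "contraction j c l \<in> I" for l using c by (auto simp: cocycle_def intro!: contraction_mem IJ)
  next
    fix l assume l: "l \<in> cells (length ys) i"
    have "contraction j (koszul ys c) l \<in> J"
      by (rule contraction_cells_mem[OF IJ(2) _ l j(1)]) (use c in \<open>auto simp: cocycle_def\<close>)
    moreover have "y * c l - koszul ys (contraction j c) l = contraction j (koszul ys c) l"
      using koszul_contraction_homotopy[of l ys j c] l j by (simp add: cells_def algebra_simps)
    ultimately show "y * c l - koszul ys (contraction j c) l \<in> J" by simp
  qed
qed

definition adjoin :: "'a::comm_ring_1 set \<Rightarrow> 'a set \<Rightarrow> 'a \<Rightarrow> 'a set" where
  "adjoin I J f = {j + f * a | j a. j \<in> J \<and> a \<in> I}"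

lemma is_ideal_adjoin: assumes "is_ideal I" "is_ideal J" shows "is_ideal (adjoin I J f)"
  unfolding is_ideal_def
proof (intro conjI ballI allI)
  show "0 \<in> adjoin I J f" unfolding adjoin_def using is_ideal_0 assms by force
next
  fix a b assume "a \<in> adjoin I J f" "b \<in> adjoin I J f"
  then obtain j x j' x' where "a = j + f * x" "b = j' + f * x'" "j \<in> J" "j' \<in> J" "x \<in> I" "x' \<in> I"
    by (auto simp: adjoin_def)
  then have "a + b = (j + j') + f * (x + x')" "j + j' \<in> J" "x + x' \<in> I"
    using is_ideal_add assms by (auto simp: algebra_simps)
  then show "a + b \<in> adjoin I J f" unfolding adjoin_def by blast
next
  fix r a assume "a \<in> adjoin I J f" 
  then obtain j x where "a = j + f * x" "j \<in> J" "x \<in> I" by (auto simp: adjoin_def)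
  moreover from this have "r * a = r * j + f * (r * x)" by (simp add: algebra_simps)
  moreover have "r * j \<in> J" "r * x \<in> I"
    using calculation is_ideal_mult assms by blast+
  ultimately show "r * a \<in> adjoin I J f" unfolding adjoin_def by blast
qed

lemma adjoin_mono: "is_ideal I \<Longrightarrow> J \<subseteq> adjoin I J f"
  unfolding adjoin_def using is_ideal_0 by force

text \<open>
  Part of the long exact cohomology sequence of \<open>0 \<longrightarrow> I/J \<longrightarrow> I/J \<longrightarrow> I/(J + f I) \<longrightarrow> 0\<close>, whose
  first map is multiplication by \<open>f\<close>: where the cohomology of the cokernel vanishes one degree
  lower, \<open>f\<close> is injective on the cohomology of \<open>I/J\<close>.
\<close>

lemma coboundary_cancel:
  assumes I: "is_ideal I" and J: "is_ideal J" 
    and reg: "\<And>a. a \<in> I \<Longrightarrow> f * a \<in> J \<Longrightarrow> a \<in> J"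
    and ex: "\<And>k. i = Suc k \<Longrightarrow> exact_at I (adjoin I J f) ys k"
    and c: "\<And>l. c l \<in> I"
    and fc: "coboundary I J ys i (\<lambda>l. f * c l)"
  shows "coboundary I J ys i c"
proof -
  obtain b where b: "\<forall>l. b l \<in> I" "\<forall>l\<in>cells (length ys) i. f * c l - koszul ys b l \<in> J"
    using fc by (auto simp: coboundary_def)
  show ?thesis
  proof (cases i)
    case 0
    have "c l \<in> J" if "l \<in> cells (length ys) i" for l
      using bspec[OF b(2) that] that c reg[of "c l"] 0 koszul_cells_0[of l ys b] by simp
    then show ?thesis by (rule coboundary_mem[OF I])
  next
    case (Suc k)
    have "cocycle I (adjoin I J f) ys k b" unfolding cocycle_def
    proof (intro conjI allI ballI b(1)[rule_format])
      fix l assume "l \<in> cells (length ys) (Suc k)"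
      then have "f * c l - koszul ys b l \<in> J" using b(2) Suc by simp
      then have "- (f * c l - koszul ys b l) + f * c l \<in> adjoin I J f"
        using is_ideal_uminus[OF J] c[of l] unfolding adjoin_def by blast
      then show "koszul ys b l \<in> adjoin I J f" by simp
    qed
    then obtain b' where b': "\<forall>l. b' l \<in> I"
      "\<forall>l\<in>cells (length ys) k. b l - koszul ys b' l \<in> adjoin I J f"
      by (rule exact_atE[OF ex[OF Suc]])
    have "\<exists>e\<in>I. l \<in> cells (length ys) k \<longrightarrow> b l - koszul ys b' l - f * e \<in> J" for l
    proof (cases "l \<in> cells (length ys) k")
      case True
      then obtain j e where "b l - koszul ys b' l = j + f * e" "j \<in> J" "e \<in> I"
        using bspec[OF b'(2) True] unfolding adjoin_def by blast
      then show ?thesis by (intro bexI[of _ e]) simp_all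
    qed (use is_ideal_0[OF I] in auto)
    then obtain e where e: "\<And>l. e l \<in> I"
      "\<And>l. l \<in> cells (length ys) k \<Longrightarrow> b l - koszul ys b' l - f * e l \<in> J" by metis
    show ?thesis unfolding coboundary_def
    proof (intro exI[of _ e] conjI allI ballI e(1))
      fix l assume l: "l \<in> cells (length ys) i"
      have "koszul ys (\<lambda>l. b l - koszul ys b' l - f * e l) l \<in> J"
        by (rule koszul_cells_mem[OF J e(2)]) (use l Suc in auto)
      then have "koszul ys b l - f * koszul ys e l \<in> J"
        by (simp add: koszul_diff koszul_mult koszul_koszul)
      from is_ideal_add[OF J this b(2)[rule_format, OF l]] have "f * (c l - koszul ys e l) \<in> J"
        by (simp add: algebra_simps)
      then show "c l - koszul ys e l \<in> J"
        by (rule reg[rotated]) (intro is_ideal_diff[OF I] c koszul_mem[OF I] e)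
    qed
  qed
qed

primrec regular :: "'a::comm_ring_1 set \<Rightarrow> 'a set \<Rightarrow> 'a list \<Rightarrow> bool" where
  "regular I J [] \<longleftrightarrow> True"
| "regular I J (f # fs) \<longleftrightarrow> (\<forall>a\<in>I. f * a \<in> J \<longrightarrow> a \<in> J) \<and> regular I (adjoin I J f) fs"

text \<open>
  The hypothesis of nilpotency is imposed for all larger \<open>J'\<close>, because the induction divides out one
  element of the regular sequence after the other.
\<close>

lemma regular_imp_exact:
  assumes "is_ideal I" "is_ideal J" "regular I J fs"
    and "\<And>f J'. f \<in> set fs \<Longrightarrow> is_ideal J' \<Longrightarrow> J \<subseteq> J' \<Longrightarrow> \<exists>N. kills I J' ys (f ^ N)"
    and "i < length fs"
  shows "exact_at I J ys i"
  using assms(2-)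
proof (induction fs arbitrary: J i)
  case Nil then show ?case by simp
next
  case (Cons f fs)
  have IH: "exact_at I (adjoin I J f) ys k" if "i = Suc k" for k
    by (rule Cons.IH) (use that Cons.prems assms(1) adjoin_mono[of I J f] is_ideal_adjoin[of I J f] in auto)
  show ?case unfolding exact_at_def
  proof (intro allI impI)
    fix c assume c: "cocycle I J ys i c"
    obtain N where "kills I J ys (f ^ N)" using Cons.prems(3)[of f J] Cons.prems(1) by auto
    then have "coboundary I J ys i (\<lambda>l. f ^ N * c l)" using c by (auto simp: kills_def)
    then show "coboundary I J ys i c"
    proof (induction N)
      case 0 then show ?case by simp
    next
      case (Suc N)
      have "coboundary I J ys i (\<lambda>l. f * (f ^ N * c l))"
        using Suc.prems by (simp add: mult.assoc)
      from coboundary_cancel[OF assms(1) _ _ _ _ this] Cons.prems IH c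
      have "coboundary I J ys i (\<lambda>l. f ^ N * c l)"
        by (auto simp: cocycle_def is_ideal_mult[OF assms(1)])
      then show ?case by (rule Suc.IH)
    qed
  qed
qed

text \<open>
  The long exact cohomology sequence of \<open>0 \<longrightarrow> K/J \<longrightarrow> I/J \<longrightarrow> I/K \<longrightarrow> 0\<close>: this is where the
  depth of the relative module gains one over the depth of the quotient.
\<close>

lemma exact_kernel:
  assumes I: "is_ideal I" and J: "is_ideal J" and K: "is_ideal K" and sub: "J \<subseteq> K" "K \<subseteq> I"
    and IJ: "exact_at I J ys i" and IK: "\<And>k. i = Suc k \<Longrightarrow> exact_at I K ys k"
  shows "exact_at K J ys i"
  unfolding exact_at_def
proof (intro allI impI)
  fix c assume c: "cocycle K J ys i c"
  then have "cocycle I J ys i c" using sub by (auto simp: cocycle_def)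
  then obtain b where b: "\<forall>l. b l \<in> I" "\<forall>l\<in>cells (length ys) i. c l - koszul ys b l \<in> J"
    by (rule exact_atE[OF IJ])
  show "coboundary K J ys i c"
  proof (cases i)
    case 0
    have "c l \<in> J" if "l \<in> cells (length ys) i" for l
      using bspec[OF b(2) that] that 0 koszul_cells_0[of l ys b] by simp
    then show ?thesis by (rule coboundary_mem[OF K])
  next
    case (Suc k)
    have "cocycle I K ys k b" unfolding cocycle_def
    proof (intro conjI allI ballI b(1)[rule_format])
      fix l assume "l \<in> cells (length ys) (Suc k)"
      then have "c l - koszul ys b l \<in> K" "c l \<in> K"
        using b(2) Suc sub(1) c by (auto simp: cocycle_def)
      from is_ideal_diff[OF K this(2,1)] show "koszul ys b l \<in> K" by simp
    qed
    then obtain b' where b': "\<forall>l. b' l \<in> I"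
      "\<forall>l\<in>cells (length ys) k. b l - koszul ys b' l \<in> K"
      by (rule exact_atE[OF IK[OF Suc]])
    define e where "e l = (if l \<in> cells (length ys) k then b l - koszul ys b' l else 0)" for l
    have e: "e l \<in> K" for l using b'(2) is_ideal_0[OF K] by (auto simp: e_def)
    show ?thesis unfolding coboundary_def
    proof (intro exI[of _ e] conjI allI ballI e)
      fix l assume l: "l \<in> cells (length ys) i"
      have "koszul ys (\<lambda>l. b l - koszul ys b' l - e l) l \<in> {0}"
        by (rule koszul_cells_mem[of _ _ k]) (use l Suc in \<open>auto simp: is_ideal_def e_def\<close>)
      then have "koszul ys e l = koszul ys b l" by (simp add: koszul_diff koszul_koszul)
      then show "c l - koszul ys e l \<in> J" using b(2)[rule_format, OF l] by simp
    qed
  qed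
qed

section \<open>Graded Nakayama lemma and regularity from vanishing\<close>

lemma regular_append:
  "regular I J (fs @ gs) \<longleftrightarrow> regular I J fs \<and> regular I (foldl (adjoin I) J fs) gs"
  by (induction fs arbitrary: J) auto

lemma cells_top: "cells n n = {replicate n True}"
proof -
  have "l \<in> cells n n \<longleftrightarrow> l = replicate n True" for l
  proof (induction n arbitrary: l)
    case 0 then show ?case by (auto simp: cells_def)
  next
    case (Suc n)
    have *: "False # l \<notin> cells (Suc n) (Suc n)" for l
      using count_le_length[of l True] by (auto simp: cells_def)
    show ?case
    proof (cases l)
      case Nil then show ?thesis by (simp add: cells_def)
    next
      case (Cons b l')
      then show ?thesis using Suc.IH * by (cases b) (simp_all add: cells_Cons)
    qed
  qed
  then show ?thesis by auto
qed

text \<open>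
  The Koszul cohomology in top degree is the quotient of \<open>I/J\<close> by all multiples of the entries.
\<close>

lemma top_koszul:
  fixes I J :: "'a::comm_ring_1 set"
  assumes "is_ideal I" "is_ideal J"
  shows "(\<exists>b. (\<forall>l. b l \<in> I) \<and> a - koszul ys b (replicate (length ys) True) \<in> J) \<longleftrightarrow>
     a \<in> foldl (adjoin I) J (rev ys)"
proof (induction ys arbitrary: a)
  case Nil
  have "\<exists>b :: bool list \<Rightarrow> 'a. \<forall>l. b l \<in> I"
    using is_ideal_0[OF assms(1)] by (intro exI[of _ "\<lambda>l. 0"]) simp
  then show ?case by simp
next
  case (Cons y ys)
  let ?T = "replicate (length ys) True" and ?Q = "foldl (adjoin I) J (rev ys)"
  have "(\<exists>b. (\<forall>l. b l \<in> I) \<and> a - koszul (y # ys) b (replicate (length (y # ys)) True) \<in> J) \<longleftrightarrow>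
      (\<exists>x\<in>I. \<exists>b. (\<forall>l. b l \<in> I) \<and> (a - y * x) - koszul ys b ?T \<in> J)"  (is "?L \<longleftrightarrow> ?R")
  proof
    assume ?L
    then obtain b where b: "\<forall>l. b l \<in> I" "a - (y * b (False # ?T) - koszul ys (\<lambda>l. b (True # l)) ?T) \<in> J"
      by auto
    show ?R
      by (intro bexI[of _ "b (False # ?T)"] exI[of _ "\<lambda>l. - b (True # l)"])
        (use b in \<open>auto simp: koszul_uminus algebra_simps intro: is_ideal_uminus[OF assms(1)]\<close>)
  next
    assume ?R
    then obtain x b where b: "x \<in> I" "\<forall>l. b l \<in> I" "(a - y * x) - koszul ys b ?T \<in> J" by auto
    show ?L
      by (intro exI[of _ "\<lambda>l. if hd l then - b (tl l) else x"])
        (use b in \<open>auto simp: koszul_uminus algebra_simps intro: is_ideal_uminus[OF assms(1)]\<close>)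
  qed
  also have "\<dots> \<longleftrightarrow> (\<exists>x\<in>I. a - y * x \<in> ?Q)" using Cons.IH by simp
  also have "\<dots> \<longleftrightarrow> a \<in> adjoin I ?Q y"
  proof -
    have "a - y * x \<in> ?Q \<longleftrightarrow> (\<exists>j. a = j + y * x \<and> j \<in> ?Q)" for x
      by (metis add_diff_cancel_right' diff_add_cancel)
    then show ?thesis unfolding adjoin_def by blast
  qed
  finally show ?case by simp
qed

text \<open>
  A grading given by its component projections.  Homogeneity of \<open>y\<close> is phrased through them as
  well: multiplication by \<open>y\<close> shifts the components by \<open>d\<close>.
\<close>

locale grading =
  fixes comp :: "nat \<Rightarrow> 'a::comm_ring_1 \<Rightarrow> 'a"
  assumes comp_add: "comp n (a + b) = comp n a + comp n b"
    and comp_sum: "\<forall>\<^sub>F N in sequentially. a = (\<Sum>n<N. comp n a)"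
begin

definition homogeneous :: "nat \<Rightarrow> 'a \<Rightarrow> bool" where
  "homogeneous d y \<longleftrightarrow> (\<forall>n a. comp n (y * a) = (if d \<le> n then y * comp (n - d) a else 0))"

definition graded :: "'a set \<Rightarrow> bool" where
  "graded I \<longleftrightarrow> (\<forall>n. \<forall>a\<in>I. comp n a \<in> I)"

lemma comp_0: "comp n 0 = 0"
  using comp_add[of n 0 0] by simp

lemma comp_uminus: "comp n (- a) = - comp n a"
  using comp_add[of n a "- a"] comp_0[of n] by (simp add: add_eq_0_iff)

lemma comp_diff: "comp n (a - b) = comp n a - comp n b"
  using comp_add[of n a "- b"] by (simp add: comp_uminus)

text \<open>
  Component \<open>n\<close> of a cochain (\<open>proj\<close>): the value at \<open>l\<close> is projected to degree \<open>n\<close> minus the degrees of the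
  entries that \<open>l\<close> does not select.  With this shift the differential preserves degrees, and all
  degrees stay natural numbers.
\<close>

primrec weight :: "('a \<Rightarrow> nat) \<Rightarrow> 'a list \<Rightarrow> bool list \<Rightarrow> nat" where
  "weight d [] l = 0"
| "weight d (y # ys) l = (if hd l then 0 else d y) + weight d ys (tl l)"

definition proj :: "('a \<Rightarrow> nat) \<Rightarrow> 'a list \<Rightarrow> nat \<Rightarrow> (bool list \<Rightarrow> 'a) \<Rightarrow> bool list \<Rightarrow> 'a" where
  "proj d ys n c l = (if weight d ys l \<le> n then comp (n - weight d ys l) (c l) else 0)"

lemma koszul_proj:
  assumes "\<forall>y\<in>set ys. homogeneous (d y) y"
  shows "koszul ys (proj d ys n c) l = proj d ys n (koszul ys c) l"
  using assms
proof (induction ys arbitrary: n c l)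
  case Nil then show ?case by (simp add: proj_def comp_0)
next
  case (Cons y ys)
  have hom: "comp m (y * a) = (if d y \<le> m then y * comp (m - d y) a else 0)" for m a
    using Cons.prems by (simp add: homogeneous_def)
  have T: "(\<lambda>l. proj d (y # ys) n c (True # l)) = proj d ys n (\<lambda>l. c (True # l))"
    by (simp add: proj_def fun_eq_iff)
  have F: "(\<lambda>l. proj d (y # ys) n c (False # l)) =
      (if d y \<le> n then proj d ys (n - d y) (\<lambda>l. c (False # l)) else (\<lambda>l. 0))"
    by (auto simp add: proj_def fun_eq_iff)
  have IH: "koszul ys (proj d ys n c) l = proj d ys n (koszul ys c) l" for n c l
    using Cons by simp
  show ?case
  proof (cases "hd l")
    case True
    have "y * proj d (y # ys) n c (False # tl l) =
        (if weight d ys (tl l) \<le> n then comp (n - weight d ys (tl l)) (y * c (False # tl l)) else 0)"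
      by (auto simp: proj_def hom algebra_simps)
    then show ?thesis
      using True by (simp add: T IH) (simp add: proj_def comp_diff)
  next
    case False
    then show ?thesis
      by (simp add: F IH koszul_zero) (auto simp add: proj_def)
  qed
qed

lemma coboundary_proj:
  assumes hom: "\<forall>y\<in>set ys. homogeneous (d y) y"
    and I: "is_ideal I" "graded I" and J: "is_ideal J" "graded J"
    and c: "coboundary I J ys i c"
  shows "coboundary I J ys i (proj d ys n c)"
proof -
  obtain b where b: "\<forall>l. b l \<in> I" "\<forall>l\<in>cells (length ys) i. c l - koszul ys b l \<in> J"
    using c by (auto simp: coboundary_def)
  show ?thesis unfolding coboundary_def
  proof (intro exI[of _ "proj d ys n b"] conjI allI ballI)
    show "proj d ys n b l \<in> I" for l
      using b I by (auto simp: proj_def graded_def is_ideal_0)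
    fix l assume "l \<in> cells (length ys) i"
    then have "c l - koszul ys b l \<in> J" using b by blast
    then show "proj d ys n c l - koszul ys (proj d ys n b) l \<in> J"
      using J unfolding koszul_proj[OF hom]
      by (auto simp: proj_def graded_def is_ideal_0 simp flip: comp_diff)
  qed
qed

lemma coboundary_sum:
  assumes "is_ideal I" "is_ideal J" "\<And>n::nat. coboundary I J ys i (c n)"
  shows "coboundary I J ys i (\<lambda>l. \<Sum>n<N. c n l)"
proof (induction N)
  case 0 then show ?case by (auto intro!: coboundary_mem assms is_ideal_0)
next
  case (Suc N)
  from coboundary_add[OF assms(1,2) this assms(3)[of N]] show ?case by simp
qed

text \<open>
  If \<open>z\<close> acts surjectively on a cohomology group, a class of degree \<open>n\<close> is \<open>z\<close> times a class
  of degree \<open>n - e\<close>; descending below degree 0 shows that it vanishes.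
\<close>

lemma nakayama:
  assumes hom: "\<forall>y\<in>set ys. homogeneous (d y) y"
    and I: "is_ideal I" "graded I" and J: "is_ideal J" "graded J"
    and z: "homogeneous e z" "e > 0"
    and surj: "\<And>c. cocycle I J ys i c \<Longrightarrow>
       \<exists>a. cocycle I J ys i a \<and> coboundary I J ys i (\<lambda>l. c l - z * a l)"
  shows "exact_at I J ys i"
  unfolding exact_at_def
proof (intro allI impI)
  have proj: "coboundary I J ys i (proj d ys n c)" if "cocycle I J ys i c" for n c
    using that
  proof (induction n arbitrary: c rule: less_induct)
    case (less n)
    obtain a where a: "cocycle I J ys i a" "coboundary I J ys i (\<lambda>l. c l - z * a l)"
      using surj[OF less.prems] by blast
    have 1: "coboundary I J ys i (proj d ys n (\<lambda>l. c l - z * a l))"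
      by (rule coboundary_proj[OF hom I J a(2)])
    have 2: "coboundary I J ys i (\<lambda>l. if e \<le> n then z * proj d ys (n - e) a l else 0)"
    proof (cases "e \<le> n")
      case True
      have "coboundary I J ys i (proj d ys (n - e) a)"
        by (rule less.IH[OF _ a(1)]) (use z True in simp)
      then show ?thesis using True coboundary_mult[OF I(1) J(1)] by simp
    qed (auto intro!: coboundary_mem I is_ideal_0 J)
    have "proj d ys n c l = proj d ys n (\<lambda>l. c l - z * a l) l
        + (if e \<le> n then z * proj d ys (n - e) a l else 0)" for l
    proof -
      have "comp m (z * x) = (if e \<le> m then z * comp (m - e) x else 0)" for m x
        using z(1) by (simp add: homogeneous_def)
      then show ?thesis by (auto simp: proj_def comp_diff add.commute)
    qed
    then have "proj d ys n c = (\<lambda>l. proj d ys n (\<lambda>l. c l - z * a l) l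
        + (if e \<le> n then z * proj d ys (n - e) a l else 0))" by blast
    with coboundary_add[OF I(1) J(1) 1 2] show ?case by simp
  qed
  fix c assume c: "cocycle I J ys i c"
  have fin: "finite (cells (length ys) i)"
    by (rule finite_subset[OF _ finite_lists_length_eq[of UNIV "length ys"]]) (auto simp: cells_def)
  have "\<forall>\<^sub>F N in sequentially. c l = (\<Sum>n<N. proj d ys n c l)" for l
  proof -
    obtain N0 where N0: "\<And>N. N \<ge> N0 \<Longrightarrow> c l = (\<Sum>n<N. comp n (c l))"
      using comp_sum[of "c l"] by (auto simp: eventually_sequentially)
    show ?thesis unfolding eventually_sequentially
    proof (intro exI[of _ "N0 + weight d ys l"] allI impI)
      let ?w = "weight d ys l"
      fix N assume N: "N0 + ?w \<le> N"
      have "(\<Sum>n<N. proj d ys n c l) = (\<Sum>n\<in>{?w..<N}. proj d ys n c l)"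
        by (rule sum.mono_neutral_right) (auto simp: proj_def)
      also have "\<dots> = (\<Sum>n<N - ?w. comp n (c l))"
        by (rule sum.reindex_bij_witness[of _ "\<lambda>n. n + ?w" "\<lambda>n. n - ?w"]) (auto simp: proj_def)
      also have "\<dots> = c l" using N0[of "N - ?w"] N by simp
      finally show "c l = (\<Sum>n<N. proj d ys n c l)" by simp
    qed
  qed
  then have "\<forall>\<^sub>F N in sequentially. \<forall>l\<in>cells (length ys) i. c l = (\<Sum>n<N. proj d ys n c l)"
    by (intro eventually_ball_finite fin) auto
  then obtain N where N: "\<forall>l\<in>cells (length ys) i. c l = (\<Sum>n<N. proj d ys n c l)"
    by (auto simp: eventually_sequentially)
  have "coboundary I J ys i (\<lambda>l. \<Sum>n<N. proj d ys n c l)"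
    by (rule coboundary_sum[OF I(1) J(1)]) (rule proj[OF c])
  then show "coboundary I J ys i c"
    using coboundary_cong[of ys i c "\<lambda>l. \<Sum>n<N. proj d ys n c l" I J] N by blast
qed

text \<open>
  In the long exact sequence that compares \<open>z # ys\<close> with \<open>ys\<close>, vanishing for \<open>z # ys\<close> makes \<open>z\<close>
  bijective on the lower cohomology of \<open>ys\<close>, which is zero by Nakayama, and injective on the top
  one, which is the quotient by \<open>ys\<close>.  The list is reversed because its head is the outermost
  cone, that is, the parameter that comes last.
\<close>

lemma exact_imp_regular:
  assumes I: "is_ideal I" "graded I" and J: "is_ideal J" "graded J"
    and "\<forall>z\<in>set zs. homogeneous (d z) z \<and> d z > 0"
    and "\<And>i. i < length zs \<Longrightarrow> exact_at I J zs i"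
  shows "regular I J (rev zs)"
  using assms(5,6)
proof (induction zs)
  case Nil then show ?case by simp
next
  case (Cons z ys)
  have hom: "\<forall>y\<in>set ys. homogeneous (d y) y" using Cons.prems by simp
  have "exact_at I J ys i" if i: "i < length ys" for i
  proof (rule nakayama[OF hom I J])
    show "homogeneous (d z) z" "d z > 0" using Cons.prems by auto
    fix c assume c: "cocycle I J ys i c"
    \<comment> \<open>A cocycle of \<open>ys\<close>, placed in the shifted summand of the cone, is a cocycle of \<open>z # ys\<close> one
      degree higher; a primitive of it exhibits \<open>c\<close> as a multiple of \<open>z\<close>.\<close>
    have "cocycle I J (z # ys) (Suc i) (\<lambda>l. if hd l then c (tl l) else 0)"
      unfolding cocycle_def
    proof (intro conjI ballI allI)
      show "(if hd l then c (tl l) else 0) \<in> I" for l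
        using c I by (auto simp: cocycle_def is_ideal_0)
      fix l assume l: "l \<in> cells (length (z # ys)) (Suc (Suc i))"
      show "koszul (z # ys) (\<lambda>l. if hd l then c (tl l) else 0) l \<in> J"
      proof (cases "hd l")
        case True
        then have "tl l \<in> cells (length ys) (Suc i)" using l by (cases l) (auto simp: cells_Cons cells_def)
        then have "- koszul ys c (tl l) \<in> J" using c is_ideal_uminus[OF J(1)] by (auto simp: cocycle_def)
        then show ?thesis using True by simp
      qed (use J in \<open>auto simp: koszul_zero is_ideal_0\<close>)
    qed
    moreover have "exact_at I J (z # ys) (Suc i)" using i by (intro Cons.prems) auto
    ultimately obtain b where b: "\<forall>l. b l \<in> I"
      "\<forall>l\<in>cells (Suc (length ys)) (Suc i).
          (if hd l then c (tl l) else 0) - koszul (z # ys) b l \<in> J"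
      by (auto elim!: exact_atE simp del: koszul.simps)
    show "\<exists>a. cocycle I J ys i a \<and> coboundary I J ys i (\<lambda>l. c l - z * a l)"
    proof (intro exI conjI)
      show "cocycle I J ys i (\<lambda>l. b (False # l))" unfolding cocycle_def
      proof (intro conjI allI ballI)
        fix l assume "l \<in> cells (length ys) (Suc i)"
        then have "- koszul ys (\<lambda>l. b (False # l)) l \<in> J"
          using bspec[OF b(2), of "False # l"] by (simp add: cells_Cons)
        from is_ideal_uminus[OF J(1) this] show "koszul ys (\<lambda>l. b (False # l)) l \<in> J" by simp
      qed (use b in simp)
      show "coboundary I J ys i (\<lambda>l. c l - z * b (False # l))" unfolding coboundary_def
      proof (intro exI[of _ "\<lambda>l. - b (True # l)"] conjI allI ballI)
        fix l assume "l \<in> cells (length ys) i"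
        then show "c l - z * b (False # l) - koszul ys (\<lambda>l. - b (True # l)) l \<in> J"
          using bspec[OF b(2), of "True # l"] by (simp add: cells_Cons koszul_uminus algebra_simps)
      qed (use b is_ideal_uminus[OF I(1)] in simp)
    qed
  qed
  then have IH: "regular I J (rev ys)" using Cons.IH Cons.prems by simp
  let ?Q = "foldl (adjoin I) J (rev ys)" and ?n = "length ys"
  have "a \<in> ?Q" if a: "a \<in> I" "z * a \<in> ?Q" for a
  proof -
    obtain b where b: "\<forall>l. b l \<in> I" "z * a - koszul ys b (replicate ?n True) \<in> J"
      using a(2) top_koszul[OF I(1) J(1)] by blast
    have "cocycle I J (z # ys) ?n (\<lambda>l. if hd l then b (tl l) else a)"
      unfolding cocycle_def using b a cells_top[of "Suc ?n"] by auto
    moreover have "exact_at I J (z # ys) ?n" by (intro Cons.prems) auto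
    ultimately obtain c where c: "\<forall>l. c l \<in> I"
      "\<forall>l\<in>cells (Suc ?n) ?n. (if hd l then b (tl l) else a) - koszul (z # ys) c l \<in> J"
      by (auto elim!: exact_atE simp del: koszul.simps)
    have "False # replicate ?n True \<in> cells (Suc ?n) ?n"
      using cells_top[of ?n] by (simp add: cells_Cons)
    from bspec[OF c(2) this] have "a - koszul ys (\<lambda>l. c (False # l)) (replicate ?n True) \<in> J" by simp
    then show ?thesis
      using c(1) by (intro iffD1[OF top_koszul[OF I(1) J(1)]] exI[of _ "\<lambda>l. c (False # l)"]) auto
  qed
  then show ?case using IH by (simp add: regular_append)
qed

end

section \<open>Polynomials and Stanley--Reisner ideals\<close>

abbreviation keys where "keys \<equiv> Poly_Mapping.keys"
abbreviation lookup where "lookup \<equiv> Poly_Mapping.lookup"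
abbreviation single where "single \<equiv> Poly_Mapping.single"

text \<open>
  The Stanley--Reisner ideal in the polynomial ring in all variables of the type, so that it is
  independent of a ground set.
\<close>

definition face_ideal :: "'v set set \<Rightarrow> ('v, 'k::field) mpoly set" where
  "face_ideal \<Delta> = {p. \<forall>m\<in>keys p. keys m \<notin> \<Delta>}"

lemma carrier_poly_ring: "carrier (poly_ring V) = {p. \<forall>m\<in>keys p. keys m \<subseteq> V}"
  by (simp add: poly_ring_def)

lemma poly_ring_simps [simp]:
  "mult (poly_ring V) = (*)" "one (poly_ring V) = 1" "zero (poly_ring V) = 0" "add (poly_ring V) = (+)"
  by (simp_all add: poly_ring_def)

lemma poly_expand: "p = (\<Sum>m\<in>keys p. single m (lookup p m))"
  by (rule poly_mapping_eqI)
    (auto simp: lookup_sum lookup_single when_def in_keys_iff sum.delta cong: if_cong)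

lemma keys_add_nat: "keys (a + b :: 'v \<Rightarrow>\<^sub>0 nat) = keys a \<union> keys b"
  by (auto simp: in_keys_iff lookup_add)

lemma is_ideal_face_ideal:
  assumes "\<And>\<sigma> \<tau>. \<sigma> \<in> \<Delta> \<Longrightarrow> \<tau> \<subseteq> \<sigma> \<Longrightarrow> \<tau> \<in> \<Delta>"
  shows "is_ideal (face_ideal \<Delta> :: ('v, 'k::field) mpoly set)"
  unfolding is_ideal_def
proof (intro conjI ballI allI)
  fix a b :: "('v, 'k) mpoly" assume "a \<in> face_ideal \<Delta>" "b \<in> face_ideal \<Delta>"
  then show "a + b \<in> face_ideal \<Delta>"
    using Poly_Mapping.keys_add[of a b] unfolding face_ideal_def by blast
next
  fix r a :: "('v, 'k) mpoly" assume a: "a \<in> face_ideal \<Delta>"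
  have "keys m \<notin> \<Delta>" if m: "m \<in> keys (r * a)" for m
  proof -
    obtain k l where "m = k + l" "l \<in> keys a" using m keys_mult[of r a] by auto
    then show ?thesis using a assms[of "keys m" "keys l"] by (auto simp: face_ideal_def keys_add_nat)
  qed
  then show "r * a \<in> face_ideal \<Delta>" by (simp add: face_ideal_def)
qed (simp add: face_ideal_def)

lemma poly_ring_closed:
  fixes p q :: "('v, 'k::field) mpoly"
  shows "0 \<in> carrier (poly_ring V :: ('v, 'k) mpoly ring)" "1 \<in> carrier (poly_ring V :: ('v, 'k) mpoly ring)"
    and "p \<in> carrier (poly_ring V) \<Longrightarrow> q \<in> carrier (poly_ring V) \<Longrightarrow> p + q \<in> carrier (poly_ring V)"
    and "p \<in> carrier (poly_ring V) \<Longrightarrow> q \<in> carrier (poly_ring V) \<Longrightarrow> p * q \<in> carrier (poly_ring V)"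
    and "p \<in> carrier (poly_ring V) \<Longrightarrow> - p \<in> carrier (poly_ring V)"
    and "p \<in> carrier (poly_ring V) \<Longrightarrow> q \<in> carrier (poly_ring V) \<Longrightarrow> p - q \<in> carrier (poly_ring V)"
    and "p \<in> carrier (poly_ring V) \<Longrightarrow> p ^ n \<in> carrier (poly_ring V)"
    and "keys m \<subseteq> V \<Longrightarrow> single m c \<in> carrier (poly_ring V :: ('v, 'k) mpoly ring)"
proof -
  note c = cring.cring_simprules[OF cring_poly_ring[where ?'v = 'v and ?'k = 'k], unfolded poly_ring_simps]
  show "0 \<in> carrier (poly_ring V :: ('v, 'k) mpoly ring)" by (rule c(2))
  show one: "1 \<in> carrier (poly_ring V :: ('v, 'k) mpoly ring)" by (rule c(6))
  show "p + q \<in> carrier (poly_ring V)"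
    if "p \<in> carrier (poly_ring V)" "q \<in> carrier (poly_ring V)"
    using that by (rule c(1))
  show mult: "p * q \<in> carrier (poly_ring V)"
    if "p \<in> carrier (poly_ring V)" "q \<in> carrier (poly_ring V)" for p q :: "('v, 'k) mpoly"
    using that by (rule c(5))
  show neg: "- p \<in> carrier (poly_ring V)" if "p \<in> carrier (poly_ring V)" for p :: "('v, 'k) mpoly"
    using that by (simp add: carrier_poly_ring)
  show "p - q \<in> carrier (poly_ring V)"
    if "p \<in> carrier (poly_ring V)" "q \<in> carrier (poly_ring V)"
    using c(1)[OF that(1) neg[OF that(2)]] by simp
  show "p ^ n \<in> carrier (poly_ring V)" if "p \<in> carrier (poly_ring V)"
  proof (induction n)
    case 0 show ?case using one by simp
  next
    case (Suc n) show ?case using mult[OF that Suc] by simp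
  qed
  show "single m c \<in> carrier (poly_ring V :: ('v, 'k) mpoly ring)" if "keys m \<subseteq> V"
    using that by (simp add: carrier_poly_ring)
qed

lemma poly_ring_sum_closed:
  "(\<And>i. i \<in> A \<Longrightarrow> f i \<in> carrier (poly_ring V)) \<Longrightarrow> sum f A \<in> carrier (poly_ring V)"
  by (induction A rule: infinite_finite_induct) (auto simp: poly_ring_closed)

lemma poly_ring_minus:
  assumes "p \<in> carrier (poly_ring V)" shows "\<ominus>\<^bsub>poly_ring V\<^esub> p = - p"
proof -
  interpret R: cring "poly_ring V :: ('a, 'b) mpoly ring" by (rule cring_poly_ring)
  show ?thesis by (rule R.minus_equality) (use assms poly_ring_closed in auto)
qed

lemma ideal_poly_ringI:
  assumes "I \<subseteq> carrier (poly_ring V)" "0 \<in> I" "\<And>a b. a \<in> I \<Longrightarrow> b \<in> I \<Longrightarrow> a + b \<in> I"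
    and mult: "\<And>r a. r \<in> carrier (poly_ring V) \<Longrightarrow> a \<in> I \<Longrightarrow> r * a \<in> I"
  shows "ideal I (poly_ring V :: ('v, 'k::field) mpoly ring)"
proof (rule idealI)
  interpret R: cring "poly_ring V :: ('v, 'k) mpoly ring" by (rule cring_poly_ring)
  show "ring (poly_ring V :: ('v, 'k) mpoly ring)" by (rule R.ring_axioms)
  have "(- 1 :: ('v, 'k) mpoly) \<in> carrier (poly_ring V)" by (intro poly_ring_closed)
  then have "- a \<in> I" if "a \<in> I" for a
    using mult[of "-1" a] that by simp
  then show "subgroup I (add_monoid (poly_ring V))"
    using assms(1-3) by (intro R.add.subgroupI) (auto simp: poly_ring_minus a_inv_def[symmetric])
  show "x \<otimes>\<^bsub>poly_ring V\<^esub> a \<in> I" "a \<otimes>\<^bsub>poly_ring V\<^esub> x \<in> I"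
    if "a \<in> I" "x \<in> carrier (poly_ring V)" for a x
    using mult[OF that(2,1)] by (simp_all add: mult.commute)
qed

lemma ideal_poly_ringD:
  fixes I :: "('v, 'k::field) mpoly set"
  assumes "ideal I (poly_ring V)"
  shows "I \<subseteq> carrier (poly_ring V)" "0 \<in> I"
    and "a \<in> I \<Longrightarrow> b \<in> I \<Longrightarrow> a + b \<in> I" "a \<in> I \<Longrightarrow> - a \<in> I"
    and "r \<in> carrier (poly_ring V) \<Longrightarrow> a \<in> I \<Longrightarrow> r * a \<in> I"
proof -
  interpret I: ideal I "poly_ring V :: ('v, 'k) mpoly ring" by fact
  show "I \<subseteq> carrier (poly_ring V)" by (rule I.a_subset)
  show "0 \<in> I" using additive_subgroup.zero_closed[OF I.is_additive_subgroup] by simp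
  show "a + b \<in> I" if "a \<in> I" "b \<in> I"
    using additive_subgroup.a_closed[OF I.is_additive_subgroup that] by simp
  show mult: "r * a \<in> I" if "r \<in> carrier (poly_ring V)" "a \<in> I" for r a
    using I.I_l_closed[OF that(2,1)] by simp
  have "(- 1 :: ('v, 'k) mpoly) \<in> carrier (poly_ring V)" by (intro poly_ring_closed)
  then show "- a \<in> I" if "a \<in> I" using mult[OF _ that, of "- 1"] by simp
qed

lemma ideal_carrier_Int:
  assumes "is_ideal I" shows "ideal (carrier (poly_ring V) \<inter> I) (poly_ring V)"
  by (rule ideal_poly_ringI) (use assms in \<open>auto simp: poly_ring_closed is_ideal_closed\<close>)

definition squarefree_monomial :: "'v set \<Rightarrow> 'v \<Rightarrow>\<^sub>0 nat" where
  "squarefree_monomial \<sigma> = (\<Sum>v\<in>\<sigma>. single v 1)"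

lemma lookup_squarefree_monomial: "finite \<sigma> \<Longrightarrow> lookup (squarefree_monomial \<sigma>) v = (if v \<in> \<sigma> then 1 else 0)"
  by (simp add: squarefree_monomial_def lookup_sum lookup_single when_def sum.delta)

lemma keys_squarefree_monomial: "finite \<sigma> \<Longrightarrow> keys (squarefree_monomial \<sigma>) = \<sigma>"
  by (auto simp: in_keys_iff lookup_squarefree_monomial split: if_splits)

lemma prod_var: "finite \<sigma> \<Longrightarrow> (\<Prod>v\<in>\<sigma>. var v) = single (squarefree_monomial \<sigma>) 1"
  by (induction \<sigma> rule: finite_induct) (auto simp: squarefree_monomial_def var_def mult_single)

text \<open>
  A Stanley--Reisner ideal is spanned by its monomials.
\<close>

lemma SR_ideal_eq:
  assumes "simplicial_complex V \<Delta>"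
  shows "SR_ideal V \<Delta> = carrier (poly_ring V) \<inter> (face_ideal \<Delta> :: ('v, 'k::field) mpoly set)"
proof
  interpret R: cring "poly_ring V :: ('v, 'k) mpoly ring" by (rule cring_poly_ring)
  have fin: "finite V" using assms by (simp add: simplicial_complex_def)
  have J: "is_ideal (face_ideal \<Delta> :: ('v, 'k) mpoly set)"
    by (rule is_ideal_face_ideal) (use assms in \<open>auto simp: simplicial_complex_def\<close>)
  have gen: "{\<Prod>v\<in>\<sigma>. var v | \<sigma>. \<sigma> \<subseteq> V \<and> \<sigma> \<notin> \<Delta>} \<subseteq>
      carrier (poly_ring V) \<inter> (face_ideal \<Delta> :: ('v, 'k::field) mpoly set)"
    using finite_subset[OF _ fin]
    by (auto simp: prod_var carrier_poly_ring face_ideal_def keys_squarefree_monomial)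
  show "SR_ideal V \<Delta> \<subseteq> carrier (poly_ring V) \<inter> (face_ideal \<Delta> :: ('v, 'k) mpoly set)"
    unfolding SR_ideal_def by (rule R.genideal_minimal[OF ideal_carrier_Int[OF J] gen])
  interpret I: ideal "SR_ideal V \<Delta> :: ('v, 'k) mpoly set" "poly_ring V" by (rule ideal_SR_ideal)
  show "carrier (poly_ring V) \<inter> (face_ideal \<Delta> :: ('v, 'k) mpoly set) \<subseteq> SR_ideal V \<Delta>"
  proof
    fix p :: "('v, 'k) mpoly" assume p: "p \<in> carrier (poly_ring V) \<inter> face_ideal \<Delta>"
    have mon: "single m (lookup p m) \<in> SR_ideal V \<Delta>" if "m \<in> keys p" for m
    proof -
      have m: "keys m \<subseteq> V" "keys m \<notin> \<Delta>" using p that by (auto simp: carrier_poly_ring face_ideal_def)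
      have "(\<Prod>v\<in>keys m. var v) \<in> (SR_ideal V \<Delta> :: ('v, 'k) mpoly set)"
        unfolding SR_ideal_def
        by (rule set_mp[OF R.genideal_self]) (use gen m in auto)
      moreover have "single (m - squarefree_monomial (keys m)) (lookup p m) \<in> carrier (poly_ring V)"
        by (rule poly_ring_closed(8)) (use m in \<open>auto simp: in_keys_iff lookup_minus subset_iff\<close>)
      ultimately have "single (m - squarefree_monomial (keys m)) (lookup p m) * (\<Prod>v\<in>keys m. var v) \<in> SR_ideal V \<Delta>"
        using I.I_l_closed by simp
      moreover have "m - squarefree_monomial (keys m) + squarefree_monomial (keys m) = m"
        by (rule poly_mapping_eqI) (auto simp: lookup_add lookup_minus lookup_squarefree_monomial in_keys_iff)
      ultimately show ?thesis by (simp add: prod_var mult_single)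
    qed
    have "(\<Sum>m\<in>A. single m (lookup p m)) \<in> SR_ideal V \<Delta>" if "finite A" "A \<subseteq> keys p" for A
      using that
    proof (induction A rule: finite_induct)
      case empty then show ?case using I.zero_closed by simp
    next
      case (insert m A) then show ?case using I.a_closed[of "single m (lookup p m)"] mon by simp
    qed
    from this[of "keys p"] show "p \<in> SR_ideal V \<Delta>" using poly_expand[of p] by simp
  qed
qed

definition monomial_degree :: "('v \<Rightarrow>\<^sub>0 nat) \<Rightarrow> nat" where
  "monomial_degree m = (\<Sum>v\<in>keys m. lookup m v)"

lemma monomial_degree_superset: "finite A \<Longrightarrow> keys m \<subseteq> A \<Longrightarrow> monomial_degree m = (\<Sum>v\<in>A. lookup m v)"
  unfolding monomial_degree_def by (rule sum.mono_neutral_left) (auto simp: in_keys_iff)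

lemma monomial_degree_add: "monomial_degree (a + b) = monomial_degree a + monomial_degree b"
proof -
  let ?A = "keys a \<union> keys b"
  have "monomial_degree (a + b) = (\<Sum>v\<in>?A. lookup a v + lookup b v)"
    using monomial_degree_superset[of ?A "a + b"] by (simp add: keys_add_nat lookup_add)
  then show ?thesis using monomial_degree_superset[of ?A a] monomial_degree_superset[of ?A b] by (simp add: sum.distrib)
qed

definition hom_part :: "nat \<Rightarrow> ('v, 'k::field) mpoly \<Rightarrow> ('v, 'k) mpoly" where
  "hom_part n p = Poly_Mapping.mapp (\<lambda>m c. c when monomial_degree m = n) p"

lemma lookup_hom_part: "lookup (hom_part n p) m = (lookup p m when monomial_degree m = n)"
  by (auto simp: hom_part_def Poly_Mapping.lookup_mapp when_def in_keys_iff)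

lemma hom_part_add: "hom_part n (p + q) = hom_part n p + hom_part n q"
  by (rule poly_mapping_eqI) (simp add: lookup_hom_part lookup_add when_add_distrib)

lemma hom_part_zero: "hom_part n 0 = 0"
  by (rule poly_mapping_eqI) (simp add: lookup_hom_part)

lemma hom_part_sum: "hom_part n (sum f A) = (\<Sum>i\<in>A. hom_part n (f i))"
  by (induction A rule: infinite_finite_induct) (auto simp: hom_part_add hom_part_zero)

lemma hom_part_single: "hom_part n (single m c) = (single m c when monomial_degree m = n)"
  by (rule poly_mapping_eqI) (auto simp: lookup_hom_part lookup_single when_def)

interpretation total_degree: grading "hom_part :: nat \<Rightarrow> ('v, 'k::field) mpoly \<Rightarrow> ('v, 'k) mpoly"
proof
  fix p :: "('v, 'k) mpoly"
  show "\<forall>\<^sub>F N in sequentially. p = (\<Sum>n<N. hom_part n p)"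
    unfolding eventually_sequentially
  proof (intro exI allI impI)
    fix N assume N: "Suc (\<Sum>m\<in>keys p. monomial_degree m) \<le> N"
    show "p = (\<Sum>n<N. hom_part n p)"
    proof (rule poly_mapping_eqI)
      fix m
      have "monomial_degree m < N" if "m \<in> keys p"
        using N member_le_sum[of m "keys p" monomial_degree] that by simp
      then show "lookup p m = lookup (\<Sum>n<N. hom_part n p) m"
        by (cases "m \<in> keys p") (auto simp: lookup_sum lookup_hom_part when_def in_keys_iff)
    qed
  qed
qed (rule hom_part_add)

text \<open>
  Both sides are additive in \<open>y\<close> and in \<open>a\<close>, so it suffices to compare them on monomials.
\<close>

lemma homogeneous_poly:
  assumes "\<forall>m\<in>keys y. monomial_degree m = d"
  shows "total_degree.homogeneous d (y :: ('v, 'k::field) mpoly)"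
  unfolding total_degree.homogeneous_def
proof (intro allI)
  fix n and a :: "('v, 'k) mpoly"
  have mono: "hom_part n (single m c * single k e) = (if d \<le> n then single m c * hom_part (n - d) (single k e) else 0)"
    if "monomial_degree m = d" for m c k and e :: 'k
    using that by (auto simp: mult_single hom_part_single monomial_degree_add when_def)
  have "hom_part n (single m c * a) = (if d \<le> n then single m c * hom_part (n - d) a else 0)"
    if "monomial_degree m = d" for m c
    by (subst (1 2) poly_expand[of a]) (simp add: sum_distrib_left hom_part_sum mono[OF that])
  then show "hom_part n (y * a) = (if d \<le> n then y * hom_part (n - d) a else 0)"
    using assms by (subst (1 2) poly_expand[of y]) (simp add: sum_distrib_right hom_part_sum)
qed

lemma graded_face_ideal: "total_degree.graded (face_ideal \<Delta>)"
  by (auto simp: total_degree.graded_def face_ideal_def in_keys_iff lookup_hom_part when_def split: if_splits)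

section \<open>Elementary symmetric polynomials as parameters\<close>

definition esym :: "'v set \<Rightarrow> nat \<Rightarrow> ('v, 'k::field) mpoly" where
  "esym U i = (\<Sum>\<sigma> | \<sigma> \<subseteq> U \<and> card \<sigma> = i. \<Prod>v\<in>\<sigma>. var v)"

lemma keys_esym:
  assumes "finite U" "m \<in> keys (esym U i :: ('v, 'k::field) mpoly)"
  obtains \<sigma> where "\<sigma> \<subseteq> U" "card \<sigma> = i" "m = squarefree_monomial \<sigma>"
proof -
  have "keys (esym U i :: ('v, 'k) mpoly) \<subseteq> squarefree_monomial ` {\<sigma>. \<sigma> \<subseteq> U \<and> card \<sigma> = i}"
  proof -
    have "lookup (esym U i :: ('v, 'k) mpoly) m = 0" if "m \<notin> squarefree_monomial ` {\<sigma>. \<sigma> \<subseteq> U \<and> card \<sigma> = i}" for m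
      using that finite_subset[OF _ assms(1)]
      by (auto simp: esym_def lookup_sum prod_var lookup_single when_def intro!: sum.neutral)
    then show ?thesis by (auto simp: in_keys_iff)
  qed
  then show thesis using assms(2) that by auto
qed

lemma homogeneous_esym: "finite U \<Longrightarrow> total_degree.homogeneous i (esym U i :: ('v, 'k::field) mpoly)"
proof (rule homogeneous_poly, intro ballI)
  fix m assume U: "finite U" and "m \<in> keys (esym U i :: ('v, 'k) mpoly)"
  then obtain \<sigma> where s: "\<sigma> \<subseteq> U" "card \<sigma> = i" "m = squarefree_monomial \<sigma>" by (rule keys_esym)
  then have "finite \<sigma>" using U finite_subset by blast
  then show "monomial_degree m = i" using s monomial_degree_superset[of \<sigma> m] by (simp add: keys_squarefree_monomial lookup_squarefree_monomial)
qed

text \<open>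
  Expanding \<open>0 = \<Prod>\<^sub>u (x\<^sub>v - x\<^sub>u)\<close> gives an equation of integral dependence of \<open>x\<^sub>v\<close> on the
  elementary symmetric polynomials.
\<close>

lemma var_power_esym:
  assumes Z: "is_ideal Z" and U: "finite U" "(v :: 'v) \<in> U"
    and e: "\<And>i. 1 \<le> i \<Longrightarrow> i \<le> card U \<Longrightarrow> esym U i \<in> Z"
  shows "var v ^ card U \<in> (Z :: ('v, 'k::field) mpoly set)"
proof -
  let ?x = "var :: 'v \<Rightarrow> ('v, 'k) mpoly" and ?n = "card U"
  have "0 = (\<Prod>u\<in>U. ?x v - ?x u)" using U by (intro prod_zero[symmetric]) auto
  also have "\<dots> = (\<Sum>X\<in>Pow U. (-1) ^ card X * (\<Prod>x\<in>X. ?x x) * (\<Prod>x\<in>U - X. ?x v))"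
    by (rule prod_diff_conv_sum[OF U(1)])
  also have "\<dots> = (\<Sum>X\<in>Pow U. (-1) ^ card X * ?x v ^ (?n - card X) * (\<Prod>x\<in>X. ?x x))"
    by (intro sum.cong) (auto simp: card_Diff_subset finite_subset[OF _ U(1)] mult_ac)
  also have "\<dots> = (\<Sum>i\<le>?n. \<Sum>X\<in>{X \<in> Pow U. card X = i}. (-1) ^ card X * ?x v ^ (?n - card X) * (\<Prod>x\<in>X. ?x x))"
    using U by (intro sum.group[symmetric]) (auto simp: card_mono)
  also have "\<dots> = (\<Sum>i\<le>?n. (-1) ^ i * ?x v ^ (?n - i) * esym U i)"
    by (intro sum.cong) (auto simp: esym_def sum_distrib_left)
  also have "\<dots> = ?x v ^ ?n * esym U 0 + (\<Sum>i\<in>{1..?n}. (-1) ^ i * ?x v ^ (?n - i) * esym U i)"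
    by (subst sum.atMost_shift) (simp add: sum.shift_bounds_cl_Suc_ivl sum.atLeast1_atMost_eq)
  also have "esym U 0 = (1 :: ('v, 'k) mpoly)"
  proof -
    have "{\<sigma>. \<sigma> \<subseteq> U \<and> card \<sigma> = 0} = {{}}" using U finite_subset by fastforce
    then show ?thesis by (simp add: esym_def)
  qed
  finally have "?x v ^ ?n = - (\<Sum>i\<in>{1..?n}. (-1) ^ i * ?x v ^ (?n - i) * esym U i)"
    by (simp add: eq_neg_iff_add_eq_0)
  moreover have "(\<Sum>i\<in>A. (-1) ^ i * ?x v ^ (?n - i) * esym U i) \<in> Z" if "finite A" "A \<subseteq> {1..?n}" for A
    using that by (induction A rule: finite_induct) (auto intro!: is_ideal_closed[OF Z] e)
  ultimately show ?thesis using is_ideal_uminus[OF Z] by auto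
qed

definition radical :: "'a::comm_ring_1 set \<Rightarrow> 'a set" where
  "radical Z = {z. \<exists>N. z ^ N \<in> Z}"

lemma is_ideal_radical: assumes Z: "is_ideal Z" shows "is_ideal (radical Z)"
  unfolding is_ideal_def
proof (intro conjI ballI allI)
  show "0 \<in> radical Z" using is_ideal_0[OF Z] by (auto simp: radical_def intro!: exI[of _ 1])
next
  fix a b assume "a \<in> radical Z" "b \<in> radical Z"
  then obtain M N where MN: "a ^ M \<in> Z" "b ^ N \<in> Z" by (auto simp: radical_def)
  have summand: "of_nat ((M + N) choose k) * a ^ k * b ^ (M + N - k) \<in> Z" for k
  proof (cases "M \<le> k")
    case True
    then have "a ^ k = a ^ (k - M) * a ^ M" by (simp flip: power_add)
    moreover have "(of_nat ((M + N) choose k) * a ^ (k - M) * b ^ (M + N - k)) * a ^ M \<in> Z"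
      by (rule is_ideal_mult[OF Z MN(1)])
    ultimately show ?thesis by (simp add: mult_ac)
  next
    case False
    then have "b ^ (M + N - k) = b ^ (M - k) * b ^ N" by (simp flip: power_add)
    moreover have "(of_nat ((M + N) choose k) * a ^ k * b ^ (M - k)) * b ^ N \<in> Z"
      by (rule is_ideal_mult[OF Z MN(2)])
    ultimately show ?thesis by (simp add: mult_ac)
  qed
  have "(\<Sum>k\<in>A. of_nat ((M + N) choose k) * a ^ k * b ^ (M + N - k)) \<in> Z" if "finite A" for A
    using that by (induction A rule: finite_induct) (auto intro: is_ideal_0[OF Z] is_ideal_add[OF Z] summand)
  then have "(a + b) ^ (M + N) \<in> Z" by (simp add: binomial_ring)
  then show "a + b \<in> radical Z" unfolding radical_def by blast
next
  fix r a assume "a \<in> radical Z"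
  then show "r * a \<in> radical Z"
    unfolding radical_def by (auto simp: power_mult_distrib intro: is_ideal_mult[OF Z])
qed

lemma irrelevant_subset_radical:
  assumes "is_ideal Z" "\<And>v. v \<in> V \<Longrightarrow> var v \<in> radical Z"
  shows "irrelevant_ideal V \<subseteq> radical Z"
proof -
  interpret R: cring "poly_ring V :: ('a, 'b) mpoly ring" by (rule cring_poly_ring)
  have "irrelevant_ideal V \<subseteq> carrier (poly_ring V) \<inter> radical Z"
    unfolding irrelevant_ideal_def
    by (rule R.genideal_minimal[OF ideal_carrier_Int[OF is_ideal_radical[OF assms(1)]]])
      (use assms(2) in \<open>auto simp: carrier_poly_ring var_def\<close>)
  then show ?thesis by blast
qed

section \<open>Relations between polynomials modulo a Stanley--Reisner ideal\<close>

lemma underdetermined_system: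
  fixes M :: "'a \<Rightarrow> 'b \<Rightarrow> 'k::field"
  assumes "finite B" "finite A" "card B < card A"
  shows "\<exists>c. (\<exists>a\<in>A. c a \<noteq> 0) \<and> (\<forall>b\<in>B. (\<Sum>a\<in>A. c a * M a b) = 0)"
  using assms
proof (induction B arbitrary: A M rule: finite_induct)
  case empty
  then obtain a where "a \<in> A" by fastforce
  then show ?case by (intro exI[of _ "\<lambda>_. 1"]) auto
next
  case (insert b B)
  show ?case
  proof (cases "\<forall>a\<in>A. M a b = 0")
    case True
    have "card B < card A" using insert by simp
    from insert.IH[OF insert.prems(1) this, of M] obtain c where
      "\<exists>a\<in>A. c a \<noteq> 0" "\<forall>b\<in>B. (\<Sum>a\<in>A. c a * M a b) = 0" by blast
    then show ?thesis using True by (intro exI[of _ c]) auto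
  next
    case False
    then obtain a0 where a0: "a0 \<in> A" "M a0 b \<noteq> 0" by blast
    let ?A = "A - {a0}"
    have fin: "finite ?A" and cd: "card B < card ?A" using insert a0 by auto
    from insert.IH[OF this, of "\<lambda>a b'. M a b' - M a b / M a0 b * M a0 b'"] obtain c where
      c: "\<exists>a\<in>?A. c a \<noteq> 0"
        "\<forall>b'\<in>B. (\<Sum>a\<in>?A. c a * (M a b' - M a b / M a0 b * M a0 b')) = 0" by blast
    define s where "s = (\<Sum>a\<in>?A. c a * M a b)"
    define c' where "c' = c(a0 := - s / M a0 b)"
    have sum: "(\<Sum>a\<in>A. c' a * M a b') = - s / M a0 b * M a0 b' + (\<Sum>a\<in>?A. c a * M a b')" for b'
      unfolding sum.remove[OF insert.prems(1) a0(1)] by (simp add: c'_def)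
    have "(\<Sum>a\<in>A. c' a * M a b') = 0" if "b' \<in> insert b B" for b'
    proof (cases "b' = b")
      case True then show ?thesis using a0 sum[of b] by (simp add: s_def)
    next
      case False
      then have "0 = (\<Sum>a\<in>?A. c a * (M a b' - M a b / M a0 b * M a0 b'))" using c(2) that by simp
      also have "\<dots> = (\<Sum>a\<in>?A. c a * M a b') - (\<Sum>a\<in>?A. c a * M a b * (M a0 b' / M a0 b))"
        by (simp add: algebra_simps sum_subtractf)
      also have "\<dots> = (\<Sum>a\<in>?A. c a * M a b') - s * (M a0 b' / M a0 b)"
        by (simp add: s_def sum_distrib_right sum_divide_distrib)
      finally show ?thesis using sum[of b'] by simp
    qed
    moreover have "\<exists>a\<in>A. c' a \<noteq> 0" using c(1) by (auto simp: c'_def)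
    ultimately show ?thesis by blast
  qed
qed

text \<open>
  The shape \<open>f\<^sub>1\<^sup>a (f\<^sub>2\<^sup>b (\<dots> (c + f\<^sub>r g\<^sub>r) \<dots> + f\<^sub>2 g\<^sub>2) + f\<^sub>1 g\<^sub>1)\<close> of a polynomial relation, where
  \<open>c\<close> is a nonzero constant.
\<close>

primrec nested_relations :: "('v, 'k::field) mpoly set \<Rightarrow> ('v, 'k) mpoly list \<Rightarrow> ('v, 'k) mpoly set" where
  "nested_relations C [] = {single 0 c | c. c \<noteq> 0}"
| "nested_relations C (f # fs) = {f ^ a * (z + f * g) | a z g. z \<in> nested_relations C fs \<and> g \<in> C}"

primrec powers :: "'a::comm_ring_1 list \<Rightarrow> nat list \<Rightarrow> 'a" where
  "powers [] \<alpha> = 1"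
| "powers (f # fs) \<alpha> = f ^ hd \<alpha> * powers fs (tl \<alpha>)"

definition exponents :: "nat \<Rightarrow> nat \<Rightarrow> nat list set" where
  "exponents r t = {\<alpha>. length \<alpha> = r \<and> set \<alpha> \<subseteq> {..<t}}"

lemma finite_exponents: "finite (exponents r t)"
  unfolding exponents_def using finite_lists_length_eq[of "{..<t}" r] by (simp add: conj_commute)

lemma card_exponents: "card (exponents r t) = t ^ r"
  unfolding exponents_def using card_lists_length_eq[of "{..<t}" r] by (simp add: conj_commute)

lemma sum_exponents_Suc: "(\<Sum>\<alpha>\<in>exponents (Suc r) t. F \<alpha>) = (\<Sum>a<t. \<Sum>\<beta>\<in>exponents r t. F (a # \<beta>))"
proof -
  have "(\<Sum>\<alpha>\<in>exponents (Suc r) t. F \<alpha>) = (\<Sum>(a, \<beta>)\<in>{..<t} \<times> exponents r t. F (a # \<beta>))"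
    by (rule sum.reindex_bij_witness[of _ "\<lambda>(a, \<beta>). a # \<beta>" "\<lambda>\<alpha>. (hd \<alpha>, tl \<alpha>)"])
      (auto simp: exponents_def length_Suc_conv)
  then show ?thesis by (simp add: sum.cartesian_product)
qed

lemma powers_carrier:
  "set fs \<subseteq> carrier (poly_ring V) \<Longrightarrow> powers fs \<alpha> \<in> carrier (poly_ring V :: ('v, 'k::field) mpoly ring)"
  by (induction fs arbitrary: \<alpha>) (auto intro!: poly_ring_closed)

text \<open>
  Factor out the lowest power of the first polynomial that occurs with a nonzero coefficient, and
  continue with the part of the sum in which this polynomial does not occur any more.
\<close>

lemma combination_nested:
  fixes c :: "nat list \<Rightarrow> 'k::field" and fs :: "('v, 'k) mpoly list"
  assumes "set fs \<subseteq> carrier (poly_ring V)" "\<exists>\<alpha>\<in>exponents (length fs) t. c \<alpha> \<noteq> 0"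
  shows "(\<Sum>\<alpha>\<in>exponents (length fs) t. single 0 (c \<alpha>) * powers fs \<alpha>) \<in> nested_relations (carrier (poly_ring V)) fs"
  using assms
proof (induction fs arbitrary: c)
  case Nil
  have "exponents 0 t = {[]}" by (auto simp: exponents_def)
  then show ?case using Nil by auto
next
  case (Cons f fs)
  let ?C = "carrier (poly_ring V :: ('v, 'k) mpoly ring)"
  define S where "S a = (\<Sum>\<beta>\<in>exponents (length fs) t. single 0 (c (a # \<beta>)) * powers fs \<beta>)" for a
  have S_C: "S a \<in> ?C" for a
    unfolding S_def using Cons.prems(1)
    by (intro poly_ring_sum_closed poly_ring_closed powers_carrier) auto
  define P where "P a \<longleftrightarrow> a < t \<and> (\<exists>\<beta>\<in>exponents (length fs) t. c (a # \<beta>) \<noteq> 0)" for a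
  obtain \<alpha> where \<alpha>: "\<alpha> \<in> exponents (Suc (length fs)) t" "c \<alpha> \<noteq> 0" using Cons.prems by auto
  then have "P (hd \<alpha>)" by (auto simp: P_def exponents_def length_Suc_conv intro!: bexI[of _ "tl \<alpha>"])
  define a where "a = (LEAST a. P a)"
  have "P a" unfolding a_def using \<open>P (hd \<alpha>)\<close> by (rule LeastI)
  have below: "S b = 0" if "b < a" for b
  proof -
    have "\<not> P b" using that not_less_Least unfolding a_def by blast
    moreover have "b < t" using that \<open>P a\<close> by (simp add: P_def)
    ultimately show ?thesis by (simp add: S_def P_def)
  qed
  have "(\<Sum>\<alpha>\<in>exponents (length (f # fs)) t. single 0 (c \<alpha>) * powers (f # fs) \<alpha>) = (\<Sum>b<t. f ^ b * S b)"
    by (simp add: sum_exponents_Suc S_def sum_distrib_left mult_ac)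
  also have "\<dots> = (\<Sum>b\<in>{a..<t}. f ^ b * S b)"
    by (rule sum.mono_neutral_right) (auto simp: below)
  also have "\<dots> = f ^ a * S a + (\<Sum>b\<in>{Suc a..<t}. f ^ b * S b)"
    using \<open>P a\<close> by (simp add: P_def sum.atLeast_Suc_lessThan)
  also have "(\<Sum>b\<in>{Suc a..<t}. f ^ b * S b) = f ^ a * (f * (\<Sum>b\<in>{Suc a..<t}. f ^ (b - Suc a) * S b))"
  proof -
    have "f ^ b = f ^ a * (f * f ^ (b - Suc a))" if "b \<in> {Suc a..<t}" for b
      using that by (simp flip: power_add power_Suc)
    then show ?thesis by (simp add: sum_distrib_left mult_ac)
  qed
  finally have "(\<Sum>\<alpha>\<in>exponents (length (f # fs)) t. single 0 (c \<alpha>) * powers (f # fs) \<alpha>) =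
      f ^ a * (S a + f * (\<Sum>b\<in>{Suc a..<t}. f ^ (b - Suc a) * S b))"
    by (simp add: distrib_left)
  moreover have "S a \<in> nested_relations ?C fs"
    unfolding S_def by (rule Cons.IH) (use Cons.prems \<open>P a\<close> in \<open>auto simp: P_def\<close>)
  moreover have "(\<Sum>b\<in>{Suc a..<t}. f ^ (b - Suc a) * S b) \<in> ?C"
    using Cons.prems(1) S_C by (intro poly_ring_sum_closed poly_ring_closed) auto
  ultimately show ?case by auto
qed

definition exp_bound :: "nat \<Rightarrow> ('v, 'k::field) mpoly \<Rightarrow> bool" where
  "exp_bound e p \<longleftrightarrow> (\<forall>m\<in>keys p. \<forall>v. lookup m v \<le> e)"

lemma exp_bound_mult:
  assumes "exp_bound a p" "exp_bound b q" shows "exp_bound (a + b) (p * q)"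
  unfolding exp_bound_def
proof (intro ballI allI)
  fix m v assume "m \<in> keys (p * q)"
  then obtain k l where "m = k + l" "k \<in> keys p" "l \<in> keys q" using keys_mult[of p q] by auto
  then show "lookup m v \<le> a + b"
    using assms by (auto simp: exp_bound_def lookup_add intro!: add_mono)
qed

lemma exp_bound_power: "exp_bound e p \<Longrightarrow> exp_bound (n * e) (p ^ n)"
proof (induction n)
  case 0 show ?case by (simp add: exp_bound_def)
next
  case (Suc n) then show ?case using exp_bound_mult[of e p "n * e" "p ^ n"] by simp
qed

lemma exp_bound_mono: "exp_bound a p \<Longrightarrow> a \<le> b \<Longrightarrow> exp_bound b p"
  unfolding exp_bound_def by (meson le_trans)

lemma exp_bound_exists: "\<exists>e. \<forall>p\<in>set ps. exp_bound e p"
proof (induction ps)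
  case Nil show ?case by simp
next
  case (Cons p ps)
  then obtain e where e: "\<forall>q\<in>set ps. exp_bound e q" by blast
  define e' where "e' = (\<Sum>m\<in>keys p. monomial_degree m)"
  have "lookup m v \<le> e'" if "m \<in> keys p" for m v
  proof -
    have "lookup m v \<le> monomial_degree m"
      unfolding monomial_degree_def by (cases "v \<in> keys m") (auto simp: in_keys_iff intro: member_le_sum)
    also have "\<dots> \<le> e'" unfolding e'_def using that by (intro member_le_sum) auto
    finally show ?thesis .
  qed
  then have "exp_bound e' p" by (simp add: exp_bound_def)
  then show ?case using e exp_bound_mono by (intro exI[of _ "max e e'"]) (auto intro: exp_bound_mono)
qed

lemma exp_bound_powers:
  assumes "\<forall>f\<in>set fs. exp_bound e f" "\<alpha> \<in> exponents (length fs) t"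
  shows "exp_bound (length fs * (t * e)) (powers fs \<alpha>)"
  using assms
proof (induction fs arbitrary: \<alpha>)
  case Nil show ?case by (simp add: exp_bound_def)
next
  case (Cons f fs)
  obtain a \<beta> where \<alpha>: "\<alpha> = a # \<beta>" "a < t" "\<beta> \<in> exponents (length fs) t"
    using Cons.prems(2) by (cases \<alpha>) (auto simp: exponents_def)
  have "exp_bound (a * e) (f ^ a)" using Cons.prems by (intro exp_bound_power) simp
  then have "exp_bound (t * e) (f ^ a)" by (rule exp_bound_mono) (use \<alpha> in simp)
  from exp_bound_mult[OF this Cons.IH[OF _ \<alpha>(3)]] show ?case using Cons.prems \<alpha> by simp
qed

lemma card_face_monomials:
  assumes "finite \<Delta>" "\<And>\<sigma>. \<sigma> \<in> \<Delta> \<Longrightarrow> finite \<sigma> \<and> card \<sigma> \<le> D"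
  shows "finite {m. keys m \<in> \<Delta> \<and> (\<forall>v. lookup m v \<le> e)}"
    and "card {m. keys m \<in> \<Delta> \<and> (\<forall>v. lookup m v \<le> e)} \<le> card \<Delta> * (e + 1) ^ D"
proof -
  have fixed: "finite {m. keys m = \<sigma> \<and> (\<forall>v. lookup m v \<le> e)} \<and>
      card {m. keys m = \<sigma> \<and> (\<forall>v. lookup m v \<le> e)} \<le> (e + 1) ^ D" if "\<sigma> \<in> \<Delta>" for \<sigma>
  proof -
    let ?M = "{m. keys m = \<sigma> \<and> (\<forall>v. lookup m v \<le> e)}"
    let ?f = "\<lambda>m. restrict (lookup m) \<sigma>" and ?E = "PiE \<sigma> (\<lambda>_. {..e})"
    have inj: "inj_on ?f ?M"
    proof (rule inj_onI, rule poly_mapping_eqI)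
      fix m m' v assume m: "m \<in> ?M" "m' \<in> ?M" "?f m = ?f m'"
      show "lookup m v = lookup m' v"
      proof (cases "v \<in> \<sigma>")
        case True then show ?thesis using fun_cong[OF m(3), of v] by simp
      next
        case False
        then have "v \<notin> keys m" "v \<notin> keys m'" using m by auto
        then show ?thesis by (simp add: in_keys_iff)
      qed
    qed
    have sub: "?f ` ?M \<subseteq> ?E" by auto
    have fin: "finite ?E" using assms(2)[OF that] by (intro finite_PiE) auto
    have "card ?E = (e + 1) ^ card \<sigma>" using assms(2)[OF that] by (simp add: card_PiE)
    also have "\<dots> \<le> (e + 1) ^ D" using assms(2)[OF that] by (intro power_increasing) auto
    finally show ?thesis using inj_on_finite[OF inj sub fin] card_inj_on_le[OF inj sub fin] by simp
  qed
  have eq: "{m. keys m \<in> \<Delta> \<and> (\<forall>v. lookup m v \<le> e)} =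
      (\<Union>\<sigma>\<in>\<Delta>. {m. keys m = \<sigma> \<and> (\<forall>v. lookup m v \<le> e)})" by auto
  show "finite {m. keys m \<in> \<Delta> \<and> (\<forall>v. lookup m v \<le> e)}"
    unfolding eq using assms(1) fixed by blast
  have "card {m. keys m \<in> \<Delta> \<and> (\<forall>v. lookup m v \<le> e)} \<le>
      (\<Sum>\<sigma>\<in>\<Delta>. card {m. keys m = \<sigma> \<and> (\<forall>v. lookup m v \<le> e)})"
    unfolding eq by (rule card_UN_le[OF assms(1)])
  also have "\<dots> \<le> (\<Sum>\<sigma>\<in>\<Delta>. (e + 1) ^ D)" using fixed by (intro sum_mono) blast
  finally show "card {m. keys m \<in> \<Delta> \<and> (\<forall>v. lookup m v \<le> e)} \<le> card \<Delta> * (e + 1) ^ D" by simp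
qed

lemma polynomial_growth:
  fixes N r e :: nat assumes "r > 0"
  shows "\<exists>t. N * (r * (t * e) + 1) ^ (r - 1) < t ^ r"
proof (intro exI)
  let ?K = "(r * e + 1) ^ (r - 1)" let ?t = "N * ?K + 1"
  have "r * (?t * e) + 1 \<le> (r * e + 1) * ?t" by (simp add: algebra_simps)
  then have "N * (r * (?t * e) + 1) ^ (r - 1) \<le> N * ((r * e + 1) * ?t) ^ (r - 1)"
    by (intro mult_left_mono power_mono) auto
  also have "\<dots> = (N * ?K) * ?t ^ (r - 1)" by (simp only: power_mult_distrib mult.assoc)
  also have "\<dots> < ?t * ?t ^ (r - 1)" by (intro mult_strict_right_mono) auto
  also have "\<dots> = ?t ^ r" using assms by (simp flip: power_Suc)
  finally show "N * (r * (?t * e) + 1) ^ (r - 1) < ?t ^ r" .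
qed

text \<open>
  There are \<open>t ^ r\<close> products of powers with exponents below \<open>t\<close>, whereas the monomials supported on
  faces that occur in them number at most a constant times \<open>t ^ (r - 1)\<close>.  For large \<open>t\<close>, a nontrivial
  linear combination of the products has no such monomial.
\<close>

lemma nested_face_ideal:
  fixes fs :: "('v, 'k::field) mpoly list"
  assumes "finite \<Delta>" "\<And>\<sigma>. \<sigma> \<in> \<Delta> \<Longrightarrow> finite \<sigma> \<and> card \<sigma> < length fs"
    and fs: "set fs \<subseteq> carrier (poly_ring V)"
  shows "nested_relations (carrier (poly_ring V)) fs \<inter> face_ideal \<Delta> \<noteq> {}"
proof -
  let ?r = "length fs"
  obtain e where e: "\<forall>f\<in>set fs. exp_bound e f" using exp_bound_exists by blast
  have "\<exists>t. card \<Delta> * (?r * (t * e) + 1) ^ (?r - 1) < t ^ ?r"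
  proof (cases "?r = 0")
    case True
    then have "\<Delta> = {}" using assms(2) by auto
    then show ?thesis using True by simp
  qed (use polynomial_growth in blast)
  then obtain t where t: "card \<Delta> * (?r * (t * e) + 1) ^ (?r - 1) < t ^ ?r" by blast
  let ?B = "{m. keys m \<in> \<Delta> \<and> (\<forall>v. lookup m v \<le> ?r * (t * e))}"
  have "finite \<sigma> \<and> card \<sigma> \<le> ?r - 1" if "\<sigma> \<in> \<Delta>" for \<sigma> using assms(2)[OF that] by auto
  note B = card_face_monomials[of \<Delta> "?r - 1" "?r * (t * e)", OF assms(1) this]
  have "card ?B < card (exponents ?r t)"
    using B(2) t by (simp add: card_exponents)
  from underdetermined_system[OF B(1) finite_exponents this, of "\<lambda>\<alpha> m. lookup (powers fs \<alpha>) m"]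
  obtain c :: "nat list \<Rightarrow> 'k" where c: "\<exists>\<alpha>\<in>exponents ?r t. c \<alpha> \<noteq> 0"
    "\<forall>m\<in>?B. (\<Sum>\<alpha>\<in>exponents ?r t. c \<alpha> * lookup (powers fs \<alpha>) m) = 0" by blast
  let ?p = "\<Sum>\<alpha>\<in>exponents ?r t. single 0 (c \<alpha>) * powers fs \<alpha>"
  have lookup_p: "lookup ?p m = (\<Sum>\<alpha>\<in>exponents ?r t. c \<alpha> * lookup (powers fs \<alpha>) m)" for m
    by (simp add: lookup_sum map.rep_eq when_def flip: mult_map_scale_conv_mult)
      (intro sum.cong; simp)
  have "keys m \<notin> \<Delta>" if m: "m \<in> keys ?p" for m
  proof
    assume face: "keys m \<in> \<Delta>"
    have "lookup ?p m \<noteq> 0" using m by (simp add: in_keys_iff)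
    then obtain \<alpha> where \<alpha>: "\<alpha> \<in> exponents ?r t" "lookup (powers fs \<alpha>) m \<noteq> 0"
      unfolding lookup_p by (metis (no_types, lifting) mult_zero_right sum.neutral)
    then have "m \<in> ?B" using exp_bound_powers[OF e \<alpha>(1)] face by (simp add: exp_bound_def in_keys_iff)
    then show False using c(2) \<open>lookup ?p m \<noteq> 0\<close> lookup_p by simp
  qed
  then have "?p \<in> face_ideal \<Delta>" by (simp add: face_ideal_def)
  then show ?thesis using combination_nested[OF fs c(1)] by blast
qed

lemma nested_carrier:
  "set fs \<subseteq> carrier (poly_ring V) \<Longrightarrow> nested_relations (carrier (poly_ring V)) fs \<subseteq> carrier (poly_ring V)"
  by (induction fs) (auto intro!: poly_ring_closed)

section \<open>Krull dimensions\<close>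

text \<open>
  Weights in the style of digits in a large base: finitely many monomials are told apart, on \<open>F\<close>, by
  an additive function with natural values.  This replaces a monomial order, for which the variables
  would have to be linearly ordered.
\<close>

lemma separating_weight:
  assumes "finite F" "finite (K :: ('v \<Rightarrow>\<^sub>0 nat) set)"
  shows "\<exists>c :: 'v \<Rightarrow> nat. \<forall>m\<in>K. \<forall>m'\<in>K. (\<Sum>v\<in>F. lookup m v * c v) = (\<Sum>v\<in>F. lookup m' v * c v) \<longrightarrow>
     (\<forall>v\<in>F. lookup m v = lookup m' v)"
  using assms(1)
proof (induction F rule: finite_induct)
  case empty show ?case by simp
next
  case (insert x F)
  then obtain c :: "'v \<Rightarrow> nat" where c: "\<And>m m'. m \<in> K \<Longrightarrow> m' \<in> K \<Longrightarrow>
      (\<Sum>v\<in>F. lookup m v * c v) = (\<Sum>v\<in>F. lookup m' v * c v) \<Longrightarrow> \<forall>v\<in>F. lookup m v = lookup m' v"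
    by blast
  define N where "N = Suc (\<Sum>m\<in>K. lookup m x)"
  have N: "lookup m x < N" if "m \<in> K" for m
    using member_le_sum[of m K "\<lambda>m. lookup m x"] that assms(2) by (simp add: N_def)
  define c' where "c' v = (if v = x then 1 else N * c v)" for v
  have w: "(\<Sum>v\<in>insert x F. lookup m v * c' v) = lookup m x + N * (\<Sum>v\<in>F. lookup m v * c v)" for m
  proof -
    have "(\<Sum>v\<in>F. lookup m v * c' v) = (\<Sum>v\<in>F. N * (lookup m v * c v))"
      using insert.hyps by (intro sum.cong) (auto simp: c'_def)
    then show ?thesis using insert.hyps by (simp add: c'_def sum_distrib_left)
  qed
  show ?case
  proof (intro exI[of _ c'] ballI impI)
    fix m m' v assume m: "m \<in> K" "m' \<in> K" "v \<in> insert x F"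
      and eq: "(\<Sum>v\<in>insert x F. lookup m v * c' v) = (\<Sum>v\<in>insert x F. lookup m' v * c' v)"
    let ?w = "\<lambda>m. \<Sum>v\<in>F. lookup m v * c v"
    have eq': "lookup m x + N * ?w m = lookup m' x + N * ?w m'" using eq by (simp only: w)
    have "lookup m x = lookup m' x"
      using arg_cong[OF eq', of "\<lambda>n. n mod N"] N[OF m(1)] N[OF m(2)] by simp
    moreover have "?w m = ?w m'"
      using arg_cong[OF eq', of "\<lambda>n. n div N"] N[OF m(1)] N[OF m(2)] by simp
    ultimately show "lookup m v = lookup m' v" using c[OF m(1,2)] m(3) by blast
  qed
qed

lemma lookup_mult_unique:
  fixes p q :: "('v, 'k::field) mpoly"
  assumes "\<And>a b. a \<in> keys p \<Longrightarrow> b \<in> keys q \<Longrightarrow> a + b = m + m' \<Longrightarrow> a = m \<and> b = m'"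
    and "m \<in> keys p" "m' \<in> keys q"
  shows "lookup (p * q) (m + m') = lookup p m * lookup q m'"
proof -
  have "p * q = (\<Sum>a\<in>keys p. \<Sum>b\<in>keys q. single (a + b) (lookup p a * lookup q b))"
    by (subst poly_expand[of p], subst poly_expand[of q]) (simp add: sum_product mult_single)
  then have "lookup (p * q) (m + m') = (\<Sum>a\<in>keys p. \<Sum>b\<in>keys q. lookup p a * lookup q b when a + b = m + m')"
    by (simp add: lookup_sum lookup_single)
  also have "\<dots> = (\<Sum>a\<in>keys p. \<Sum>b\<in>keys q. if a = m then (if b = m' then lookup p m * lookup q m' else 0) else 0)"
    by (intro sum.cong refl) (use assms(1) in \<open>auto simp: when_def\<close>)
  also have "\<dots> = (\<Sum>a\<in>keys p. if a = m then lookup p m * lookup q m' else 0)"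
    by (intro sum.cong refl) (use assms(3) in \<open>simp add: sum.delta\<close>)
  also have "\<dots> = lookup p m * lookup q m'"
    using assms(2) by simp
  finally show ?thesis .
qed

text \<open>
  Modulo the variables outside of \<open>F\<close>, the polynomial ring is a domain: among the monomials supported
  on \<open>F\<close>, those of maximal weight in \<open>p\<close> and in \<open>q\<close> have a product that cannot cancel.
\<close>

lemma face_ideal_Pow_prime:
  fixes p q :: "('v, 'k::field) mpoly"
  assumes F: "finite F" and pq: "p * q \<in> face_ideal (Pow F)"
  shows "p \<in> face_ideal (Pow F) \<or> q \<in> face_ideal (Pow F)"
proof (rule ccontr)
  assume neither: "\<not> (p \<in> face_ideal (Pow F) \<or> q \<in> face_ideal (Pow F))"
  define K where "K r = {m \<in> keys r. keys m \<subseteq> F}" for r :: "('v, 'k) mpoly"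
  have fin: "finite (K r)" for r by (simp add: K_def)
  have ne: "K p \<noteq> {}" "K q \<noteq> {}" using neither by (auto simp: K_def face_ideal_def)
  obtain c :: "'v \<Rightarrow> nat" where c: "\<And>m m'. m \<in> K p \<union> K q \<Longrightarrow> m' \<in> K p \<union> K q \<Longrightarrow>
      (\<Sum>v\<in>F. lookup m v * c v) = (\<Sum>v\<in>F. lookup m' v * c v) \<Longrightarrow> \<forall>v\<in>F. lookup m v = lookup m' v"
    using separating_weight[OF F, of "K p \<union> K q"] fin by blast
  define w where "w m = (\<Sum>v\<in>F. lookup m v * c v)" for m
  have w_add: "w (a + b) = w a + w b" for a b
    by (simp add: w_def lookup_add algebra_simps sum.distrib)
  have w_inj: "m = m'" if "m \<in> K p \<union> K q" "m' \<in> K p \<union> K q" "w m = w m'" for m m'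
  proof (rule poly_mapping_eqI)
    fix v show "lookup m v = lookup m' v"
    proof (cases "v \<in> F")
      case True then show ?thesis using c[OF that(1,2)] that(3) by (simp add: w_def)
    next
      case False
      then have "v \<notin> keys m" "v \<notin> keys m'" using that by (auto simp: K_def)
      then show ?thesis by (simp add: in_keys_iff)
    qed
  qed
  have "\<exists>m\<in>K r. \<forall>a\<in>K r. w a \<le> w m" if "K r \<noteq> {}" for r
  proof -
    have "Max (w ` K r) \<in> w ` K r" using fin that by (intro Max_in) auto
    then obtain m where "m \<in> K r" "w m = Max (w ` K r)" by auto
    then show ?thesis using fin by (intro bexI[of _ m]) auto
  qed
  then obtain m m' where m: "m \<in> K p" "\<forall>a\<in>K p. w a \<le> w m" and m': "m' \<in> K q" "\<forall>a\<in>K q. w a \<le> w m'"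
    using ne by blast
  have "lookup (p * q) (m + m') = lookup p m * lookup q m'"
  proof (rule lookup_mult_unique)
    fix a b assume ab: "a \<in> keys p" "b \<in> keys q" "a + b = m + m'"
    have "keys a \<union> keys b = keys m \<union> keys m'" using ab(3) by (metis keys_add_nat)
    then have "a \<in> K p" "b \<in> K q" using ab m m' by (auto simp: K_def)
    moreover from this have "w a \<le> w m" "w b \<le> w m'" "w a + w b = w m + w m'"
      using m m' ab(3) by (auto simp flip: w_add)
    moreover from this have "w a = w m" "w b = w m'" by linarith+
    ultimately show "a = m \<and> b = m'" using w_inj[of a m] w_inj[of b m'] m m' by blast
  qed (use m m' in \<open>auto simp: K_def\<close>)
  also have "\<dots> \<noteq> 0" using m m' by (auto simp: K_def in_keys_iff)
  finally have "m + m' \<in> keys (p * q)" by (simp add: in_keys_iff)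
  moreover have "keys (m + m') \<subseteq> F" using m m' by (auto simp: K_def keys_add_nat)
  ultimately show False using pq by (auto simp: face_ideal_def)
qed

text \<open>
  Peeling off the factors of such a relation along a chain of primes would put a nonzero constant
  into the last prime.
\<close>

lemma nested_prime_chain:
  fixes fs :: "('v, 'k::field) mpoly list"
  assumes "set fs \<subseteq> carrier (poly_ring V)"
    and "\<And>i. i \<le> length fs \<Longrightarrow> primeideal (Q i) (poly_ring V)"
    and "\<And>i. i < length fs \<Longrightarrow> Q i \<subseteq> Q (Suc i) \<and> fs ! i \<in> Q (Suc i) - Q i"
  shows "nested_relations (carrier (poly_ring V)) fs \<inter> Q 0 = {}"
  using assms
proof (induction fs arbitrary: Q)
  case Nil
  interpret primeideal "Q 0" "poly_ring V :: ('v, 'k) mpoly ring" using Nil by simp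
  have "single 0 c \<notin> Q 0" if c: "c \<noteq> 0" for c
  proof
    assume "single 0 c \<in> Q 0"
    then have "single 0 (inverse c) * single 0 c \<in> Q 0"
      using I_l_closed[of "single 0 c" "single 0 (inverse c)"] by (simp add: poly_ring_closed)
    then have "1 \<in> Q 0" using c by (simp add: mult_single)
    then show False using I_notcarr one_imp_carrier by simp
  qed
  then show ?case by auto
next
  case (Cons f fs)
  let ?C = "carrier (poly_ring V) :: ('v, 'k) mpoly set"
  have IH: "nested_relations ?C fs \<inter> Q (Suc 0) = {}"
  proof (rule Cons.IH[of "\<lambda>i. Q (Suc i)"])
    show "set fs \<subseteq> ?C" using Cons.prems(1) by simp
    show "primeideal (Q (Suc i)) (poly_ring V)" if "i \<le> length fs" for i
      using Cons.prems(2)[of "Suc i"] that by simp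
    show "Q (Suc i) \<subseteq> Q (Suc (Suc i)) \<and> fs ! i \<in> Q (Suc (Suc i)) - Q (Suc i)" if "i < length fs" for i
      using Cons.prems(3)[of "Suc i"] that by simp
  qed
  interpret Q0: primeideal "Q 0" "poly_ring V :: ('v, 'k) mpoly ring" using Cons.prems(2) by simp
  interpret Q1: primeideal "Q (Suc 0)" "poly_ring V :: ('v, 'k) mpoly ring" using Cons.prems(2)[of 1] by simp
  have f: "f \<in> ?C" "f \<notin> Q 0" "f \<in> Q (Suc 0)" "Q 0 \<subseteq> Q (Suc 0)"
    using Cons.prems(1) Cons.prems(3)[of 0] by auto
  have "f ^ a * (z + f * g) \<notin> Q 0" if z: "z \<in> nested_relations ?C fs" and g: "g \<in> ?C" for a z g
  proof
    have zC: "z \<in> ?C" using z nested_carrier[of fs V] Cons.prems(1) by auto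
    have C: "z + f * g \<in> ?C" using zC f g by (intro poly_ring_closed)
    assume "f ^ a * (z + f * g) \<in> Q 0"
    then have "z + f * g \<in> Q 0"
    proof (induction a)
      case (Suc a)
      have "f ^ a * (z + f * g) \<in> ?C" using C f(1) poly_ring_closed(4)[OF poly_ring_closed(7)] by blast
      then have "f ^ a * (z + f * g) \<in> Q 0"
        using Q0.I_prime[of f "f ^ a * (z + f * g)"] f Suc.prems by (simp add: mult.assoc)
      then show ?case by (rule Suc.IH)
    qed simp
    then have "z + f * g \<in> Q (Suc 0)" using f by blast
    moreover have "f * (- g) \<in> Q (Suc 0)"
      using Q1.I_r_closed[OF f(3), of "- g"] g by (simp add: poly_ring_closed)
    ultimately have "(z + f * g) + f * (- g) \<in> Q (Suc 0)"
      using additive_subgroup.a_closed[OF Q1.is_additive_subgroup, of "z + f * g" "f * (- g)"] by simp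
    then show False using IH z by auto
  qed
  then show ?case by auto
qed

lemma ideal_rcoset_eq_iff:
  assumes "ideal J R" "x \<in> carrier R" "y \<in> carrier R"
  shows "J +>\<^bsub>R\<^esub> x = J +>\<^bsub>R\<^esub> y \<longleftrightarrow> x \<ominus>\<^bsub>R\<^esub> y \<in> J"
proof -
  interpret ideal J R by fact
  show ?thesis using quotient_eq_iff_same_a_r_cos[OF assms] by auto
qed

lemma primeideal_Quot:
  assumes J: "ideal J R" and Q: "primeideal Q R" and sub: "J \<subseteq> Q"
  shows "primeideal (a_r_coset R J ` Q) (R Quot J)"
proof -
  interpret Q: primeideal Q R by fact
  interpret J: ideal J R by fact
  have mem: "x \<in> Q" if x: "x \<in> carrier R" "J +>\<^bsub>R\<^esub> x \<in> a_r_coset R J ` Q" for x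
  proof -
    obtain y where y: "y \<in> Q" "J +>\<^bsub>R\<^esub> x = J +>\<^bsub>R\<^esub> y" using x(2) by auto
    have yC: "y \<in> carrier R" by (rule Q.Icarr[OF y(1)])
    have "x \<ominus>\<^bsub>R\<^esub> y \<in> Q" using ideal_rcoset_eq_iff[OF J x(1) yC] y(2) sub by blast
    then have "(x \<ominus>\<^bsub>R\<^esub> y) \<oplus>\<^bsub>R\<^esub> y \<in> Q" using y(1) by (rule additive_subgroup.a_closed[OF Q.is_additive_subgroup])
    moreover have "(x \<ominus>\<^bsub>R\<^esub> y) \<oplus>\<^bsub>R\<^esub> y = x"
      using x(1) yC by (simp add: a_minus_def Q.a_assoc Q.l_neg)
    ultimately show ?thesis by simp
  qed
  show ?thesis
  proof (rule primeidealI)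
    show "ideal (a_r_coset R J ` Q) (R Quot J)"
      by (rule Q.ring_ideal_imp_quot_ideal[OF J Q.ideal_axioms])
    show "cring (R Quot J)" by (rule J.quotient_is_cring[OF Q.is_cring])
    show "carrier (R Quot J) \<noteq> a_r_coset R J ` Q"
    proof
      assume "carrier (R Quot J) = a_r_coset R J ` Q"
      then have "J +>\<^bsub>R\<^esub> x \<in> a_r_coset R J ` Q" if "x \<in> carrier R" for x
        using that by (auto simp: FactRing_def A_RCOSETS_def')
      then show False using mem Q.I_notcarr Q.a_subset by blast
    qed
    fix A B assume AB: "A \<in> carrier (R Quot J)" "B \<in> carrier (R Quot J)"
      "A \<otimes>\<^bsub>R Quot J\<^esub> B \<in> a_r_coset R J ` Q"
    obtain a b where ab: "a \<in> carrier R" "b \<in> carrier R" "A = J +>\<^bsub>R\<^esub> a" "B = J +>\<^bsub>R\<^esub> b"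
      using AB by (auto simp: FactRing_def A_RCOSETS_def')
    have "J +>\<^bsub>R\<^esub> (a \<otimes>\<^bsub>R\<^esub> b) \<in> a_r_coset R J ` Q"
    proof -
      have "A \<otimes>\<^bsub>R Quot J\<^esub> B = rcoset_mult R J A B" by (simp add: FactRing_def)
      also have "\<dots> = J +>\<^bsub>R\<^esub> (a \<otimes>\<^bsub>R\<^esub> b)"
        unfolding ab(3,4) by (rule J.rcoset_mult_add[OF ab(1,2)])
      finally show ?thesis using AB(3) by simp
    qed
    then have "a \<otimes>\<^bsub>R\<^esub> b \<in> Q" by (rule mem[OF Q.m_closed[OF ab(1,2)]])
    then have "a \<in> Q \<or> b \<in> Q" by (rule Q.I_prime[OF ab(1,2)])
    then show "A \<in> a_r_coset R J ` Q \<or> B \<in> a_r_coset R J ` Q" unfolding ab(3,4) by blast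
  qed
qed

lemma poly_ring_a_minus:
  assumes "p \<in> carrier (poly_ring V)" "q \<in> carrier (poly_ring V)"
  shows "p \<ominus>\<^bsub>poly_ring V\<^esub> q = p - q"
  using assms by (simp add: a_minus_def poly_ring_minus)

text \<open>
  The chain consists of the prime ideals generated by the variables outside of \<open>F\<close> together with more
  and more of the variables in \<open>F\<close>.
\<close>

lemma krull_dim_ge:
  fixes J :: "('v, 'k::field) mpoly set"
  assumes J: "ideal J (poly_ring V)" and F: "finite F" "F \<subseteq> V" and sub: "J \<subseteq> face_ideal (Pow F)"
  shows "ereal (real (card F)) \<le> krull_dim (poly_ring V Quot J)"
proof -
  let ?R = "poly_ring V :: ('v, 'k) mpoly ring"
  interpret R: cring ?R by (rule cring_poly_ring)
  interpret J: ideal J ?R by (rule J)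
  obtain xs where xs: "set xs = F" "distinct xs" using finite_distinct_list[OF F(1)] by blast
  have len: "length xs = card F" using xs distinct_card by fastforce
  define Q where "Q i = carrier ?R \<inter> face_ideal (Pow (set (drop i xs)))" for i
  have dropF: "set (drop i xs) \<subseteq> F" for i using xs set_drop_subset by fastforce
  have anti: "(face_ideal (Pow B) :: ('v, 'k) mpoly set) \<subseteq> face_ideal (Pow A)" if "A \<subseteq> B" for A B :: "'v set"
    using that by (auto simp: face_ideal_def)
  have JQ: "J \<subseteq> Q i" for i
    unfolding Q_def using sub anti[OF dropF] J.a_subset by blast
  have prime: "primeideal (Q i) ?R" for i
  proof (rule primeidealI)
    show "ideal (Q i) ?R" unfolding Q_def
      by (rule ideal_carrier_Int, rule is_ideal_face_ideal) auto
    show "cring ?R" by (rule cring_poly_ring)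
    have "1 \<notin> Q i" by (simp add: Q_def face_ideal_def)
    then show "carrier ?R \<noteq> Q i" using poly_ring_closed(2) by blast
    show "p \<in> Q i \<or> q \<in> Q i" if "p \<in> carrier ?R" "q \<in> carrier ?R" "p \<otimes>\<^bsub>?R\<^esub> q \<in> Q i" for p q
      using face_ideal_Pow_prime[of "set (drop i xs)" p q] that by (auto simp: Q_def)
  qed
  define P where "P i = a_r_coset ?R J ` Q i" for i
  have chain: "P i \<subset> P (Suc i)" if i: "i < length xs" for i
  proof -
    have "set (drop (Suc i) xs) \<subseteq> set (drop i xs)" by (simp add: set_drop_subset_set_drop)
    then have sub': "P i \<subseteq> P (Suc i)" unfolding P_def Q_def using anti by blast
    let ?x = "xs ! i" let ?v = "var ?x :: ('v, 'k) mpoly"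
    have x: "?x \<in> V" using xs F i nth_mem by blast
    then have vC: "?v \<in> carrier ?R" by (simp add: carrier_poly_ring var_def)
    have d: "drop i xs = ?x # drop (Suc i) xs" using i by (simp add: Cons_nth_drop_Suc)
    moreover have "?x \<notin> set (drop (Suc i) xs)"
      using xs(2) d distinct_drop[of xs i] by (metis distinct.simps(2))
    ultimately have v: "?v \<in> Q (Suc i)" and nv: "?v \<notin> Q i"
      using vC by (auto simp: Q_def face_ideal_def var_def)
    have "J +>\<^bsub>?R\<^esub> ?v \<notin> P i"
    proof
      assume "J +>\<^bsub>?R\<^esub> ?v \<in> P i"
      then obtain q where q: "q \<in> Q i" "J +>\<^bsub>?R\<^esub> ?v = J +>\<^bsub>?R\<^esub> q" by (auto simp: P_def)
      have qC: "q \<in> carrier ?R" using q(1) by (simp add: Q_def)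
      have "?v - q \<in> Q i"
        using q(2) ideal_rcoset_eq_iff[OF J vC qC] poly_ring_a_minus[OF vC qC] JQ by auto
      then have "(?v - q) + q \<in> Q i"
        using additive_subgroup.a_closed[OF ideal.axioms(1)[OF primeideal.axioms(1)[OF prime[of i]]], of "?v - q" q] q(1) by simp
      then show False using nv by simp
    qed
    moreover have "J +>\<^bsub>?R\<^esub> ?v \<in> P (Suc i)" using v by (auto simp: P_def)
    ultimately show ?thesis using sub' by blast
  qed
  have "primeideal (P i) (?R Quot J)" for i
    unfolding P_def by (rule primeideal_Quot[OF J prime JQ])
  then show ?thesis
    unfolding krull_dim_def using chain len by (intro Sup_upper) (auto intro!: exI[of _ "card F"] exI[of _ P])
qed

lemma krull_dim_le:
  fixes J :: "('v, 'k::field) mpoly set"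
  assumes J: "ideal J (poly_ring V)" and sub: "carrier (poly_ring V) \<inter> face_ideal \<Delta> \<subseteq> J"
    and \<Delta>: "finite \<Delta>" "\<And>\<sigma>. \<sigma> \<in> \<Delta> \<Longrightarrow> finite \<sigma> \<and> card \<sigma> \<le> D"
  shows "krull_dim (poly_ring V Quot J) \<le> ereal (real D)"
  unfolding krull_dim_def
proof (intro Sup_least, clarify)
  let ?R = "poly_ring V :: ('v, 'k) mpoly ring"
  interpret R: cring ?R by (rule cring_poly_ring)
  interpret J: ideal J ?R by (rule J)
  interpret h: ring_hom_ring ?R "?R Quot J" "a_r_coset ?R J" by (rule J.rcos_ring_hom_ring)
  fix n P assume P: "\<forall>i\<le>n. primeideal (P i) (?R Quot J)" "\<forall>i<n. P i \<subset> P (Suc i)"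
  define Q where "Q i = {r \<in> carrier ?R. J +>\<^bsub>?R\<^esub> r \<in> P i}" for i
  have prime: "primeideal (Q i) ?R" if "i \<le> n" for i
    unfolding Q_def by (rule h.primeideal_vimage[OF cring_poly_ring]) (use P(1) that in blast)
  have "\<exists>f. f \<in> Q (Suc i) - Q i" if i: "i < n" for i
  proof -
    obtain X where X: "X \<in> P (Suc i)" "X \<notin> P i" using P(2) i by blast
    interpret p: primeideal "P (Suc i)" "?R Quot J" using P(1) i by simp
    have "X \<in> carrier (?R Quot J)" using p.a_subset X by blast
    then obtain r where "r \<in> carrier ?R" "X = J +>\<^bsub>?R\<^esub> r" by (auto simp: FactRing_def A_RCOSETS_def')
    then show ?thesis using X by (auto simp: Q_def)
  qed
  then obtain f where f: "\<And>i. i < n \<Longrightarrow> f i \<in> Q (Suc i) - Q i" by metis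
  let ?fs = "map f [0..<n]"
  have fsC: "set ?fs \<subseteq> carrier ?R" using f by (auto simp: Q_def)
  have disj: "nested_relations (carrier ?R) ?fs \<inter> Q 0 = {}"
    by (rule nested_prime_chain[OF fsC]) (use prime f P(2) in \<open>auto simp: Q_def\<close>)
  show "ereal (real n) \<le> ereal (real D)"
  proof (rule ccontr)
    assume "\<not> ereal (real n) \<le> ereal (real D)"
    then have "D < n" by simp
    then have "finite \<sigma> \<and> card \<sigma> < length ?fs" if "\<sigma> \<in> \<Delta>" for \<sigma> using \<Delta>(2)[OF that] by auto
    from nested_face_ideal[OF \<Delta>(1) this fsC] obtain z where
      z: "z \<in> nested_relations (carrier ?R) ?fs" "z \<in> face_ideal \<Delta>" by blast
    then have "z \<in> J" "z \<in> carrier ?R" using sub nested_carrier[OF fsC] by auto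
    then have "J +>\<^bsub>?R\<^esub> z = J" by (simp add: J.a_rcos_const)
    moreover interpret p: primeideal "P 0" "?R Quot J" using P(1) by simp
    have "J \<in> P 0" using p.zero_closed by (simp add: FactRing_def)
    ultimately show False using disj z \<open>z \<in> carrier ?R\<close> by (auto simp: Q_def)
  qed
qed

section \<open>Regular sequences on quotients of ideals\<close>

lemma quotient_module_map:
  assumes M: "Module.module R M" and N: "submodule N R M"
  defines "\<pi> \<equiv> a_r_coset M N" and "Q \<equiv> quotient_module M N"
  shows "carrier Q = \<pi> ` carrier M" "\<zero>\<^bsub>Q\<^esub> = N"
    and "x \<in> carrier M \<Longrightarrow> \<pi> x = N \<longleftrightarrow> x \<in> N"
    and "x \<in> carrier M \<Longrightarrow> y \<in> carrier M \<Longrightarrow> \<pi> x \<oplus>\<^bsub>Q\<^esub> \<pi> y = \<pi> (x \<oplus>\<^bsub>M\<^esub> y)"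
    and "r \<in> carrier R \<Longrightarrow> x \<in> carrier M \<Longrightarrow> r \<odot>\<^bsub>Q\<^esub> \<pi> x = \<pi> (r \<odot>\<^bsub>M\<^esub> x)"
proof -
  interpret Module.module R M by fact
  interpret N: submodule N R M by fact
  have ab: "abelian_subgroup N M"
    by (intro abelian_subgroupI3 additive_subgroupI N.subgroup_axioms M.abelian_group_axioms)
  interpret N: abelian_subgroup N M by fact
  show "carrier Q = \<pi> ` carrier M"
    unfolding Q_def \<pi>_def quotient_module_def by (auto simp: A_RCOSETS_def')
  show "\<zero>\<^bsub>Q\<^esub> = N" by (simp add: Q_def quotient_module_def)
  show "\<pi> x = N \<longleftrightarrow> x \<in> N" if "x \<in> carrier M"
    using N.a_rcos_self[OF that] N.a_rcos_const[of x] unfolding \<pi>_def by auto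
  show "\<pi> x \<oplus>\<^bsub>Q\<^esub> \<pi> y = \<pi> (x \<oplus>\<^bsub>M\<^esub> y)" if "x \<in> carrier M" "y \<in> carrier M"
    unfolding Q_def \<pi>_def quotient_module_def using N.a_rcos_sum[OF that] by simp
  show "r \<odot>\<^bsub>Q\<^esub> \<pi> x = \<pi> (r \<odot>\<^bsub>M\<^esub> x)" if rx: "r \<in> carrier R" "x \<in> carrier M"
  proof -
    have "\<pi> (r \<odot>\<^bsub>M\<^esub> y) = \<pi> (r \<odot>\<^bsub>M\<^esub> x)" if y: "y \<in> \<pi> x" for y
    proof -
      obtain h where h: "h \<in> N" "y = h \<oplus>\<^bsub>M\<^esub> x" using y unfolding \<pi>_def a_r_coset_def' by blast
      have hc: "h \<in> carrier M" using h(1) by (rule N.a_Hcarr)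
      have "r \<odot>\<^bsub>M\<^esub> y = r \<odot>\<^bsub>M\<^esub> h \<oplus>\<^bsub>M\<^esub> r \<odot>\<^bsub>M\<^esub> x"
        using h(2) hc rx by (simp only: smult_r_distr)
      then have "r \<odot>\<^bsub>M\<^esub> y \<in> N +>\<^bsub>M\<^esub> (r \<odot>\<^bsub>M\<^esub> x)"
        using N.smult_closed[OF rx(1) h(1)] unfolding a_r_coset_def' by blast
      then show ?thesis
        unfolding \<pi>_def by (rule N.a_repr_independence'[symmetric]) (rule smult_closed[OF rx])
    qed
    moreover have "x \<in> \<pi> x" unfolding \<pi>_def using rx(2) by (rule N.a_rcos_self)
    ultimately have "(\<Union>y\<in>\<pi> x. \<pi> (r \<odot>\<^bsub>M\<^esub> y)) = \<pi> (r \<odot>\<^bsub>M\<^esub> x)" by blast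
    then show ?thesis by (simp add: Q_def \<pi>_def quotient_module_def)
  qed
qed

lemma regular_element_quotient_iff:
  assumes "Module.module R M" "submodule N R M"
  shows "regular_element R (quotient_module M N) f \<longleftrightarrow>
     f \<in> carrier R \<and> (\<forall>x\<in>carrier M. f \<odot>\<^bsub>M\<^esub> x \<in> N \<longrightarrow> x \<in> N)"
proof -
  interpret Module.module R M by fact
  note q = quotient_module_map[OF assms]
  show ?thesis
  proof (cases "f \<in> carrier R")
    case True
    then show ?thesis
      unfolding regular_element_def q(1,2)
      using q(3) q(5)[OF True] smult_closed[OF True] by auto
  qed (simp add: regular_element_def)
qed

lemma submodule_quotient_image:
  assumes M: "Module.module R M" and N: "submodule N R M" and K: "submodule K R M"
  shows "submodule (a_r_coset M N ` K) R (quotient_module M N)"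
proof -
  interpret M: Module.module R M by fact
  interpret Q: Module.module R "quotient_module M N" by (rule module_quotient_module[OF M N])
  note q = quotient_module_map[OF M N] and KE = M.submoduleE[OF K]
  have NM: "\<zero>\<^bsub>M\<^esub> \<in> N" "\<zero>\<^bsub>M\<^esub> \<in> K"
    using subgroup.one_closed[OF submodule.axioms(1)[OF N]]
      subgroup.one_closed[OF submodule.axioms(1)[OF K]] by simp_all
  have zero: "a_r_coset M N \<zero>\<^bsub>M\<^esub> = N" using q(3) NM by simp
  show ?thesis
  proof (rule Q.submoduleI)
    show "a_r_coset M N ` K \<subseteq> carrier (quotient_module M N)" using KE(1) q(1) by auto
    show "\<zero>\<^bsub>quotient_module M N\<^esub> \<in> a_r_coset M N ` K" using zero NM q(2) by blast
    show "\<ominus>\<^bsub>quotient_module M N\<^esub> a \<in> a_r_coset M N ` K" if a: "a \<in> a_r_coset M N ` K" for a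
    proof -
      obtain k where k: "k \<in> K" "a = a_r_coset M N k" using a by blast
      have kM: "k \<in> carrier M" "\<ominus>\<^bsub>M\<^esub> k \<in> carrier M" "\<ominus>\<^bsub>M\<^esub> k \<in> K"
        using KE(1) KE(3)[OF k(1)] k(1) by auto
      have "\<ominus>\<^bsub>quotient_module M N\<^esub> a = a_r_coset M N (\<ominus>\<^bsub>M\<^esub> k)"
        by (rule Q.minus_equality) (use q(1,2) q(4)[of "\<ominus>\<^bsub>M\<^esub> k" k] k kM zero in \<open>auto simp: M.M.l_neg\<close>)
      then show ?thesis using kM by blast
    qed
    show "a \<oplus>\<^bsub>quotient_module M N\<^esub> b \<in> a_r_coset M N ` K"
      if ab: "a \<in> a_r_coset M N ` K" "b \<in> a_r_coset M N ` K" for a b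
    proof -
      obtain k l where k: "k \<in> K" "a = a_r_coset M N k" "l \<in> K" "b = a_r_coset M N l" using ab by blast
      then show ?thesis using q(4)[of k l] KE(5)[of k l] KE(1) by auto
    qed
    show "r \<odot>\<^bsub>quotient_module M N\<^esub> a \<in> a_r_coset M N ` K"
      if ra: "r \<in> carrier R" "a \<in> a_r_coset M N ` K" for r a
    proof -
      obtain k where k: "k \<in> K" "a = a_r_coset M N k" using ra by blast
      then show ?thesis using q(5)[OF ra(1), of k] KE(4)[OF ra(1) k(1)] KE(1) by auto
    qed
  qed
qed

lemma submodule_quotient_preimage:
  assumes M: "Module.module R M" and N: "submodule N R M" and L: "submodule L R (quotient_module M N)"
  defines "K \<equiv> {x \<in> carrier M. a_r_coset M N x \<in> L}"
  shows "N \<subseteq> K" "\<And>x y. x \<in> K \<Longrightarrow> y \<in> K \<Longrightarrow> x \<oplus>\<^bsub>M\<^esub> y \<in> K"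
proof -
  interpret M: Module.module R M by fact
  interpret Q: Module.module R "quotient_module M N" by (rule module_quotient_module[OF M N])
  note q = quotient_module_map[OF M N] and LE = Q.submoduleE[OF L]
  have "N \<in> L" using subgroup.one_closed[OF submodule.axioms(1)[OF L]] q(2) by simp
  moreover have "x \<in> carrier M \<and> a_r_coset M N x = N" if "x \<in> N" for x
    using M.submoduleE(1)[OF N] q(3)[of x] that by blast
  ultimately show "N \<subseteq> K" by (simp add: K_def subset_iff)
  show "x \<oplus>\<^bsub>M\<^esub> y \<in> K" if "x \<in> K" "y \<in> K" for x y
    using that q(4)[of x y] LE(5)[of "a_r_coset M N x" "a_r_coset M N y"] by (auto simp: K_def)
qed

lemma foldl_adjoin_superset:
  assumes "0 \<in> I" shows "J \<subseteq> foldl (adjoin I) J fs"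
proof (induction fs arbitrary: J)
  case (Cons f fs)
  have "J \<subseteq> adjoin I J f" unfolding adjoin_def using assms by force
  then show ?case using Cons[of "adjoin I J f"] by auto
qed simp

lemma foldl_adjoin_generator:
  assumes "0 \<in> I" "0 \<in> J" "f \<in> set fs" "x \<in> I" shows "f * x \<in> foldl (adjoin I) J fs"
  using assms(2,3)
proof (induction fs arbitrary: J)
  case (Cons g fs)
  have *: "h * x \<in> adjoin I J h" "0 \<in> adjoin I J h" for h
    unfolding adjoin_def using assms(1,4) Cons.prems(1) by force+
  show ?case
  proof (cases "f = g")
    case True
    then show ?thesis using * foldl_adjoin_superset[OF assms(1), of "adjoin I J g" fs] by auto
  next
    case False
    then show ?thesis using Cons * by simp
  qed
qed simp

lemma foldl_adjoin_least:
  assumes "\<And>a b. a \<in> N \<Longrightarrow> b \<in> N \<Longrightarrow> a + b \<in> N" "\<And>f x. f \<in> set fs \<Longrightarrow> x \<in> I \<Longrightarrow> f * x \<in> N" "J \<subseteq> N"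
  shows "foldl (adjoin I) J fs \<subseteq> N"
  using assms(2,3)
proof (induction fs arbitrary: J)
  case (Cons g fs)
  have "adjoin I J g \<subseteq> N" unfolding adjoin_def using Cons.prems assms(1) by auto
  then show ?case using Cons by simp
qed simp

lemma ideal_foldl_adjoin:
  fixes I J :: "('v, 'k::field) mpoly set"
  assumes I: "ideal I (poly_ring V)" and J: "ideal J (poly_ring V)" and "J \<subseteq> I"
    and "set fs \<subseteq> carrier (poly_ring V)"
  shows "ideal (foldl (adjoin I) J fs) (poly_ring V) \<and> foldl (adjoin I) J fs \<subseteq> I"
  using J assms(3,4)
proof (induction fs arbitrary: J)
  case (Cons f fs)
  note ID = ideal_poly_ringD[OF I] and JD = ideal_poly_ringD[OF Cons.prems(1)]
  have f: "f \<in> carrier (poly_ring V)" using Cons.prems by simp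
  have sub: "adjoin I J f \<subseteq> I"
    unfolding adjoin_def using Cons.prems(2) f by (auto intro!: ID(3,5))
  have "ideal (adjoin I J f) (poly_ring V)"
  proof (rule ideal_poly_ringI)
    show "adjoin I J f \<subseteq> carrier (poly_ring V)" using sub ID(1) by blast
    show "0 \<in> adjoin I J f" unfolding adjoin_def using ID(2) JD(2) by force
    fix a b assume "a \<in> adjoin I J f" "b \<in> adjoin I J f"
    then obtain j x j' x' where "a = j + f * x" "b = j' + f * x'" "j \<in> J" "j' \<in> J" "x \<in> I" "x' \<in> I"
      by (auto simp: adjoin_def)
    then have "a + b = (j + j') + f * (x + x')" "j + j' \<in> J" "x + x' \<in> I"
      by (auto simp: algebra_simps intro: ID(3) JD(3))
    then show "a + b \<in> adjoin I J f" unfolding adjoin_def by blast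
  next
    fix r a :: "('v, 'k) mpoly" assume r: "r \<in> carrier (poly_ring V)" and "a \<in> adjoin I J f" 
    then obtain j x where "a = j + f * x" "j \<in> J" "x \<in> I" by (auto simp: adjoin_def)
    moreover from this have "r * a = r * j + f * (r * x)" by (simp add: algebra_simps)
    moreover have "r * j \<in> J" "r * x \<in> I"
      using calculation r by (auto intro: ID(5) JD(5))
    ultimately show "r * a \<in> adjoin I J f" unfolding adjoin_def by blast
  qed
  then show ?case using Cons.IH[of "adjoin I J f"] sub Cons.prems by simp
qed (use assms in simp)

lemma submodule_ideal_module:
  fixes I K :: "('v, 'k::field) mpoly set"
  assumes I: "ideal I (poly_ring V)" and K: "ideal K (poly_ring V)" "K \<subseteq> I"
  shows "submodule K (poly_ring V) (ideal_module (poly_ring V) I)"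
proof -
  note KD = ideal_poly_ringD[OF K(1)]
  interpret M: Module.module "poly_ring V" "ideal_module (poly_ring V) I"
    by (rule module_ideal_module[OF cring_poly_ring I])
  show ?thesis
  proof (rule M.submoduleI)
    fix a assume a: "a \<in> K"
    then have "- a \<in> K" by (rule KD(4))
    moreover have "\<ominus>\<^bsub>ideal_module (poly_ring V) I\<^esub> a = - a"
      by (rule M.minus_equality) (use a calculation K(2) in \<open>auto simp: ideal_module_def\<close>)
    ultimately show "\<ominus>\<^bsub>ideal_module (poly_ring V) I\<^esub> a \<in> K" by simp
  qed (use K(2) KD(2,3,5) in \<open>auto simp: ideal_module_def\<close>)
qed

text \<open>
  The submodule generated by the multiples is the image of \<open>J + (f\<^sub>1, \<dots>, f\<^sub>k) I\<close>: it is the least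
  submodule for which the preimage contains \<open>J\<close> and the products.
\<close>

lemma seq_smult_quotient:
  fixes I J :: "('v, 'k::field) mpoly set"
  assumes I: "ideal I (poly_ring V)" and J: "ideal J (poly_ring V)" "J \<subseteq> I"
    and fs: "set fs \<subseteq> carrier (poly_ring V)"
  defines "M \<equiv> ideal_module (poly_ring V) I"
  shows "seq_smult (poly_ring V) (quotient_module M J) fs = a_r_coset M J ` foldl (adjoin I) J fs"
proof -
  let ?R = "poly_ring V :: ('v, 'k) mpoly ring"
  have M: "Module.module ?R M" unfolding M_def by (rule module_ideal_module[OF cring_poly_ring I])
  interpret M: Module.module ?R M by (rule M)
  have Js: "submodule J ?R M" unfolding M_def by (rule submodule_ideal_module[OF I J])
  have Ks: "submodule (foldl (adjoin I) J fs) ?R M"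
    unfolding M_def using ideal_foldl_adjoin[OF I J fs] by (intro submodule_ideal_module[OF I]) auto
  have simps: "carrier M = I" "f \<odot>\<^bsub>M\<^esub> x = f * x" "x \<oplus>\<^bsub>M\<^esub> y = x + y" for f x y
    by (simp_all add: M_def ideal_module_def)
  note q = quotient_module_map[OF M Js]
  have zero: "0 \<in> I" "0 \<in> J" using ideal_poly_ringD(2) I J by blast+
  show ?thesis
  proof
    have "f \<odot>\<^bsub>quotient_module M J\<^esub> X \<in> a_r_coset M J ` foldl (adjoin I) J fs"
      if f: "f \<in> set fs" and X: "X \<in> carrier (quotient_module M J)" for f X
    proof -
      obtain x where x: "x \<in> I" "X = a_r_coset M J x" using X q(1) simps(1) by auto
      have "f \<in> carrier ?R" using f fs by blast
      then show ?thesis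
        using q(5)[of f x] x simps foldl_adjoin_generator[OF zero f x(1)] by auto
    qed
    then show "seq_smult ?R (quotient_module M J) fs \<subseteq> a_r_coset M J ` foldl (adjoin I) J fs"
      unfolding seq_smult_def using submodule_quotient_image[OF M Js Ks] by (intro Inter_lower) auto
  next
    show "a_r_coset M J ` foldl (adjoin I) J fs \<subseteq> seq_smult ?R (quotient_module M J) fs"
      unfolding seq_smult_def
    proof (intro Inter_greatest, clarify)
      fix L x assume L: "submodule L ?R (quotient_module M J)"
        and gen: "\<forall>f\<in>set fs. \<forall>x\<in>carrier (quotient_module M J). f \<odot>\<^bsub>quotient_module M J\<^esub> x \<in> L"
        and x: "x \<in> foldl (adjoin I) J fs"
      let ?K = "{x \<in> carrier M. a_r_coset M J x \<in> L}"
      note K = submodule_quotient_preimage[OF M Js L]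
      have "foldl (adjoin I) J fs \<subseteq> ?K"
      proof (rule foldl_adjoin_least)
        show "a + b \<in> ?K" if "a \<in> ?K" "b \<in> ?K" for a b using K(2)[OF that] by (simp add: simps)
        show "J \<subseteq> ?K" by (rule K(1))
        fix f x assume f: "f \<in> set fs" "x \<in> I"
        then have fR: "f \<in> carrier ?R" using fs by blast
        have "f \<odot>\<^bsub>quotient_module M J\<^esub> a_r_coset M J x \<in> L" using gen f q(1) simps(1) by auto
        then show "f * x \<in> ?K" using q(5)[OF fR, of x] M.smult_closed[OF fR, of x] f by (simp add: simps)
      qed
      then show "a_r_coset M J x \<in> L" using x by blast
    qed
  qed
qed

lemma regular_iff_nth:
  "regular I J fs \<longleftrightarrow>
     (\<forall>i<length fs. \<forall>a\<in>I. fs ! i * a \<in> foldl (adjoin I) J (take i fs) \<longrightarrow> a \<in> foldl (adjoin I) J (take i fs))"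
proof (induction fs arbitrary: J)
  case (Cons f fs)
  show ?case unfolding length_Cons All_less_Suc2 by (simp add: Cons)
qed simp

text \<open>
  This trades the cosets of cosets in the definition of a regular sequence for plain membership of
  polynomials in ideals.
\<close>

lemma regular_sequence_iff:
  fixes I J :: "('v, 'k::field) mpoly set"
  assumes I: "ideal I (poly_ring V)" and J: "ideal J (poly_ring V)" "J \<subseteq> I"
    and fs: "set fs \<subseteq> carrier (poly_ring V)"
  shows "regular_sequence (poly_ring V) (quotient_module (ideal_module (poly_ring V) I) J) fs \<longleftrightarrow>
     regular I J fs \<and> foldl (adjoin I) J fs \<noteq> I"
proof -
  let ?R = "poly_ring V :: ('v, 'k) mpoly ring"
  define M where "M = ideal_module ?R I"
  have M: "Module.module ?R M" unfolding M_def by (rule module_ideal_module[OF cring_poly_ring I])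
  interpret M: Module.module ?R M by (rule M)
  have Js: "submodule J ?R M" unfolding M_def by (rule submodule_ideal_module[OF I J])
  note ID = ideal_poly_ringD[OF I] and JD = ideal_poly_ringD[OF J(1)]
  have simps: "carrier M = I" "f \<odot>\<^bsub>M\<^esub> x = f * x" "x \<oplus>\<^bsub>M\<^esub> y = x + y" "\<zero>\<^bsub>M\<^esub> = 0" for f x y
    by (simp_all add: M_def ideal_module_def)
  let ?\<pi> = "a_r_coset M J"
  note q = quotient_module_map[OF M Js, unfolded simps]
  interpret Q: Module.module ?R "quotient_module M J" by (rule module_quotient_module[OF M Js])
  \<comment> \<open>Because K contains J, membership can be tested on any representative of the coset.\<close>
  have mem: "?\<pi> x \<in> ?\<pi> ` K \<longleftrightarrow> x \<in> K" if K: "ideal K ?R" "J \<subseteq> K" "K \<subseteq> I" and x: "x \<in> I" for K x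
  proof
    assume "?\<pi> x \<in> ?\<pi> ` K"
    then obtain k where k: "k \<in> K" "?\<pi> x = ?\<pi> k" by blast
    have kI: "k \<in> I" using k K by blast
    have neg: "- k \<in> I" by (rule ID(4)[OF kI])
    have "?\<pi> (x + - k) = ?\<pi> (k + - k)"
      using q(4)[OF x neg] q(4)[OF kI neg] k(2) by simp
    then have "x + - k \<in> J"
      using q(3)[of "x + - k"] q(3)[of 0] ID(3)[OF x neg] ID(2) JD(2) by simp
    then have "(x + - k) + k \<in> K"
      using ideal_poly_ringD(3)[OF K(1), of "x + - k" k] K(2) k(1) by blast
    then show "x \<in> K" by simp
  qed blast
  have fold: "ideal (foldl (adjoin I) J gs) ?R" "J \<subseteq> foldl (adjoin I) J gs" "foldl (adjoin I) J gs \<subseteq> I"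
    if "set gs \<subseteq> carrier ?R" for gs
    using ideal_foldl_adjoin[OF I J that] foldl_adjoin_superset[of I J gs] ID(2) by auto
  have reg: "regular_element ?R (quotient_module (quotient_module M J)
        (seq_smult ?R (quotient_module M J) (take i fs))) (fs ! i) \<longleftrightarrow>
      (\<forall>a\<in>I. fs ! i * a \<in> foldl (adjoin I) J (take i fs) \<longrightarrow> a \<in> foldl (adjoin I) J (take i fs))"
    if i: "i < length fs" for i
  proof -
    let ?K = "foldl (adjoin I) J (take i fs)"
    have t: "set (take i fs) \<subseteq> carrier ?R" using fs set_take_subset[of i fs] by blast
    have fi: "fs ! i \<in> carrier ?R" using fs i nth_mem by blast
    have sm: "seq_smult ?R (quotient_module M J) (take i fs) = ?\<pi> ` ?K"
      unfolding M_def by (rule seq_smult_quotient[OF I J t])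
    have "submodule ?K ?R M" unfolding M_def using fold[OF t] by (intro submodule_ideal_module[OF I])
    then have sub: "submodule (?\<pi> ` ?K) ?R (quotient_module M J)"
      by (rule submodule_quotient_image[OF M Js])
    have "fs ! i * a \<in> I" if "a \<in> I" for a by (rule ID(5)[OF fi that])
    then show ?thesis
      unfolding sm regular_element_quotient_iff[OF Q.module_axioms sub] q(1)
      using mem[OF fold[OF t]] q(5)[OF fi] fi by auto
  qed
  have "seq_smult ?R (quotient_module M J) fs = ?\<pi> ` foldl (adjoin I) J fs"
    unfolding M_def by (rule seq_smult_quotient[OF I J fs])
  then have "seq_smult ?R (quotient_module M J) fs \<noteq> carrier (quotient_module M J) \<longleftrightarrow>
      foldl (adjoin I) J fs \<noteq> I"
    using q(1) mem[OF fold[OF fs]] fold(3)[OF fs] by auto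
  then show ?thesis
    unfolding M_def[symmetric] regular_sequence_def regular_iff_nth using reg by auto
qed

section \<open>Depth of Stanley--Reisner modules\<close>

text \<open>
  The inclusion induces an isomorphism \<open>I' / (I' \<inter> J) = I / J\<close> when \<open>I = I' + J\<close>, and the submodules
  generated by multiples of \<open>f\<close> correspond to each other.  It is used to change the ground set, with
  \<open>I'\<close> the part of \<open>I\<close> in finitely many variables.
\<close>

lemma adjoin_Int:
  assumes I': "I' \<subseteq> I" "\<And>x y. x \<in> I' \<Longrightarrow> y \<in> I' \<Longrightarrow> x + y \<in> I'" "\<And>x. x \<in> I' \<Longrightarrow> - x \<in> I'"
      "\<And>x. x \<in> I' \<Longrightarrow> f * x \<in> I'"
    and J: "is_ideal J" "J \<subseteq> I"
    and dec: "\<And>a. a \<in> I \<Longrightarrow> \<exists>a'\<in>I'. a - a' \<in> J"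
  shows "adjoin I' (I' \<inter> J) f = I' \<inter> adjoin I J f"
proof
  show "adjoin I' (I' \<inter> J) f \<subseteq> I' \<inter> adjoin I J f"
    unfolding adjoin_def using I' by blast
  show "I' \<inter> adjoin I J f \<subseteq> adjoin I' (I' \<inter> J) f"
  proof
    fix q assume q: "q \<in> I' \<inter> adjoin I J f"
    then obtain j a where ja: "q = j + f * a" "j \<in> J" "a \<in> I" by (auto simp: adjoin_def)
    obtain a' where a': "a' \<in> I'" "a - a' \<in> J" using dec[OF ja(3)] by blast
    have "q - f * a' = j + f * (a - a')" using ja(1) by (simp add: algebra_simps)
    then have "q - f * a' \<in> J" using ja(2) a'(2) is_ideal_closed[OF J(1)] by simp
    moreover have "q - f * a' \<in> I'" using I'(2)[OF _ I'(3)[OF I'(4)[OF a'(1)]], of q] q by simp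
    moreover have "q = (q - f * a') + f * a'" by simp
    ultimately show "q \<in> adjoin I' (I' \<inter> J) f" unfolding adjoin_def using a'(1) by blast
  qed
qed

lemma regular_Int:
  assumes I': "I' \<subseteq> I" "\<And>x y. x \<in> I' \<Longrightarrow> y \<in> I' \<Longrightarrow> x + y \<in> I'" "\<And>x. x \<in> I' \<Longrightarrow> - x \<in> I'"
      "\<And>f x. f \<in> set fs \<Longrightarrow> x \<in> I' \<Longrightarrow> f * x \<in> I'"
    and I: "is_ideal I" and J: "is_ideal J" "J \<subseteq> I"
    and dec: "\<And>a. a \<in> I \<Longrightarrow> \<exists>a'\<in>I'. a - a' \<in> J"
  shows "regular I' (I' \<inter> J) fs \<longleftrightarrow> regular I J fs"
  using I'(4) J dec
proof (induction fs arbitrary: J)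
  case (Cons f fs)
  have e: "adjoin I' (I' \<inter> J) f = I' \<inter> adjoin I J f"
    by (rule adjoin_Int) (use I' Cons.prems in auto)
  have IH: "regular I' (I' \<inter> adjoin I J f) fs \<longleftrightarrow> regular I (adjoin I J f) fs"
  proof (rule Cons.IH)
    show "is_ideal (adjoin I J f)" by (rule is_ideal_adjoin[OF I Cons.prems(2)])
    show "adjoin I J f \<subseteq> I" unfolding adjoin_def using Cons.prems(3) is_ideal_closed[OF I] by auto
    show "\<exists>a'\<in>I'. a - a' \<in> adjoin I J f" if "a \<in> I" for a
      using Cons.prems(4)[OF that] adjoin_mono[OF I, of J f] by blast
  qed (use Cons.prems(1) in auto)
  have "(\<forall>a\<in>I'. f * a \<in> I' \<inter> J \<longrightarrow> a \<in> I' \<inter> J) \<longleftrightarrow> (\<forall>a\<in>I. f * a \<in> J \<longrightarrow> a \<in> J)"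
  proof
    assume *: "\<forall>a\<in>I'. f * a \<in> I' \<inter> J \<longrightarrow> a \<in> I' \<inter> J"
    show "\<forall>a\<in>I. f * a \<in> J \<longrightarrow> a \<in> J"
    proof (intro ballI impI)
      fix a assume a: "a \<in> I" "f * a \<in> J"
      obtain a' where a': "a' \<in> I'" "a - a' \<in> J" using Cons.prems(4)[OF a(1)] by blast
      have "f * a - f * (a - a') \<in> J"
        by (intro is_ideal_diff[OF Cons.prems(2)] is_ideal_mult[OF Cons.prems(2)] a a')
      then have "f * a' \<in> J" by (simp add: algebra_simps)
      then have "a' \<in> J" using * a'(1) Cons.prems(1)[of f a'] by auto
      from is_ideal_add[OF Cons.prems(2) this a'(2)] show "a \<in> J" by simp
    qed
  qed (use I'(1) in auto)
  then show ?case by (simp add: e IH)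
qed simp

text \<open>
  Peeling off the factors of a relation that annihilates \<open>I/J\<close> along a regular sequence leaves
  a nonzero constant that annihilates \<open>I/(J + (f\<^sub>1, \<dots>, f\<^sub>r) I)\<close>.
\<close>

lemma nested_regular:
  fixes I J :: "('v, 'k::field) mpoly set"
  assumes I: "ideal I (poly_ring V)" and J: "ideal J (poly_ring V)" "J \<subseteq> I"
    and fs: "set fs \<subseteq> carrier (poly_ring V)" and reg: "regular I J fs"
    and z: "z \<in> nested_relations (carrier (poly_ring V)) fs" "\<And>a. a \<in> I \<Longrightarrow> z * a \<in> J"
  shows "I \<subseteq> foldl (adjoin I) J fs"
  using J fs reg z
proof (induction fs arbitrary: J z)
  case Nil
  then obtain c where c: "z = single 0 c" "c \<noteq> 0" by auto
  have "a \<in> J" if "a \<in> I" for a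
  proof -
    have "single 0 (inverse c) * (z * a) \<in> J"
      by (rule ideal_poly_ringD(5)[OF Nil.prems(1)]) (use Nil that in \<open>auto simp: poly_ring_closed\<close>)
    moreover have "single 0 (inverse c) * (z * a) = a"
      using c by (simp add: mult_single flip: mult.assoc)
    ultimately show ?thesis by simp
  qed
  then show ?case by auto
next
  case (Cons f fs)
  note ID = ideal_poly_ringD[OF I] and JD = ideal_poly_ringD[OF Cons.prems(1)]
  obtain n z' g where z': "z = f ^ n * (z' + f * g)" "z' \<in> nested_relations (carrier (poly_ring V)) fs"
    "g \<in> carrier (poly_ring V)" using Cons.prems(5) by auto
  have f: "f \<in> carrier (poly_ring V)" using Cons.prems by simp
  have z'C: "z' \<in> carrier (poly_ring V)" using nested_carrier[of fs V] z'(2) Cons.prems(3) by auto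
  have "z' * a \<in> adjoin I J f" if a: "a \<in> I" for a
  proof -
    let ?b = "(z' + f * g) * a"
    have b: "?b \<in> I" using ID(5)[OF _ a] poly_ring_closed(3,4) z'C f z'(3) by blast
    have "f ^ n * ?b \<in> J \<Longrightarrow> ?b \<in> J"
    proof (induction n)
      case (Suc n)
      have "f ^ n * ?b \<in> I" by (intro ID(5) b poly_ring_closed f)
      then have "f ^ n * ?b \<in> J" using Suc.prems Cons.prems(4) by (simp add: mult.assoc)
      then show ?case by (rule Suc.IH)
    qed simp
    then have "?b \<in> J" using Cons.prems(6)[OF a] z'(1) by (simp add: mult.assoc)
    moreover have "- (g * a) \<in> I" by (intro ID(4,5) a z')
    moreover have "z' * a = ?b + f * (- (g * a))" by (simp add: algebra_simps)
    ultimately show ?thesis unfolding adjoin_def by blast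
  qed
  moreover have "ideal (adjoin I J f) (poly_ring V) \<and> adjoin I J f \<subseteq> I"
    using ideal_foldl_adjoin[OF I Cons.prems(1,2), of "[f]"] f by simp
  ultimately have "I \<subseteq> foldl (adjoin I) (adjoin I J f) fs"
    using Cons.IH[of "adjoin I J f" z'] Cons.prems z'(2) by auto
  then show ?case by simp
qed

text \<open>
  Depth is at most dimension, for modules over a Stanley--Reisner ring.
\<close>

lemma regular_length_bound:
  fixes I J :: "('v, 'k::field) mpoly set"
  assumes I: "ideal I (poly_ring V)" and J: "ideal J (poly_ring V)" "J \<subseteq> I"
    and fs: "set fs \<subseteq> carrier (poly_ring V)" and reg: "regular I J fs" "foldl (adjoin I) J fs \<noteq> I"
    and X: "finite X" "\<And>\<sigma>. \<sigma> \<in> X \<Longrightarrow> finite \<sigma> \<and> card \<sigma> \<le> D"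
    and ann: "\<And>z a. z \<in> carrier (poly_ring V) \<inter> face_ideal X \<Longrightarrow> a \<in> I \<Longrightarrow> z * a \<in> J"
  shows "length fs \<le> D"
proof (rule ccontr)
  assume len: "\<not> length fs \<le> D"
  have "finite \<sigma> \<and> card \<sigma> < length fs" if "\<sigma> \<in> X" for \<sigma> using X(2)[OF that] len by auto
  from nested_face_ideal[OF X(1) this fs] obtain z where
    z: "z \<in> nested_relations (carrier (poly_ring V)) fs" "z \<in> face_ideal X" by blast
  then have "z \<in> carrier (poly_ring V)" using nested_carrier[OF fs] by blast
  then have "I \<subseteq> foldl (adjoin I) J fs"
    using z ann by (intro nested_regular[OF I J fs reg(1)]) auto
  then show False using ideal_foldl_adjoin[OF I J fs] reg(2) by blast
qed

lemma irrelevant_ideal_ideal: "ideal (irrelevant_ideal V :: ('v, 'k::field) mpoly set) (poly_ring V)"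
proof -
  interpret R: cring "poly_ring V :: ('v, 'k) mpoly ring" by (rule cring_poly_ring)
  show ?thesis unfolding irrelevant_ideal_def
    by (rule R.genideal_ideal) (auto simp: carrier_poly_ring var_def)
qed

lemma var_irrelevant: "v \<in> V \<Longrightarrow> (var v :: ('v, 'k::field) mpoly) \<in> irrelevant_ideal V"
proof -
  interpret R: cring "poly_ring V :: ('v, 'k) mpoly ring" by (rule cring_poly_ring)
  assume v: "v \<in> V"
  have "var ` V \<subseteq> carrier (poly_ring V :: ('v, 'k) mpoly ring)" by (auto simp: carrier_poly_ring var_def)
  from R.genideal_self[OF this] show "(var v :: ('v, 'k) mpoly) \<in> irrelevant_ideal V"
    unfolding irrelevant_ideal_def using v by blast
qed

text \<open>
  The polynomials without constant term form the ideal of the complex \<open>{{}}\<close>.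
\<close>

lemma irrelevant_constant_term:
  fixes p :: "('v, 'k::field) mpoly"
  assumes "p \<in> irrelevant_ideal V" shows "lookup p 0 = 0"
proof -
  interpret R: cring "poly_ring V :: ('v, 'k) mpoly ring" by (rule cring_poly_ring)
  have nz: "single x (Suc 0) \<noteq> (0 :: 'v \<Rightarrow>\<^sub>0 nat)" for x
    using lookup_single_eq[of x "Suc 0"] by (metis lookup_zero nat.distinct(1))
  have "is_ideal (face_ideal {{}} :: ('v, 'k) mpoly set)" by (rule is_ideal_face_ideal) auto
  then have "irrelevant_ideal V \<subseteq> carrier (poly_ring V) \<inter> (face_ideal {{}} :: ('v, 'k) mpoly set)"
    unfolding irrelevant_ideal_def
    by (intro R.genideal_minimal ideal_carrier_Int) (auto simp: carrier_poly_ring var_def face_ideal_def nz)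
  then have "0 \<notin> keys p" using assms by (auto simp: face_ideal_def)
  then show ?thesis by (simp add: in_keys_iff)
qed

lemma esym_irrelevant:
  assumes "finite U" "i > 0"
  shows "(esym U i :: ('v, 'k::field) mpoly) \<in> irrelevant_ideal U"
proof -
  note ID = ideal_poly_ringD[OF irrelevant_ideal_ideal[where ?'k = 'k and V = U]]
  have "(\<Prod>v\<in>\<sigma>. var v) \<in> (irrelevant_ideal U :: ('v, 'k) mpoly set)" if s: "\<sigma> \<subseteq> U" "card \<sigma> = i" for \<sigma>
  proof -
    have fin: "finite \<sigma>" using s assms(1) finite_subset by blast
    obtain v where v: "v \<in> \<sigma>" using s assms(2) by fastforce
    have "(\<Prod>v\<in>\<sigma> - {v}. var v) \<in> carrier (poly_ring U :: ('v, 'k) mpoly ring)"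
      using fin s by (auto simp: prod_var keys_squarefree_monomial intro!: poly_ring_closed)
    from ID(5)[OF this var_irrelevant[of v U]] show ?thesis
      using v s fin by (simp add: prod.remove mult.commute subset_iff)
  qed
  then have "(\<Sum>\<sigma>\<in>A. \<Prod>v\<in>\<sigma>. var v) \<in> (irrelevant_ideal U :: ('v, 'k) mpoly set)"
    if "finite A" "A \<subseteq> {\<sigma>. \<sigma> \<subseteq> U \<and> card \<sigma> = i}" for A
    using that(2) by (induction rule: finite_induct[OF that(1)]) (auto intro!: ID(2,3))
  then show ?thesis unfolding esym_def using assms(1) by simp
qed

lemma face_ideal_anti: "\<Delta> \<subseteq> \<Gamma> \<Longrightarrow> face_ideal \<Gamma> \<subseteq> face_ideal \<Delta>"
  by (auto simp: face_ideal_def)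

text \<open>
  Discarding the monomials that are not supported on \<open>V\<close> changes a polynomial only by an element of
  the ideal of \<open>X\<close>.
\<close>

lemma face_decomposition:
  fixes p :: "('v, 'k::field) mpoly"
  assumes "X \<subseteq> Pow V"
  shows "\<exists>p'\<in>carrier (poly_ring V). keys p' \<subseteq> keys p \<and> p - p' \<in> face_ideal X"
proof -
  define p' where "p' = Poly_Mapping.mapp (\<lambda>m c. c when keys m \<subseteq> V) p"
  have "lookup p' m = (if keys m \<subseteq> V then lookup p m else 0)" for m
    by (auto simp: p'_def Poly_Mapping.lookup_mapp when_def in_keys_iff)
  then have keys_p': "keys p' = {m \<in> keys p. keys m \<subseteq> V}"
    and "keys (p - p') \<subseteq> {m. \<not> keys m \<subseteq> V}"
    by (auto simp: in_keys_iff[of _ p'] in_keys_iff[of _ p] in_keys_iff[of _ "p - p'"] lookup_minus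
        split: if_splits)
  then show ?thesis
    using assms by (intro bexI[of _ p']) (auto simp: carrier_poly_ring face_ideal_def)
qed

lemma complex_dim_eq:
  assumes "F \<in> X" "\<And>\<sigma>. \<sigma> \<in> X \<Longrightarrow> card \<sigma> \<le> card F"
  shows "complex_dim X = ereal (real (card F) - 1)"
  unfolding complex_dim_def
  by (rule antisym) (auto intro!: SUP_least SUP_upper2[OF assms(1)] assms(2))

lemma depth_ge_imp_regular_sequence:
  assumes "ereal (real n) \<le> depth R \<mm> M"
  shows "\<exists>fs. set fs \<subseteq> \<mm> \<and> regular_sequence R M fs \<and> n \<le> length fs"
proof (rule ccontr)
  assume "\<not> ?thesis"
  then have short: "length fs < n" if "set fs \<subseteq> \<mm>" "regular_sequence R M fs" for fs
    using that by (meson not_le)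
  have "depth R \<mm> M \<le> ereal (real n - 1)"
    unfolding depth_def by (intro Sup_least) (use short in force)
  with assms have "ereal (real n) \<le> ereal (real n - 1)" by (rule order_trans)
  then show False by simp
qed

lemma esym_face_ideal:
  assumes "finite U" "\<And>\<sigma>. \<sigma> \<in> \<Gamma> \<Longrightarrow> card \<sigma> < i"
  shows "esym U i \<in> face_ideal \<Gamma>"
  unfolding face_ideal_def
proof (intro CollectI ballI notI)
  fix m assume m: "m \<in> keys (esym U i :: ('a, 'b) mpoly)" "keys m \<in> \<Gamma>"
  obtain \<sigma> where "\<sigma> \<subseteq> U" "card \<sigma> = i" "m = squarefree_monomial \<sigma>" using keys_esym[OF assms(1) m(1)] by blast
  then show False using assms m(2) by (auto simp: keys_squarefree_monomial finite_subset)
qed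

text \<open>
  The sequence of parameters belongs to the large complex \<open>\<Gamma>\<close>.  It serves for the subcomplex \<open>X\<close> as
  well, because \<open>I\<^sub>\<Gamma>\<close> is contained in \<open>I\<^sub>X\<close> and hence annihilates the module.
\<close>

lemma regular_sequence_imp_exact:
  fixes X \<Gamma> :: "'v set set"
  assumes X: "simplicial_complex V X" "X \<subseteq> \<Gamma>" and U: "finite U" "\<Gamma> \<subseteq> Pow U"
    and D: "\<And>\<sigma>. \<sigma> \<in> \<Gamma> \<Longrightarrow> card \<sigma> \<le> D"
    and fs: "set fs \<subseteq> irrelevant_ideal V"
    and reg: "regular_sequence (poly_ring V) (SR_module TYPE('k::field) V X) fs"
    and i: "i < length fs"
  shows "exact_at UNIV (face_ideal X :: ('v, 'k) mpoly set) (rev (map (esym U) [1..<Suc D])) i"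
proof -
  let ?R = "poly_ring V :: ('v, 'k) mpoly ring" and ?J = "face_ideal X :: ('v, 'k) mpoly set"
  let ?ys = "rev (map (esym U) [1..<Suc D]) :: ('v, 'k) mpoly list"
  interpret R: cring ?R by (rule cring_poly_ring)
  have fsC: "set fs \<subseteq> carrier ?R" using fs ideal_poly_ringD(1)[OF irrelevant_ideal_ideal] by blast
  have J: "is_ideal ?J" by (rule is_ideal_face_ideal) (use X in \<open>auto simp: simplicial_complex_def\<close>)
  have XV: "X \<subseteq> Pow V" using X by (simp add: simplicial_complex_def)
  have sub: "SR_ideal V X \<subseteq> carrier ?R" using ideal_poly_ringD(1)[OF ideal_SR_ideal] .
  have "regular (carrier ?R) (SR_ideal V X) fs"
    using reg regular_sequence_iff[OF R.oneideal ideal_SR_ideal sub fsC] by (simp add: SR_module_def)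
  then have "regular UNIV ?J fs"
    unfolding SR_ideal_eq[OF X(1)]
  proof (subst (asm) regular_Int[where I = UNIV])
    show "\<exists>a'\<in>carrier ?R. a - a' \<in> ?J" for a using face_decomposition[OF XV, of a] by blast
  qed (use fsC in \<open>auto simp: J is_ideal_UNIV poly_ring_closed\<close>)
  then show ?thesis
  proof (rule regular_imp_exact[OF is_ideal_UNIV J _ _ i])
    fix f and J' :: "('v, 'k) mpoly set" assume f: "f \<in> set fs" and J': "is_ideal J'" "?J \<subseteq> J'"
    define Z where "Z = {z. kills UNIV J' ?ys z}"
    have Z: "is_ideal Z" unfolding Z_def by (rule is_ideal_kills[OF is_ideal_UNIV J'(1)])
    have face: "z \<in> Z" if "z \<in> face_ideal \<Gamma>" for z
    proof -
      have "z \<in> J'" using that face_ideal_anti[OF X(2)] J'(2) by blast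
      then have "z * a \<in> J'" for a using is_ideal_mult[OF J'(1), of z a] by (simp add: mult.commute)
      then have "kills UNIV J' ?ys z" by (intro kills_ann is_ideal_UNIV)
      then show ?thesis by (simp add: Z_def)
    qed
    have "var v \<in> radical Z" for v
    proof (cases "v \<in> U")
      case True
      have "esym U j \<in> Z" if "1 \<le> j" for j
      proof (cases "j \<le> D")
        case True
        then have "j \<in> set [1..<Suc D]" using that by auto
        then have "esym U j \<in> set ?ys" unfolding set_rev set_map by (rule imageI)
        then show ?thesis unfolding Z_def using kills_entry[OF is_ideal_UNIV J'(1)] by blast
      next
        case False
        have "card \<sigma> < j" if "\<sigma> \<in> \<Gamma>" for \<sigma> using D[OF that] False by simp
        then show ?thesis by (intro face esym_face_ideal U(1))
      qed
      then have "var v ^ card U \<in> Z" by (intro var_power_esym[OF Z U(1) True])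
      then show ?thesis unfolding radical_def by blast
    next
      case False
      then have "var v \<in> Z" using U(2) by (intro face) (auto simp: face_ideal_def var_def)
      then show ?thesis unfolding radical_def by (auto intro!: exI[of _ 1])
    qed
    then have "f \<in> radical Z" using irrelevant_subset_radical[OF Z, of V] f fs by blast
    then show "\<exists>N. kills UNIV J' ?ys (f ^ N)" by (simp add: radical_def Z_def)
  qed
qed

lemma lookup_mult_single:
  fixes r :: "('v, 'k::field) mpoly"
  shows "lookup (r * single b 1) (m + b) = lookup r m"
proof (cases "m \<in> keys r")
  case True
  have "lookup (r * single b 1) (m + b) = lookup r m * lookup (single b 1) b"
    by (rule lookup_mult_unique) (use True in auto)
  then show ?thesis by simp
next
  case False
  have "m + b \<notin> keys (r * single b 1)"
  proof
    assume "m + b \<in> keys (r * single b 1)"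
    then obtain k where "m + b = k + b" "k \<in> keys r"
      using keys_mult[of r "single b (1 :: 'k)"] by (auto split: if_splits)
    then show False using False by simp
  qed
  then show ?thesis using False by (simp add: in_keys_iff)
qed

text \<open>
  A nonzero module differs from its product with the irrelevant ideal.  The witness is \<open>x\<^sub>\<sigma>\<close> for a
  face \<open>\<sigma>\<close> of \<open>\<Gamma> - \<Delta>\<close> of least size: each proper divisor of \<open>x\<^sub>\<sigma>\<close> that is not in \<open>I\<^sub>\<Gamma>\<close> lies
  outside of \<open>I\<^sub>\<Delta>\<close> as well.
\<close>

lemma adjoin_irrelevant_proper:
  fixes fs :: "('v, 'k::field) mpoly list"
  assumes \<Gamma>: "simplicial_complex V \<Gamma>" and sub: "\<Delta> \<subset> \<Gamma>"
    and fs: "set fs \<subseteq> irrelevant_ideal V"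
  shows "foldl (adjoin (carrier (poly_ring V) \<inter> face_ideal \<Delta>)) (carrier (poly_ring V) \<inter> face_ideal \<Gamma>) fs
     \<noteq> carrier (poly_ring V) \<inter> face_ideal \<Delta>"
proof -
  let ?I = "carrier (poly_ring V) \<inter> face_ideal \<Delta> :: ('v, 'k) mpoly set"
  have fin: "finite \<sigma>" "\<sigma> \<subseteq> V" if "\<sigma> \<in> \<Gamma>" for \<sigma>
    using \<Gamma> that finite_subset by (auto simp: simplicial_complex_def)
  obtain \<sigma> where \<sigma>: "\<sigma> \<in> \<Gamma> - \<Delta>" "\<And>\<tau>. card \<tau> < card \<sigma> \<Longrightarrow> \<tau> \<notin> \<Gamma> - \<Delta>"
  proof -
    obtain \<sigma>0 where "\<sigma>0 \<in> \<Gamma> - \<Delta>" using sub by blast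
    then show thesis
      using that arg_min_nat_lemma[of "\<lambda>\<sigma>. \<sigma> \<in> \<Gamma> - \<Delta>" \<sigma>0 card] by (metis not_le)
  qed
  define s where "s = squarefree_monomial \<sigma>"
  have fs\<sigma>: "finite \<sigma>" "\<sigma> \<subseteq> V" using fin \<sigma> by auto
  have ks: "keys s = \<sigma>" using fs\<sigma> by (simp add: s_def keys_squarefree_monomial)
  let ?N = "{p :: ('v, 'k) mpoly. lookup p s = 0}"
  have "foldl (adjoin ?I) (carrier (poly_ring V) \<inter> face_ideal \<Gamma>) fs \<subseteq> ?N"
  proof (rule foldl_adjoin_least)
    show "carrier (poly_ring V) \<inter> face_ideal \<Gamma> \<subseteq> ?N"
      using \<sigma>(1) ks by (auto simp: face_ideal_def in_keys_iff[of s])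
    show "a + b \<in> ?N" if "a \<in> ?N" "b \<in> ?N" for a b using that by (simp add: lookup_add)
    fix f x assume f: "f \<in> set fs" and x: "x \<in> ?I"
    have "s \<notin> keys (f * x)"
    proof
      assume "s \<in> keys (f * x)"
      then obtain k l where kl: "s = k + l" "k \<in> keys f" "l \<in> keys x" using keys_mult[of f x] by blast
      have "lookup f 0 = 0" using irrelevant_constant_term f fs by blast
      then have "k \<noteq> 0" using kl(2) by (auto simp: in_keys_iff)
      have "keys l \<subseteq> \<sigma>" using ks kl(1) keys_add_nat[of k l] by auto
      moreover have "keys l \<noteq> \<sigma>"
      proof
        assume l: "keys l = \<sigma>"
        have "lookup k v = 0" for v
        proof (cases "v \<in> \<sigma>")
          case True
          then have "lookup l v \<ge> 1" using l by (auto simp: in_keys_iff Suc_le_eq)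
          moreover have "lookup k v + lookup l v = 1"
            using kl(1) True fs\<sigma> by (metis lookup_add lookup_squarefree_monomial s_def)
          ultimately show ?thesis by simp
        next
          case False
          then have "lookup k v + lookup l v = 0"
            using kl(1) fs\<sigma> by (metis lookup_add lookup_squarefree_monomial s_def)
          then show ?thesis by simp
        qed
        then have "k = 0" by (intro poly_mapping_eqI) simp
        then show False using \<open>k \<noteq> 0\<close> by simp
      qed
      ultimately have l\<sigma>: "keys l \<subset> \<sigma>" by blast
      then have "keys l \<notin> \<Gamma> - \<Delta>" using \<sigma>(2) fs\<sigma>(1) psubset_card_mono by blast
      moreover have "keys l \<in> \<Gamma>" using l\<sigma> \<sigma>(1) \<Gamma> by (auto simp: simplicial_complex_def)
      ultimately show False using x kl(3) by (auto simp: face_ideal_def)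
    qed
    then show "f * x \<in> ?N" by (simp add: in_keys_iff)
  qed
  moreover have "single s 1 \<in> ?I" using \<sigma>(1) ks fs\<sigma> by (auto simp: carrier_poly_ring face_ideal_def)
  ultimately show ?thesis by force
qed

lemma annihilator_relative:
  fixes I J :: "('v, 'k::field) mpoly set"
  assumes I: "ideal I (poly_ring V)" and J: "ideal J (poly_ring V)" "J \<subseteq> I"
  shows "annihilator (poly_ring V) (quotient_module (ideal_module (poly_ring V) I) J) =
     {r \<in> carrier (poly_ring V). \<forall>a\<in>I. r * a \<in> J}"
proof -
  note q = quotient_module_map[OF module_ideal_module[OF cring_poly_ring I] submodule_ideal_module[OF I J]]
  have simps: "carrier (ideal_module (poly_ring V) I) = I" "r \<odot>\<^bsub>ideal_module (poly_ring V) I\<^esub> x = r * x" for r x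
    by (simp_all add: ideal_module_def)
  have "r \<odot>\<^bsub>quotient_module (ideal_module (poly_ring V) I) J\<^esub> a_r_coset (ideal_module (poly_ring V) I) J a = J
      \<longleftrightarrow> r * a \<in> J" if "r \<in> carrier (poly_ring V)" "a \<in> I" for r a
    using q(3)[of "r * a"] q(5)[of r a] that ideal_poly_ringD(5)[OF I that] by (simp add: simps)
  then show ?thesis
    unfolding annihilator_def q(1,2) simps by blast
qed

lemma ideal_colon:
  fixes I J :: "('v, 'k::field) mpoly set"
  assumes I: "ideal I (poly_ring V)" and J: "ideal J (poly_ring V)"
  shows "ideal {r \<in> carrier (poly_ring V). \<forall>a\<in>I. r * a \<in> J} (poly_ring V)"
proof (rule ideal_poly_ringI)
  note JD = ideal_poly_ringD[OF J]
  show "0 \<in> {r \<in> carrier (poly_ring V). \<forall>a\<in>I. r * a \<in> J}" using JD(2) by (simp add: poly_ring_closed)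
  show "r + s \<in> {r \<in> carrier (poly_ring V). \<forall>a\<in>I. r * a \<in> J}"
    if "r \<in> {r \<in> carrier (poly_ring V). \<forall>a\<in>I. r * a \<in> J}"
      "s \<in> {r \<in> carrier (poly_ring V). \<forall>a\<in>I. r * a \<in> J}" for r s
    using that JD(3) by (auto simp: poly_ring_closed distrib_right)
  show "r * s \<in> {r \<in> carrier (poly_ring V). \<forall>a\<in>I. r * a \<in> J}"
    if "r \<in> carrier (poly_ring V)" "s \<in> {r \<in> carrier (poly_ring V). \<forall>a\<in>I. r * a \<in> J}" for r s
    using that JD(5) by (auto simp: poly_ring_closed mult.assoc)
qed auto

theorem mainTheorem6:
  fixes V W :: "'v set" and \<Delta> \<Gamma> :: "'v set set"
  assumes "simplicial_complex V \<Delta>"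
    and "SR_depth TYPE('k::field) V \<Delta> \<ge> krull_dim (SR_ring TYPE('k) V \<Delta>) - 1"
    and "simplicial_complex W \<Gamma>"
    and "cohen_macaulay_complex TYPE('k) W \<Gamma>"
    and "complex_dim \<Gamma> = complex_dim \<Delta>"
    and "\<Delta> \<subseteq> \<Gamma>"
  shows "relative_cohen_macaulay TYPE('k) \<Gamma> \<Delta>"
proof -
  define U where "U = \<Union>\<Gamma>"
  let ?R = "poly_ring U :: ('v, 'k) mpoly ring"
  define I where "I = carrier ?R \<inter> face_ideal \<Delta>"
  define J where "J = carrier ?R \<inter> face_ideal \<Gamma>"
  define M where "M = quotient_module (ideal_module ?R I) J"
  have W: "finite W" "\<Gamma> \<subseteq> Pow W" using assms(3) by (simp_all add: simplicial_complex_def)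
  then have UW: "U \<subseteq> W" unfolding U_def by blast
  have Ufin: "finite U" by (rule finite_subset[OF UW W(1)])
  have \<Gamma>U: "\<Gamma> \<subseteq> Pow U" by (auto simp: U_def)
  have scU: "simplicial_complex U \<Gamma>" "simplicial_complex U \<Delta>"
    using assms(1,3,6) Ufin \<Gamma>U by (simp_all add: simplicial_complex_def)
  have M: "relative_SR_module TYPE('k) U \<Gamma> \<Delta> = M"
    by (simp add: relative_SR_module_def M_def I_def J_def SR_ideal_eq scU)
  have down: "\<tau> \<in> \<Delta>" if "\<sigma> \<in> \<Delta>" "\<tau> \<subseteq> \<sigma>" for \<sigma> \<tau> using that scU(2) unfolding simplicial_complex_def by blast
  have down': "\<tau> \<in> \<Gamma>" if "\<sigma> \<in> \<Gamma>" "\<tau> \<subseteq> \<sigma>" for \<sigma> \<tau> using that scU(1) unfolding simplicial_complex_def by blast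
  have rI: "is_ideal (face_ideal \<Delta> :: ('v, 'k) mpoly set)" by (rule is_ideal_face_ideal) (rule down)
  have rJ: "is_ideal (face_ideal \<Gamma> :: ('v, 'k) mpoly set)" by (rule is_ideal_face_ideal) (rule down')
  have I: "ideal I ?R" and J: "ideal J ?R"
    unfolding I_def J_def by (intro ideal_carrier_Int rI rJ)+
  have JI: "J \<subseteq> I" unfolding I_def J_def using face_ideal_anti[OF assms(6)] by blast
  show ?thesis
  proof (cases "\<Delta> = \<Gamma>")
    case True
    note q = quotient_module_map[OF module_ideal_module[OF cring_poly_ring I] submodule_ideal_module[OF I J JI]]
    have "carrier (ideal_module ?R I) = J" using True by (simp add: ideal_module_def I_def J_def)
    then have "carrier M = {\<zero>\<^bsub>M\<^esub>}"
      using q(1-3) ideal_poly_ringD(2)[OF J] unfolding M_def by auto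
    then show ?thesis
      by (simp add: relative_cohen_macaulay_def cohen_macaulay_module_def M flip: U_def)
  next
    case False
    then have proper: "\<Delta> \<subset> \<Gamma>" using assms(6) by blast
    have finG: "finite \<Gamma>" "finite \<Delta>"
      using scU finite_subset unfolding simplicial_complex_def by (metis finite_Pow_iff)+
    have face_fin: "finite \<sigma>" if "\<sigma> \<in> \<Gamma>" for \<sigma>
      using that Ufin finite_subset[of \<sigma> U] unfolding U_def by blast
    obtain G where G: "G \<in> \<Gamma>" "\<And>\<sigma>. \<sigma> \<in> \<Gamma> \<Longrightarrow> card \<sigma> \<le> card G"
    proof -
      have "Max (card ` \<Gamma>) \<in> card ` \<Gamma>" using finG proper by (intro Max_in) auto
      then obtain G where "G \<in> \<Gamma>" "card G = Max (card ` \<Gamma>)" by auto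
      then show thesis using finG by (intro that[of G]) auto
    qed
    define D where "D = card G"
    have dimG: "complex_dim \<Gamma> = ereal (real D - 1)" using complex_dim_eq[OF G] by (simp add: D_def)
    \<comment> \<open>The void complex has dimension \<open>- \<infinity>\<close>, unlike \<open>\<Gamma>\<close>.\<close>
    have "\<Delta> \<noteq> {}" using dimG assms(5) by (auto simp: complex_dim_def bot_ereal_def)
    obtain F where F: "F \<in> \<Delta>" "\<And>\<sigma>. \<sigma> \<in> \<Delta> \<Longrightarrow> card \<sigma> \<le> card F"
    proof -
      have "Max (card ` \<Delta>) \<in> card ` \<Delta>" using finG \<open>\<Delta> \<noteq> {}\<close> by (intro Max_in) auto
      then obtain F where "F \<in> \<Delta>" "card F = Max (card ` \<Delta>)" by auto
      then show thesis using finG by (intro that[of F]) auto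
    qed
    have cardF: "card F = D" using complex_dim_eq[OF F] dimG assms(5) by simp
    have D: "card \<sigma> \<le> D" if "\<sigma> \<in> \<Gamma>" for \<sigma> using G(2)[OF that] by (simp add: D_def)
    have krull: "ereal (real D) \<le> krull_dim (SR_ring TYPE('k) Y X)"
      if X: "simplicial_complex Y X" "H \<in> X" "card H = D" for X H and Y :: "'v set"
    proof -
      have Y: "finite Y" "X \<subseteq> Pow Y" "\<forall>\<sigma>\<in>X. \<forall>\<tau>. \<tau> \<subseteq> \<sigma> \<longrightarrow> \<tau> \<in> X"
        using X(1) by (simp_all add: simplicial_complex_def)
      have HY: "H \<subseteq> Y" using Y(2) X(2) by blast
      moreover have "finite H" by (rule finite_subset[OF HY Y(1)])
      moreover have "SR_ideal Y X \<subseteq> (face_ideal (Pow H) :: ('v, 'k) mpoly set)"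
      proof -
        have "Pow H \<subseteq> X" using Y(3) X(2) by blast
        from face_ideal_anti[OF this] show ?thesis unfolding SR_ideal_eq[OF X(1)] by blast
      qed
      ultimately show ?thesis
        unfolding SR_ring_def using krull_dim_ge[OF ideal_SR_ideal, of H Y X] X(3) by simp
    qed

    let ?ys = "rev (map (esym U) [1..<Suc D]) :: ('v, 'k) mpoly list"
    have exact_\<Gamma>: "exact_at UNIV (face_ideal \<Gamma>) ?ys i" if i: "i < D" for i
    proof -
      have "ereal (real D) \<le> SR_depth TYPE('k) W \<Gamma>"
        using assms(4) krull[OF assms(3) G(1)] by (simp add: cohen_macaulay_complex_def D_def)
      then obtain fs where "set fs \<subseteq> irrelevant_ideal W"
        "regular_sequence (poly_ring W) (SR_module TYPE('k) W \<Gamma>) fs" "D \<le> length fs"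
        unfolding SR_depth_def using depth_ge_imp_regular_sequence by blast
      then show ?thesis
        using i by (intro regular_sequence_imp_exact[OF assms(3) order_refl Ufin \<Gamma>U D]) auto
    qed
    have exact_\<Delta>: "exact_at UNIV (face_ideal \<Delta>) ?ys i" if i: "Suc i < D" for i
    proof -
      have "ereal (real (D - 1)) = ereal (real D) - 1" using i by (simp add: of_nat_diff one_ereal_def)
      also have "\<dots> \<le> krull_dim (SR_ring TYPE('k) V \<Delta>) - 1"
        by (rule ereal_minus_mono[OF krull[OF assms(1) F(1) cardF] order_refl])
      also have "\<dots> \<le> SR_depth TYPE('k) V \<Delta>" by (rule assms(2))
      finally obtain fs where "set fs \<subseteq> irrelevant_ideal V"
        "regular_sequence (poly_ring V) (SR_module TYPE('k) V \<Delta>) fs" "D - 1 \<le> length fs"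
        unfolding SR_depth_def using depth_ge_imp_regular_sequence by blast
      then show ?thesis
        using i by (intro regular_sequence_imp_exact[OF assms(1,6) Ufin \<Gamma>U D]) auto
    qed
    have exact: "exact_at (face_ideal \<Delta>) (face_ideal \<Gamma>) ?ys i" if i: "i < D" for i
      by (rule exact_kernel[OF is_ideal_UNIV rJ rI face_ideal_anti[OF assms(6)] subset_UNIV exact_\<Gamma>[OF i]])
        (use i exact_\<Delta> in auto)

    let ?es = "map (esym U) [1..<Suc D] :: ('v, 'k) mpoly list"
    have es_irr: "set ?es \<subseteq> irrelevant_ideal U" by (auto intro!: esym_irrelevant[OF Ufin])
    then have esC: "set ?es \<subseteq> carrier ?R" using ideal_poly_ringD(1)[OF irrelevant_ideal_ideal] by blast
    have "\<exists>n. total_degree.homogeneous n z \<and> n > 0" if z: "z \<in> set ?ys" for z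
    proof -
      obtain n where "n \<in> set [1..<Suc D]" "z = esym U n"
        using z unfolding set_rev set_map by (rule imageE)
      then show ?thesis using homogeneous_esym[OF Ufin, of n] by (intro exI[of _ n]) auto
    qed
    then obtain d where "\<forall>z\<in>set ?ys. total_degree.homogeneous (d z) z \<and> d z > 0" by metis
    then have "regular (face_ideal \<Delta>) (face_ideal \<Gamma>) (rev ?ys)"
      by (rule total_degree.exact_imp_regular[OF rI graded_face_ideal rJ graded_face_ideal])
        (use exact in \<open>simp del: upt_Suc\<close>)
    then have "regular (face_ideal \<Delta>) (face_ideal \<Gamma>) ?es" by (simp del: upt_Suc)
    \<comment> \<open>Back to the finitely many variables in \<open>U\<close>.\<close>
    also have "regular (face_ideal \<Delta>) (face_ideal \<Gamma>) ?es \<longleftrightarrow> regular I (I \<inter> face_ideal \<Gamma>) ?es"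
    proof (rule regular_Int[symmetric])
      show "I \<subseteq> face_ideal \<Delta>" by (simp add: I_def)
      show "face_ideal \<Gamma> \<subseteq> (face_ideal \<Delta> :: ('v, 'k) mpoly set)" by (rule face_ideal_anti[OF assms(6)])
      show "x + y \<in> I" if "x \<in> I" "y \<in> I" for x y using that by (rule ideal_poly_ringD(3)[OF I])
      show "- x \<in> I" if "x \<in> I" for x using that by (rule ideal_poly_ringD(4)[OF I])
      show "f * x \<in> I" if "f \<in> set ?es" "x \<in> I" for f x
        using that esC by (intro ideal_poly_ringD(5)[OF I]) auto
      show "\<exists>a'\<in>I. a - a' \<in> face_ideal \<Gamma>" if "a \<in> face_ideal \<Delta>" for a
        using face_decomposition[OF \<Gamma>U, of a] that unfolding I_def face_ideal_def by blast
    qed (rule rI rJ)+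
    also have "I \<inter> face_ideal \<Gamma> = J"
      unfolding I_def J_def using face_ideal_anti[OF assms(6)] by blast
    finally have reg_es: "regular I J ?es" .
    have top_es: "foldl (adjoin I) J ?es \<noteq> I"
      unfolding I_def J_def by (rule adjoin_irrelevant_proper[OF scU(1) proper es_irr])
    have rs_iff: "regular_sequence ?R M fs \<longleftrightarrow> regular I J fs \<and> foldl (adjoin I) J fs \<noteq> I"
      if "set fs \<subseteq> carrier ?R" for fs
      unfolding M_def by (rule regular_sequence_iff[OF I J JI that])

    have depth: "depth ?R (irrelevant_ideal U) M = ereal (real D)"
    proof (rule antisym)
      have "regular_sequence ?R M ?es" using rs_iff[OF esC] reg_es top_es by simp
      moreover have "length ?es = D" by simp
      ultimately show "ereal (real D) \<le> depth ?R (irrelevant_ideal U) M"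
        unfolding depth_def using es_irr by (intro Sup_upper CollectI exI[of _ ?es]) simp
      show "depth ?R (irrelevant_ideal U) M \<le> ereal (real D)"
        unfolding depth_def
      proof (intro Sup_least, clarify)
        fix fs assume fs: "set fs \<subseteq> irrelevant_ideal U" "regular_sequence ?R M fs"
        then have fsC: "set fs \<subseteq> carrier ?R" using ideal_poly_ringD(1)[OF irrelevant_ideal_ideal] by blast
        have ann: "z * a \<in> J" if "z \<in> carrier ?R \<inter> face_ideal \<Gamma>" "a \<in> I" for z a
          using ideal_poly_ringD(5)[OF J, of a z] that ideal_poly_ringD(1)[OF I]
          by (auto simp: J_def mult.commute)
        have "length fs \<le> D"
          using regular_length_bound[OF I J JI fsC _ _ finG(1) _ ann, of D] fs rs_iff[OF fsC] face_fin D by blast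
        then show "ereal (real (length fs)) \<le> ereal (real D)" by simp
      qed
    qed

    \<comment> \<open>Otherwise the ideal of the complex generated by \<open>\<Gamma> - \<Delta>\<close>, which annihilates \<open>M\<close>, would bound
      the depth of \<open>M\<close> by \<open>D - 1\<close>.\<close>
    have "\<exists>H\<in>\<Gamma> - \<Delta>. card H = D"
    proof (rule ccontr)
      assume "\<not> ?thesis"
      then have less: "card H < D" if "H \<in> \<Gamma> - \<Delta>" for H using D[of H] that le_neq_implies_less by blast
      define X where "X = {\<sigma>. \<exists>\<tau>\<in>\<Gamma> - \<Delta>. \<sigma> \<subseteq> \<tau>}"
      have X\<Gamma>: "X \<subseteq> \<Gamma>" using down' by (auto simp: X_def)
      have X: "finite \<sigma> \<and> card \<sigma> \<le> D - 1" if "\<sigma> \<in> X" for \<sigma>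
      proof -
        obtain \<tau> where "\<tau> \<in> \<Gamma> - \<Delta>" "\<sigma> \<subseteq> \<tau>" using \<open>\<sigma> \<in> X\<close> by (auto simp: X_def)
        then show ?thesis using less[of \<tau>] card_mono[of \<tau> \<sigma>] face_fin[of \<tau>] finite_subset[of \<sigma> \<tau>] by auto
      qed
      have "z * a \<in> J" if z: "z \<in> carrier ?R \<inter> face_ideal X" and a: "a \<in> I" for z a
      proof -
        have "keys m \<notin> \<Gamma>" if m: "m \<in> keys (z * a)" for m
        proof
          assume mG: "keys m \<in> \<Gamma>"
          obtain k l where kl: "m = k + l" "k \<in> keys z" "l \<in> keys a" using m keys_mult[of z a] by blast
          have "keys l \<notin> \<Delta>" using a kl(3) by (auto simp: I_def face_ideal_def)
          then have "keys m \<notin> \<Delta>" using down[of "keys m" "keys l"] kl(1) by (auto simp: keys_add_nat)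
          then have "keys k \<in> X" unfolding X_def using mG kl(1) by (auto simp: keys_add_nat)
          then show False using z kl(2) by (auto simp: face_ideal_def)
        qed
        moreover have "z * a \<in> carrier ?R" using z a by (auto simp: I_def poly_ring_closed)
        ultimately show ?thesis by (auto simp: J_def face_ideal_def)
      qed
      then have "length ?es \<le> D - 1"
        using regular_length_bound[OF I J JI esC reg_es top_es, of X "D - 1"] X finite_subset[OF X\<Gamma> finG(1)] by blast
      then have "D = 0" by (simp del: upt_Suc)
      then show False using less proper by blast
    qed
    then obtain H where H: "H \<in> \<Gamma>" "H \<notin> \<Delta>" "card H = D" by blast

    let ?A = "{r \<in> carrier ?R. \<forall>a\<in>I. r * a \<in> J}"
    have A: "annihilator ?R M = ?A" unfolding M_def by (rule annihilator_relative[OF I J JI])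
    have Ai: "ideal ?A ?R" by (rule ideal_colon[OF I J])
    have dim: "module_dim ?R M = ereal (real D)"
      unfolding module_dim_def A
    proof (rule antisym)
      have "carrier ?R \<inter> face_ideal \<Gamma> \<subseteq> ?A"
      proof
        fix z assume "z \<in> carrier ?R \<inter> face_ideal \<Gamma>"
        then show "z \<in> ?A"
          using ideal_poly_ringD(5)[OF J, of _ z] ideal_poly_ringD(1)[OF I] by (auto simp: J_def mult.commute)
      qed
      then show "krull_dim (?R Quot ?A) \<le> ereal (real D)"
        using krull_dim_le[OF Ai _ finG(1), of D] face_fin D by blast
      have HU: "finite H" "H \<subseteq> U" using face_fin[OF H(1)] H(1) \<Gamma>U by auto
      have "?A \<subseteq> face_ideal (Pow H)"
      proof
        fix r assume r: "r \<in> ?A"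
        have "single (squarefree_monomial H) 1 \<in> I"
          using HU H(2) by (auto simp: I_def carrier_poly_ring face_ideal_def keys_squarefree_monomial)
        then have rJ: "r * single (squarefree_monomial H) 1 \<in> face_ideal \<Gamma>" using r by (auto simp: J_def)
        have "\<not> keys m \<subseteq> H" if m: "m \<in> keys r" for m
        proof
          assume mH: "keys m \<subseteq> H"
          have "m + squarefree_monomial H \<in> keys (r * single (squarefree_monomial H) 1)"
            using m by (simp add: in_keys_iff lookup_mult_single)
          moreover have "keys (m + squarefree_monomial H) = H" using mH HU by (auto simp: keys_add_nat keys_squarefree_monomial)
          ultimately show False using rJ H(1) by (auto simp: face_ideal_def)
        qed
        then show "r \<in> face_ideal (Pow H)" by (simp add: face_ideal_def)
      qed
      then show "ereal (real D) \<le> krull_dim (?R Quot ?A)"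
        using krull_dim_ge[OF Ai HU] H(3) by simp
    qed
    show ?thesis
      unfolding relative_cohen_macaulay_def cohen_macaulay_module_def U_def[symmetric] M depth dim by simp
  qed
qed

end
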